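(* Let $(V_t)_{t\ge 0}$ be a generalized Ornstein--Uhlenbeck process satisfying the tail condition with index $\alpha>0$ and the moment condition. Let $0<a_n\uparrow\infty$ be a sequence of constants such that $\lim_{n\to\infty}n\mathbb{P}(V_0>a_nx)=x^{-\alpha}$ for $x>0$. Let $h>0$, $H_k=\sup_{(k-1)h\le t\le kh}V_t$ for $k\in\mathbb{N}$, and suppose the asymptotic independence condition $\mathcal{A}(a_n)$ holds for $(H_k)_{k\in\mathbb{N}}$. Define $M(n):=\sup_{0\le t\le n}V_t$ for $n>0$. Then $$\lim_{n\to\infty}\mathbb{P}(a_n^{-1}M(n)\le x)=\exp\left(-\mathbb{E}\Big(\sup_{0\le s\le1}e^{-\alpha\xi_s}-\sup_{s\ge1}e^{-\alpha\xi_s}\Big)^+x^{-\alpha}\right)\quad\text{for }x>0.$$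
   Context: Setting: $(\xi_t,\eta_t,L_t)_{t\ge0}$ is a three-dimensional Lévy process independent of the random variable $V_0$; $(\eta_t)_{t\ge 0}$ is a subordinator (a positive Lévy process) and $(-L_t)_{t\ge0}$ is not a subordinator. $\int_a^b$ is the integral over $(a,b]$. The generalized Ornstein--Uhlenbeck process is $V_t=e^{-\xi_t}\left(\int_0^t e^{\xi_{s-}}\,\mathrm{d}\eta_s+V_0\right)$, $t\ge0$. Put $\Psi_\xi(v)=\log\mathbb{E}(e^{-v\xi_1})$ for $v>0$ whenever $\mathbb{E}(e^{-v\xi_1})<\infty$. $x^+=\max\{x,0\}$. Tail condition: $(V_t)_{t\ge0}$ is a stationary positive càdlàg version of the generalized Ornstein--Uhlenbeck process, and $\mathbb{P}(V_0>x)\sim Cx^{-\alpha}$ as $x\to\infty$ for some $C>0$, with $\alpha>0$. Moment condition: for the same $\alpha>0$ there is $d>\alpha$ such that $\Psi_\xi(\alpha)=0$, $\Psi_\xi(d)<\infty$, and $\mathbb{E}\left|e^{-\xi_{h_0}}\int_0^{h_0}e^{\xi_{s-}}\,\mathrm{d}\eta_s\right|^d<\infty$ for some $h_0>0$. Asymptotic independence condition $\mathcal{A}(c_n)$ for a strictly stationary sequence $(\mathbf{Y}_k)$ of regularly varying $\mathbb{R}^q$-valued random vectors and constants $0<c_n\uparrow\infty$ with $\lim_{n}n\mathbb{P}(|\mathbf{Y}_1|_\infty>c_n)=C'$ for some $C'>0$: there exist positive integers $(r_n)$ with $r_n\to\infty$, $r_n/n\to0$ such that $$\mathbb{E}\exp\Big(-\sum_{j=1}^nf(\mathbf{Y}_j/c_n)\Big)-\Big[\mathbb{E}\exp\Big(-\sum_{j=1}^{r_n}f(\mathbf{Y}_j/c_n)\Big)\Big]^{\lfloor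 n/r_n\rfloor}\to0\quad(n\to\infty)$$ for all bounded non-negative step functions $f$ on $\overline{\mathbb{R}}^q\setminus\{\mathbf{0}\}$ with bounded support (bounded subsets of $\overline{\mathbb{R}}^q\setminus\{\mathbf 0\}$ being those bounded away from $\mathbf{0}$; $\overline{\mathbb{R}}=\mathbb{R}\cup\{\pm\infty\}$). Here $|\cdot|_\infty$ is the maximum norm; a random vector $\mathbf{X}$ in $\mathbb{R}^q$ is regularly varying with index $a>0$ if there is a random vector $\Theta$ on $\{|\mathbf{x}|_\infty=1\}$ such that for every $x>0$, $\mathbb{P}(|\mathbf{X}|_\infty>ux,\mathbf{X}/|\mathbf{X}|_\infty\in\cdot)/\mathbb{P}(|\mathbf{X}|_\infty>u)\Rightarrow x^{-a}\mathbb{P}(\Theta\in\cdot)$ as $u\to\infty$. *)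

theory Defs
  imports "HOL-Probability.Probability" "HOL-Library.Landau_Symbols"
begin

definition cadlag :: "(real \<Rightarrow> 'b::topological_space) \<Rightarrow> bool" where
  "cadlag f \<longleftrightarrow>
     (\<forall>t\<ge>0. continuous (at_right t) f) \<and>
     (\<forall>t>0. \<exists>l. (f \<longlongrightarrow> l) (at_left t))"

text \<open>
  Processes are indexed by all reals, but only the times \<open>t \<ge> 0\<close> are ever used.
  Stochastic continuity is not listed because it follows from stationary increments, \<open>X 0 = 0\<close>
  and right-continuity at 0. Path properties are required almost surely only.
\<close>

definition levy_process :: "'a measure \<Rightarrow> (real \<Rightarrow> 'a \<Rightarrow> 'b::euclidean_space) \<Rightarrow> bool" where
  "levy_process M X \<longleftrightarrow>
     prob_space M \<and>
     (\<forall>t\<ge>0. X t \<in> borel_measurable M) \<and>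
     (AE \<omega> in M. X 0 \<omega> = 0) \<and>
     (\<forall>(n::nat) (t::nat \<Rightarrow> real). 0 \<le> t 0 \<and> (\<forall>i<n. t i \<le> t (Suc i)) \<longrightarrow>
        prob_space.indep_vars M (\<lambda>_. borel) (\<lambda>i \<omega>. X (t (Suc i)) \<omega> - X (t i) \<omega>) {..<n}) \<and>
     (\<forall>s\<ge>0. \<forall>t\<ge>0. distr M borel (\<lambda>\<omega>. X (s + t) \<omega> - X s \<omega>) = distr M borel (X t)) \<and>
     (AE \<omega> in M. cadlag (\<lambda>t. X t \<omega>))"

text \<open>
  A positive Levy process; since its increments are stationary, its paths are then almost surely
  nondecreasing.
\<close>

definition subordinator :: "'a measure \<Rightarrow> (real \<Rightarrow> 'a \<Rightarrow> real) \<Rightarrow> bool" where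
  "subordinator M \<eta> \<longleftrightarrow> levy_process M \<eta> \<and> (\<forall>t\<ge>0. AE \<omega> in M. 0 \<le> \<eta> t \<omega>)"

text \<open>
  The integral of \<open>exp (\<xi>(s-))\<close> with respect to \<open>\<eta>\<close> over \<open>(0,t]\<close>. As \<open>\<eta>\<close> is a subordinator, the
  stochastic integral is the pathwise Lebesgue-Stieltjes integral. The path of \<open>\<eta>\<close> is extended to
  negative times as a constant, so the Stieltjes measure lives on \<open>(0,\<infinity>)\<close>.
\<close>

definition exp_integral ::
    "(real \<Rightarrow> 'a \<Rightarrow> real) \<Rightarrow> (real \<Rightarrow> 'a \<Rightarrow> real) \<Rightarrow> real \<Rightarrow> 'a \<Rightarrow> real" where
  "exp_integral \<xi> \<eta> t \<omega> =
     (LINT s:{0<..t}|interval_measure (\<lambda>u. \<eta> (max 0 u) \<omega>). exp (Lim (at_left s) (\<lambda>u. \<xi> u \<omega>)))"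

text \<open>
  \<open>V\<close> is a version of the generalized Ornstein-Uhlenbeck process driven by \<open>(\<xi>, \<eta>)\<close> and started
  in \<open>V 0\<close>.
\<close>

definition gen_OU ::
    "'a measure \<Rightarrow> (real \<Rightarrow> 'a \<Rightarrow> real) \<Rightarrow> (real \<Rightarrow> 'a \<Rightarrow> real) \<Rightarrow> (real \<Rightarrow> 'a \<Rightarrow> real) \<Rightarrow> bool" where
  "gen_OU M \<xi> \<eta> V \<longleftrightarrow>
     (\<forall>t\<ge>0. V t \<in> borel_measurable M) \<and>
     (\<forall>t\<ge>0. AE \<omega> in M. V t \<omega> = exp (- \<xi> t \<omega>) * (exp_integral \<xi> \<eta> t \<omega> + V 0 \<omega>))"

definition stationary :: "'a measure \<Rightarrow> (real \<Rightarrow> 'a \<Rightarrow> real) \<Rightarrow> bool" where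
  "stationary M V \<longleftrightarrow>
     (\<forall>I u. finite I \<and> I \<subseteq> {0..} \<and> 0 \<le> u \<longrightarrow>
        distr M (PiM I (\<lambda>_. borel)) (\<lambda>\<omega>. \<lambda>t\<in>I. V (t + u) \<omega>) =
        distr M (PiM I (\<lambda>_. borel)) (\<lambda>\<omega>. \<lambda>t\<in>I. V t \<omega>))"

text \<open>
  All paths of the chosen version are cadlag, which makes suprema over intervals finite and
  measurable without completing \<open>M\<close>. Positivity is understood in the weak sense, as for
  subordinators.
\<close>

definition tail_condition ::
    "'a measure \<Rightarrow> (real \<Rightarrow> 'a \<Rightarrow> real) \<Rightarrow> (real \<Rightarrow> 'a \<Rightarrow> real) \<Rightarrow> (real \<Rightarrow> 'a \<Rightarrow> real) \<Rightarrow> real \<Rightarrow> bool"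
  where
  "tail_condition M \<xi> \<eta> V \<alpha> \<longleftrightarrow>
     gen_OU M \<xi> \<eta> V \<and> stationary M V \<and>
     (AE \<omega> in M. \<forall>t\<ge>0. 0 \<le> V t \<omega>) \<and>
     (\<forall>\<omega>\<in>space M. cadlag (\<lambda>t. V t \<omega>)) \<and>
     0 < \<alpha> \<and>
     (\<exists>C>0. (\<lambda>x. measure M {\<omega> \<in> space M. V 0 \<omega> > x}) \<sim>[at_top] (\<lambda>x. C * x powr (- \<alpha>)))"

definition Psi :: "'a measure \<Rightarrow> (real \<Rightarrow> 'a \<Rightarrow> real) \<Rightarrow> real \<Rightarrow> ereal" where
  "Psi M \<xi> v =
     (if integrable M (\<lambda>\<omega>. exp (- v * \<xi> 1 \<omega>))
      then ereal (ln (\<integral>\<omega>. exp (- v * \<xi> 1 \<omega>) \<partial>M)) else \<infinity>)"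

definition moment_condition ::
    "'a measure \<Rightarrow> (real \<Rightarrow> 'a \<Rightarrow> real) \<Rightarrow> (real \<Rightarrow> 'a \<Rightarrow> real) \<Rightarrow> real \<Rightarrow> bool" where
  "moment_condition M \<xi> \<eta> \<alpha> \<longleftrightarrow>
     0 < \<alpha> \<and>
     (\<exists>d>\<alpha>. Psi M \<xi> \<alpha> = 0 \<and> Psi M \<xi> d < \<infinity> \<and>
        (\<exists>h0>0. (\<integral>\<^sup>+\<omega>. ennreal (\<bar>exp (- \<xi> h0 \<omega>) * exp_integral \<xi> \<eta> h0 \<omega>\<bar> powr d) \<partial>M) < \<infinity>))"

text \<open>
  Nonnegative step functions on the extended real line without 0, with support bounded away from 0:
  finite linear combinations of indicators of arbitrary intervals (open, closed or half-open, hence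
  described as the order-convex sets). They are extended by the value 0 to the point 0.
\<close>

definition step_fun :: "(ereal \<Rightarrow> real) \<Rightarrow> bool" where
  "step_fun f \<longleftrightarrow>
     (\<exists>(m::nat) (c::nat \<Rightarrow> real) (J::nat \<Rightarrow> ereal set).
        (\<forall>i<m. \<forall>x\<in>J i. \<forall>y\<in>J i. {x..y} \<subseteq> J i) \<and>
        (\<forall>y. f y = (\<Sum>i<m. c i * indicator (J i) y))) \<and>
     (\<forall>y. 0 \<le> f y) \<and>
     (\<exists>\<epsilon>>0. \<forall>y. \<bar>y\<bar> \<le> ereal \<epsilon> \<longrightarrow> f y = 0)"

text \<open>The asymptotic independence condition for a real-valued sequence \<open>Y 1, Y 2, \<dots>\<close>.\<close>

definition asymp_indep :: "'a measure \<Rightarrow> (nat \<Rightarrow> 'a \<Rightarrow> real) \<Rightarrow> (nat \<Rightarrow> real) \<Rightarrow> bool" where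
  "asymp_indep M Y c \<longleftrightarrow>
     (\<exists>r::nat \<Rightarrow> nat.
        (\<forall>n. 0 < r n) \<and>
        filterlim r at_top sequentially \<and>
        (\<lambda>n. real (r n) / real n) \<longlonglongrightarrow> 0 \<and>
        (\<forall>f. step_fun f \<longrightarrow>
           (\<lambda>n. (\<integral>\<omega>. exp (- (\<Sum>j=1..n. f (ereal (Y j \<omega> / c n)))) \<partial>M)
              - (\<integral>\<omega>. exp (- (\<Sum>j=1..r n. f (ereal (Y j \<omega> / c n)))) \<partial>M) ^ (n div r n))
             \<longlonglongrightarrow> 0))"

text \<open>
  The expectation of the positive part of the difference of the two suprema, the suprema being
  taken in \<open>[0,\<infinity>]\<close>. Subtraction on \<^typ>\<open>ennreal\<close> is truncated at 0, so it is the positive part. The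
  nonnegative integral is insensitive to changes on null sets even for non-measurable integrands,
  so almost sure path regularity of \<open>\<xi>\<close> suffices.
\<close>

definition sup_decrease_mean :: "'a measure \<Rightarrow> (real \<Rightarrow> 'a \<Rightarrow> real) \<Rightarrow> real \<Rightarrow> real" where
  "sup_decrease_mean M \<xi> \<alpha> =
     enn2real (\<integral>\<^sup>+\<omega>. (SUP s\<in>{0..1}. ennreal (exp (- \<alpha> * \<xi> s \<omega>)))
                    - (SUP s\<in>{1..}. ennreal (exp (- \<alpha> * \<xi> s \<omega>))) \<partial>M)"

end

(*
  Write V_t = exp(-(xi_t - xi_s)) V_s + B_{s,t}, where B_{s,t} >= 0 is a functional of the increments
  of (xi, eta) after s, hence independent of the past up to s. Hence V cannot drop quickly, and an
  Ottaviani type inequality bounds tails of suprema over bounded intervals by the tail of V_0.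
  Since E exp(-alpha xi_m) = 1, Breiman's lemma shows that exp(-xi_m) V_0 and V_m have the same tail
  C u^(-alpha); this forces P(B_{0,m} > u) = o(u^(-alpha)), and so
  u^alpha P(sup_K V > u) tends to C E sup_K exp(-alpha xi) for K = [0,m] and K = [1,m].
  By stationarity P(sup_[0,N] V > u) = P(V_0 > u) + sum_{m=1..N} P(sup_[0,1] V > u, sup_[1,m] V <= u),
  a sum with decreasing terms. An anti-clustering estimate, based on E exp(-alpha xi_1 / 2) < 1, gives
  (n/N) P(sup_[0,N] V > x a_n) -> x^(-alpha) E(...)^+ whenever N -> oo and N/n -> 0; if instead
  E exp(-alpha xi_1 / 2) = 1, then xi = 0 and both sides vanish.
  Condition A(a_n), applied to the step functions K 1_(y,oo] and K -> oo, turns this into the limit of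
  P(sup_[0,nh] V <= y a_n), and a_n / a_[n/h] -> h^(1/alpha) removes h.
*)
theory Submission
  imports Defs
begin

section \<open>Dyadic times\<close>

text \<open>The affine identity for \<open>V\<close> holds almost surely at each fixed time, with a
  null set depending on the time, so the pathwise arguments run over countably many times. Dyadic
  times are chosen because their grids are nested: events of increments at one level form a
  sigma-algebra that grows with the level, and left-point Stieltjes sums on the grids are functions
  of finitely many increments. In this way B_{s,t} is measurable for the increments after s without
  completing the measure; continuous time returns only at the end, by right-continuity. The maximal
  inequality costs a factor 2 and lowers the level by exp(-b). It is therefore applied only where an
  order of magnitude suffices: to power bounds, to terms of smaller order, and to clustering. Exact
  constants come from Breiman's lemma alone. Step functions in condition A are real-valued, so the
  absence of exceedances enters only up to an error exp(-K), and n must tend to infinity before K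
  does. Blocks are counted in units of h; the limit over them carries a factor h in the exponent,
  which the change of norming cancels.\<close>

definition dyadics :: "real set" where
  "dyadics = {real i / 2 ^ n | i n. True}"

lemma dyadics_common_level:
  assumes "s \<in> dyadics" "t \<in> dyadics"
  obtains i j n where "s = real i / 2 ^ n" "t = real j / 2 ^ n"
proof -
  obtain i n j m where "s = real i / 2 ^ n" "t = real j / 2 ^ m"
    using assms by (auto simp: dyadics_def)
  then have "s = real (i * 2 ^ m) / 2 ^ (n + m)" "t = real (j * 2 ^ n) / 2 ^ (n + m)"
    by (simp_all add: power_add field_simps)
  then show ?thesis by (rule that)
qed

lemma dyadicsI: "real i / 2 ^ n \<in> dyadics"
  by (auto simp: dyadics_def)

lemma of_nat_dyadics: "real i \<in> dyadics"
  using dyadicsI[of i 0] by simp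

lemma zero_dyadics: "0 \<in> dyadics" and one_dyadics: "1 \<in> dyadics"
  using of_nat_dyadics[of 0] of_nat_dyadics[of 1] by simp_all

lemma dyadics_nonneg: "s \<in> dyadics \<Longrightarrow> 0 \<le> s"
  by (auto simp: dyadics_def)

lemma dyadics_add:
  assumes "s \<in> dyadics" "t \<in> dyadics" shows "s + t \<in> dyadics"
proof -
  obtain i j n where "s = real i / 2 ^ n" "t = real j / 2 ^ n"
    using assms by (rule dyadics_common_level)
  then have "s + t = real (i + j) / 2 ^ n" by (simp add: add_divide_distrib)
  then show ?thesis by (simp only: dyadicsI)
qed

lemma dyadics_diff:
  assumes "s \<in> dyadics" "t \<in> dyadics" "s \<le> t" shows "t - s \<in> dyadics"
proof -
  obtain i j n where *: "s = real i / 2 ^ n" "t = real j / 2 ^ n"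
    using assms by (auto elim: dyadics_common_level)
  with assms(3) have "i \<le> j" by (simp add: divide_le_cancel)
  with * have "t - s = real (j - i) / 2 ^ n" by (simp add: diff_divide_distrib of_nat_diff)
  then show ?thesis by (simp only: dyadicsI)
qed

lemma countable_dyadics: "countable dyadics"
proof -
  have "dyadics = (\<lambda>(i, n). real i / 2 ^ n) ` (UNIV :: (nat \<times> nat) set)"
    by (auto simp: dyadics_def)
  then show ?thesis by (metis countableI_type countable_image)
qed

lemma dyadic_between:
  assumes "0 \<le> s" "s < t"
  obtains r where "r \<in> dyadics" "s < r" "r < t"
proof -
  obtain n where n: "1 / (t - s) < 2 ^ n"
    using real_arch_pow[of 2 "1 / (t - s)"] by auto
  define i where "i = nat \<lfloor>s * 2 ^ n\<rfloor> + 1"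
  have i: "s * 2 ^ n < real i" "real i \<le> s * 2 ^ n + 1"
    unfolding i_def using assms(1) by (auto; linarith)+
  have "1 < (t - s) * 2 ^ n" using n assms by (simp add: field_simps)
  with i have "real i < t * 2 ^ n" by (simp add: algebra_simps)
  with i(1) have "s < real i / 2 ^ n" "real i / 2 ^ n < t" by (simp_all add: field_simps)
  then show ?thesis using that dyadicsI by blast
qed

section \<open>Independence of past and future increments\<close>

text \<open>Values lie in a Euclidean space because \<xi> and \<eta> must be handled jointly:
  independence of past and future is needed for functions of both at once. The variable
  \<open>U\<close> stands for the initial value and belongs to the past of every time.\<close>

locale levy_initial = prob_space M for M :: "'a measure" +
  fixes X :: "real \<Rightarrow> 'a \<Rightarrow> 'b::euclidean_space" and U :: "'a \<Rightarrow> real"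
  assumes levy: "levy_process M X"
    and U_measurable [measurable]: "U \<in> borel_measurable M"
    and U_indep: "indep_set
       (sets (vimage_algebra (space M) (\<lambda>\<omega>. \<lambda>t\<in>{0..}. X t \<omega>) (PiM {0..} (\<lambda>_. borel))))
       (sets (vimage_algebra (space M) U borel))"
begin

lemma X_measurable: "0 \<le> t \<Longrightarrow> X t \<in> borel_measurable M"
  using levy by (simp add: levy_process_def)

lemma levy_indep:
  "0 \<le> t 0 \<Longrightarrow> (\<And>i. i < n \<Longrightarrow> t i \<le> t (Suc i)) \<Longrightarrow>
    indep_vars (\<lambda>_. borel) (\<lambda>i \<omega>. X (t (Suc i)) \<omega> - X (t i) \<omega>) {..<n::nat}"
  using levy unfolding levy_process_def by blast

section \<open>Sigma-algebras generated by increments on dyadic grids\<close>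

definition incr_sets :: "nat \<Rightarrow> nat \<Rightarrow> 'a set set" where
  "incr_sets n i =
     {(\<lambda>\<omega>. X (real (Suc i) / 2 ^ n) \<omega> - X (real i / 2 ^ n) \<omega>) -` A \<inter> space M | A. A \<in> sets borel}"

definition grid_sets :: "nat \<Rightarrow> nat set \<Rightarrow> 'a set set" where
  "grid_sets n K = sigma_sets (space M) (\<Union>i\<in>K. incr_sets n i)"

text \<open>A cell with \<open>s\<close> in its interior belongs to neither index set, so the two
  families of increments stay independent at every level; for dyadic \<open>s\<close> no such cell
  is left at fine levels.\<close>

abbreviation before :: "real \<Rightarrow> nat \<Rightarrow> nat set" where
  "before s n \<equiv> {i. real (Suc i) / 2 ^ n \<le> s}"

abbreviation after :: "real \<Rightarrow> nat \<Rightarrow> nat set" where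
  "after s n \<equiv> {i. s \<le> real i / 2 ^ n}"

text \<open>The generator consists of rectangles, an event of \<open>U\<close> met with an event of
  increments at one grid level, because these form a pi-system on which probabilities
  factor.\<close>

definition past :: "real \<Rightarrow> 'a measure" where
  "past s = sigma (space M)
     {U -` A \<inter> space M \<inter> E | A n E. A \<in> sets borel \<and> E \<in> grid_sets n (before s n)}"

text \<open>Only increments after \<open>s\<close> enter, never the values \<open>X t\<close>
  themselves, which depend on the past. The union over the levels is directed, hence again a
  pi-system.\<close>

definition future :: "real \<Rightarrow> 'a measure" where
  "future s = sigma (space M) (\<Union>n. grid_sets n (after s n))"

lemma incr_sets_events: "incr_sets n i \<subseteq> events"
proof -
  have "(\<lambda>\<omega>. X (real (Suc i) / 2 ^ n) \<omega> - X (real i / 2 ^ n) \<omega>) \<in> borel_measurable M"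
    by (intro borel_measurable_diff X_measurable) auto
  then show ?thesis unfolding incr_sets_def by (auto intro: measurable_sets)
qed

lemma grid_sets_events: "grid_sets n K \<subseteq> events"
  unfolding grid_sets_def by (intro sets.sigma_sets_subset UN_least incr_sets_events)

lemma grid_sets_sigma_algebra: "sigma_algebra (space M) (grid_sets n K)"
  unfolding grid_sets_def
  by (rule sigma_algebra_sigma_sets) (use incr_sets_events sets.space_closed in blast)

lemma grid_sets_sets: "sets (sigma (space M) (grid_sets n K)) = grid_sets n K"
  using grid_sets_sigma_algebra by (rule sigma_algebra.sets_measure_of_eq)

lemma Int_stable_grid_sets: "Int_stable (grid_sets n K)"
proof -
  interpret sigma_algebra "space M" "grid_sets n K" by (rule grid_sets_sigma_algebra)
  show ?thesis by (auto simp: Int_stable_def)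
qed

text \<open>Independence of an infinite family concerns its finite subfamilies only; each of them
  sits in an initial segment of cells, where the definition of a Levy process applies to equidistant
  times.\<close>

lemma indep_incr_sets: "indep_sets (incr_sets n) UNIV"
proof (subst indep_sets_finite_index_sets, intro allI impI)
  fix J :: "nat set" assume J: "finite J"
  then obtain k where k: "J \<subseteq> {..<k}" using finite_nat_set_iff_bounded by auto
  have "indep_vars (\<lambda>_. borel) (\<lambda>i \<omega>. X (real (Suc i) / 2 ^ n) \<omega> - X (real i / 2 ^ n) \<omega>) {..<k}"
    by (rule levy_indep) (simp_all add: divide_right_mono)
  then have "indep_sets (incr_sets n) {..<k}"
    unfolding indep_vars_def2 incr_sets_def by simp
  with k show "indep_sets (incr_sets n) J" by (rule indep_sets_mono_index)
qed

lemma Int_stable_incr_sets: "Int_stable (incr_sets n i)"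
proof (rule Int_stableI)
  let ?f = "\<lambda>\<omega>. X (real (Suc i) / 2 ^ n) \<omega> - X (real i / 2 ^ n) \<omega>"
  fix a b assume "a \<in> incr_sets n i" "b \<in> incr_sets n i"
  then obtain A B where "A \<in> sets borel" "B \<in> sets borel"
    "a = ?f -` A \<inter> space M" "b = ?f -` B \<inter> space M"
    unfolding incr_sets_def by blast
  then have "a \<inter> b = ?f -` (A \<inter> B) \<inter> space M" "A \<inter> B \<in> sets borel" by auto
  then show "a \<inter> b \<in> incr_sets n i" unfolding incr_sets_def by blast
qed

lemma indep_grid_sets: "indep_set (grid_sets n (before s n)) (grid_sets n (after s n))"
proof -
  have "indep_sets (\<lambda>j. sigma_sets (space M) (\<Union>i\<in>case_bool (before s n) (after s n) j. incr_sets n i)) UNIV"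
  proof (rule indep_sets_collect_sigma)
    show "indep_sets (incr_sets n) (\<Union>j. case j of True \<Rightarrow> before s n | False \<Rightarrow> after s n)"
      by (rule indep_sets_mono_index[OF _ indep_incr_sets]) simp
    have "real i / 2 ^ n < real (Suc i) / 2 ^ n" for i
      by (rule divide_strict_right_mono) simp_all
    then have "before s n \<inter> after s n = {}"
      by (auto simp del: of_nat_Suc simp: not_le[symmetric] dest: order_trans)
    then show "disjoint_family (case_bool (before s n) (after s n))"
      unfolding disjoint_family_on_def by (auto split: bool.split)
  qed (rule Int_stable_incr_sets)
  then show ?thesis
    unfolding indep_set_def grid_sets_def
    by (rule back_subst[of "\<lambda>F. indep_sets F UNIV"]) (rule ext, simp split: bool.split)
qed

lemma incr_grid_measurable:
  assumes "i \<le> j" "{i..<j} \<subseteq> K"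
  shows "(\<lambda>\<omega>. X (real j / 2 ^ n) \<omega> - X (real i / 2 ^ n) \<omega>)
    \<in> borel_measurable (sigma (space M) (grid_sets n K))"
proof -
  have 1: "(\<lambda>\<omega>. X (real (Suc l) / 2 ^ n) \<omega> - X (real l / 2 ^ n) \<omega>)
    \<in> borel_measurable (sigma (space M) (grid_sets n K))" if "l \<in> K" for l
  proof (rule measurableI)
    fix A :: "'b set" assume "A \<in> sets borel"
    with that show "(\<lambda>\<omega>. X (real (Suc l) / 2 ^ n) \<omega> - X (real l / 2 ^ n) \<omega>) -` A
        \<inter> space (sigma (space M) (grid_sets n K)) \<in> sets (sigma (space M) (grid_sets n K))"
      unfolding grid_sets_sets space_measure_of_conv
      unfolding grid_sets_def by (intro sigma_sets.Basic) (use that in \<open>unfold incr_sets_def, blast\<close>)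
  qed simp
  have "(\<lambda>\<omega>. \<Sum>l=i..<j. X (real (Suc l) / 2 ^ n) \<omega> - X (real l / 2 ^ n) \<omega>)
    \<in> borel_measurable (sigma (space M) (grid_sets n K))"
    by (rule borel_measurable_sum, rule 1) (use assms in blast)
  also have "(\<lambda>\<omega>. \<Sum>l=i..<j. X (real (Suc l) / 2 ^ n) \<omega> - X (real l / 2 ^ n) \<omega>)
    = (\<lambda>\<omega>. X (real j / 2 ^ n) \<omega> - X (real i / 2 ^ n) \<omega>)"
    using assms(1) by (intro ext sum_Suc_diff'[where f = "\<lambda>l. X (real l / 2 ^ n) _"])
  finally show ?thesis .
qed

text \<open>The coarse cell \<open>i\<close> splits into the fine cells from
  \<open>i * 2 ^ (m - n)\<close> up to, but excluding, \<open>Suc i * 2 ^ (m - n)\<close>, and its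
  increment is the telescoping sum over them.\<close>

lemma grid_sets_refine:
  assumes "n \<le> m" "\<And>i l. i \<in> K \<Longrightarrow> i * 2 ^ (m - n) \<le> l \<Longrightarrow> l < Suc i * 2 ^ (m - n) \<Longrightarrow> l \<in> K'"
  shows "grid_sets n K \<subseteq> grid_sets m K'"
proof -
  have eq: "real i / 2 ^ n = real (i * 2 ^ (m - n)) / 2 ^ m" for i
    using assms(1) by (auto simp: le_iff_add power_add)
  have "incr_sets n i \<subseteq> grid_sets m K'" if "i \<in> K" for i
  proof
    fix E assume "E \<in> incr_sets n i"
    then obtain A where A: "A \<in> sets borel"
      "E = (\<lambda>\<omega>. X (real (Suc i) / 2 ^ n) \<omega> - X (real i / 2 ^ n) \<omega>) -` A \<inter> space M"
      by (auto simp: incr_sets_def)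
    have "(\<lambda>\<omega>. X (real (Suc i) / 2 ^ n) \<omega> - X (real i / 2 ^ n) \<omega>)
      \<in> borel_measurable (sigma (space M) (grid_sets m K'))"
      unfolding eq by (rule incr_grid_measurable) (use assms(2)[OF that] in auto)
    from measurable_sets[OF this A(1)] show "E \<in> grid_sets m K'"
      by (simp add: A(2) grid_sets_sets space_measure_of_conv)
  qed
  then show ?thesis
    unfolding grid_sets_def[of n K]
    by (intro sigma_algebra.sigma_sets_subset[OF grid_sets_sigma_algebra]) blast
qed

lemma grid_sets_before_mono: "n \<le> m \<Longrightarrow> grid_sets n (before s n) \<subseteq> grid_sets m (before s m)"
proof (rule grid_sets_refine)
  fix i l assume nm: "n \<le> m" and "i \<in> before s n" "l < Suc i * 2 ^ (m - n)"
  then have i: "real (Suc i) / 2 ^ n \<le> s" and "Suc l \<le> Suc i * 2 ^ (m - n)"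
    by simp_all
  from this(2) have "real (Suc l) \<le> real (Suc i * 2 ^ (m - n))"
    by (simp only: of_nat_le_iff)
  then have "real (Suc l) / 2 ^ m \<le> real (Suc i * 2 ^ (m - n)) / 2 ^ m"
    by (intro divide_right_mono) auto
  also have "\<dots> = real (Suc i) / 2 ^ n"
    using nm by (auto simp: le_iff_add power_add field_simps)
  finally show "l \<in> before s m" using i by simp
qed

lemma grid_sets_after_mono: "n \<le> m \<Longrightarrow> grid_sets n (after s n) \<subseteq> grid_sets m (after s m)"
proof (rule grid_sets_refine)
  fix i l assume nm: "n \<le> m" and "i \<in> after s n" "i * 2 ^ (m - n) \<le> l"
  then have i: "s \<le> real i / 2 ^ n" and "real (i * 2 ^ (m - n)) \<le> real l"
    by (auto simp del: of_nat_mult)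
  then have "real (i * 2 ^ (m - n)) / 2 ^ m \<le> real l / 2 ^ m"
    by (intro divide_right_mono) auto
  moreover have "real (i * 2 ^ (m - n)) / 2 ^ m = real i / 2 ^ n"
    using nm by (auto simp: le_iff_add power_add)
  ultimately show "l \<in> after s m" using i by simp
qed

text \<open>\<open>U_indep\<close> speaks of the product sigma-algebra generated by the whole path;
  grid events belong to it since every increment is a measurable function of two
  coordinates.\<close>

lemma prob_U_Int_grid:
  assumes A: "A \<in> sets borel" and E: "E \<in> grid_sets n UNIV"
  shows "prob (U -` A \<inter> space M \<inter> E) = prob (U -` A \<inter> space M) * prob E"
proof -
  let ?P = "\<lambda>\<omega>. \<lambda>t\<in>{0..}. X t \<omega>"
  let ?N = "vimage_algebra (space M) ?P (PiM {0..} (\<lambda>_. borel))"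
  have P: "?P \<in> space M \<rightarrow> space (PiM {0..} (\<lambda>_. borel))" by (simp add: space_PiM)
  have X: "X t \<in> borel_measurable ?N" if "0 \<le> t" for t
  proof -
    have "(\<lambda>\<omega>. (?P \<omega>) t) \<in> borel_measurable ?N"
      by (rule measurable_compose[OF measurable_vimage_algebra1[OF P] measurable_component_singleton])
        (use that in simp)
    with that show ?thesis by simp
  qed
  have "incr_sets n i \<subseteq> sets ?N" for i
  proof -
    have "(\<lambda>\<omega>. X (real (Suc i) / 2 ^ n) \<omega> - X (real i / 2 ^ n) \<omega>) \<in> borel_measurable ?N"
      by (intro borel_measurable_diff X) auto
    from measurable_sets[OF this] show ?thesis by (auto simp: incr_sets_def)
  qed
  then have "grid_sets n UNIV \<subseteq> sets ?N"
    unfolding grid_sets_def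
    using sigma_algebra.sigma_sets_subset[OF sets.sigma_algebra_axioms[of ?N]] by (simp add: UN_least)
  moreover have "U -` A \<inter> space M \<in> sets (vimage_algebra (space M) U borel)"
    using A by (rule in_vimage_algebra)
  ultimately have "prob (E \<inter> (U -` A \<inter> space M)) = prob E * prob (U -` A \<inter> space M)"
    using E by (intro indep_setD[OF U_indep]) auto
  then show ?thesis by (simp add: Int_commute mult.commute)
qed

lemma past_generator_sets:
  "{U -` A \<inter> space M \<inter> E | A n E. A \<in> sets borel \<and> E \<in> grid_sets n (before s n)} \<subseteq> events"
proof clarify
  fix A n E assume "A \<in> sets (borel :: real measure)" "E \<in> grid_sets n (before s n)"
  then show "U -` A \<inter> space M \<inter> E \<in> events"
    using grid_sets_events[of n "before s n"] measurable_sets[OF U_measurable] by blast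
qed

lemma sets_past: "sets (past s) = sigma_sets (space M)
    {U -` A \<inter> space M \<inter> E | A n E. A \<in> sets borel \<and> E \<in> grid_sets n (before s n)}"
  unfolding past_def
  by (rule sets_measure_of) (rule order_trans[OF past_generator_sets sets.space_closed])

text \<open>The pi-lambda argument needs factorisation on the two generators. There \<open>U\<close>
  is split off first, against all increments together, and only then are the increments before
  \<open>s\<close> separated from those after \<open>s\<close>. Events given at different levels are
  compared at the finer one.\<close>

lemma indep_past_future: "indep_set (sets (past s)) (sets (future s))"
proof -
  let ?P = "{U -` A \<inter> space M \<inter> E | A n E. A \<in> sets borel \<and> E \<in> grid_sets n (before s n)}"
  let ?F = "\<Union>n. grid_sets n (after s n)"
  have F: "?F \<subseteq> events" using grid_sets_events by blast
  have "indep_set (sigma_sets (space M) ?P) (sigma_sets (space M) ?F)"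
  proof (rule indep_set_sigma_sets)
    show "indep_set ?P ?F"
    proof (rule indep_setI)
      fix a b assume "a \<in> ?P" "b \<in> ?F"
      then obtain A n m E where A: "A \<in> sets borel" and E: "E \<in> grid_sets n (before s n)"
        and a: "a = U -` A \<inter> space M \<inter> E" and b: "b \<in> grid_sets m (after s m)"
        by blast
      define k where "k = max n m"
      have E': "E \<in> grid_sets k (before s k)" and b': "b \<in> grid_sets k (after s k)"
        using E b grid_sets_before_mono[of n k s] grid_sets_after_mono[of m k s]
        by (auto simp: k_def)
      have sub: "grid_sets k K \<subseteq> grid_sets k UNIV" for K
        unfolding grid_sets_def by (intro sigma_sets_mono') auto
      interpret G: sigma_algebra "space M" "grid_sets k UNIV" by (rule grid_sets_sigma_algebra)
      have "prob (a \<inter> b) = prob (U -` A \<inter> space M \<inter> (E \<inter> b))" by (simp add: a Int_assoc)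
      also have "\<dots> = prob (U -` A \<inter> space M) * prob (E \<inter> b)"
        using E' b' sub by (intro prob_U_Int_grid[OF A]) (auto intro!: G.Int)
      also have "prob (E \<inter> b) = prob E * prob b"
        using indep_grid_sets E' b' by (rule indep_setD)
      also have "prob (U -` A \<inter> space M) * (prob E * prob b) = prob a * prob b"
        unfolding a using prob_U_Int_grid[OF A subsetD[OF sub E']] by simp
      finally show "prob (a \<inter> b) = prob a * prob b" .
    qed (use past_generator_sets F in auto)
    show "Int_stable ?P"
    proof (rule Int_stableI)
      fix a b assume "a \<in> ?P" "b \<in> ?P"
      then obtain A n E B m G where A: "A \<in> sets borel" and E: "E \<in> grid_sets n (before s n)"
        and a: "a = U -` A \<inter> space M \<inter> E"
        and B: "B \<in> sets borel" and G: "G \<in> grid_sets m (before s m)"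
        and b: "b = U -` B \<inter> space M \<inter> G"
        by blast
      define k where "k = max n m"
      have E': "E \<in> grid_sets k (before s k)" and G': "G \<in> grid_sets k (before s k)"
        using E G grid_sets_before_mono[of n k s] grid_sets_before_mono[of m k s]
        by (auto simp: k_def)
      have "E \<inter> G \<in> grid_sets k (before s k)"
        using Int_stable_grid_sets E' G' by (auto simp: Int_stable_def)
      moreover have "a \<inter> b = U -` (A \<inter> B) \<inter> space M \<inter> (E \<inter> G)" by (auto simp: a b)
      ultimately show "a \<inter> b \<in> ?P" using A B by blast
    qed
    show "Int_stable ?F"
    proof (rule Int_stableI)
      fix a b assume "a \<in> ?F" "b \<in> ?F"
      then obtain n m where *: "a \<in> grid_sets n (after s n)" "b \<in> grid_sets m (after s m)" by blast
      have "a \<in> grid_sets (max n m) (after s (max n m))" "b \<in> grid_sets (max n m) (after s (max n m))"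
        using * grid_sets_after_mono[of n "max n m" s] grid_sets_after_mono[of m "max n m" s] by auto
      then have "a \<inter> b \<in> grid_sets (max n m) (after s (max n m))"
        using Int_stable_grid_sets by (auto simp: Int_stable_def)
      then show "a \<inter> b \<in> ?F" by blast
    qed
  qed
  moreover have "sets (past s) = sigma_sets (space M) ?P"
    by (rule sets_past)
  moreover have "sets (future s) = sigma_sets (space M) ?F"
    unfolding future_def by (rule sets_measure_of) (rule order_trans[OF F sets.space_closed])
  ultimately show ?thesis by simp
qed

lemma space_past [simp]: "space (past s) = space M" and space_future [simp]: "space (future s) = space M"
  unfolding past_def future_def by (simp_all add: space_measure_of_conv)

lemma sets_past_subset: "sets (past s) \<subseteq> events" and sets_future_subset: "sets (future s) \<subseteq> events"
  using indep_past_future[of s]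
  unfolding indep_set_def indep_sets_def by (metis (full_types) UNIV_I bool.simps(3,4))+

lemma measurable_past: "f \<in> measurable (past s) N \<Longrightarrow> f \<in> measurable M N"
  and measurable_future: "f \<in> measurable (future s) N \<Longrightarrow> f \<in> measurable M N"
  using sets_past_subset[of s] sets_future_subset[of s] by (auto simp: measurable_def)

lemma U_past: "U \<in> borel_measurable (past s)"
proof (rule measurableI)
  fix A :: "real set" assume "A \<in> sets borel"
  moreover have "space M \<in> grid_sets 0 (before s 0)"
    unfolding grid_sets_def by (rule sigma_sets_top)
  ultimately have "U -` A \<inter> space M \<inter> space M \<in>
    {U -` A \<inter> space M \<inter> E | A n E. A \<in> sets borel \<and> E \<in> grid_sets n (before s n)}"
    by blast
  then have "U -` A \<inter> space M \<inter> space M \<in> sets (past s)"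
    unfolding sets_past by (rule sigma_sets.Basic)
  then show "U -` A \<inter> space (past s) \<in> sets (past s)" by simp
qed simp

lemma grid_sets_past: "grid_sets n (before s n) \<subseteq> sets (past s)"
proof
  fix E assume E: "E \<in> grid_sets n (before s n)"
  then have "U -` UNIV \<inter> space M \<inter> E \<in>
    {U -` A \<inter> space M \<inter> E | A n E. A \<in> sets borel \<and> E \<in> grid_sets n (before s n)}"
    by (intro CollectI exI[of _ UNIV] exI[of _ n] exI[of _ E]) simp
  then have "U -` UNIV \<inter> space M \<inter> E \<in> sets (past s)"
    unfolding sets_past by (rule sigma_sets.Basic)
  moreover have "E \<subseteq> space M" using E grid_sets_events sets.sets_into_space by blast
  ultimately show "E \<in> sets (past s)" by (simp add: Int_absorb1)
qed

lemma grid_sets_mono: "K \<subseteq> K' \<Longrightarrow> grid_sets n K \<subseteq> grid_sets n K'"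
  unfolding grid_sets_def by (intro sigma_sets_mono' UN_mono) auto

lemma sets_past_mono: "r \<le> s \<Longrightarrow> sets (past r) \<subseteq> sets (past s)"
proof -
  assume "r \<le> s"
  then have "grid_sets n (before r n) \<subseteq> grid_sets n (before s n)" for n
    by (intro grid_sets_mono) auto
  then show ?thesis unfolding sets_past by (intro sigma_sets_mono') blast
qed

lemma past_le: "f \<in> measurable (past r) N \<Longrightarrow> r \<le> s \<Longrightarrow> f \<in> measurable (past s) N"
  by (rule measurable_from_subalg) (simp_all add: subalgebra_def sets_past_mono)

lemma grid_sets_future: "grid_sets n (after s n) \<subseteq> sets (future s)"
proof -
  have "(\<Union>n. grid_sets n (after s n)) \<subseteq> Pow (space M)"
    using grid_sets_events sets.space_closed by blast
  then have "sets (future s) = sigma_sets (space M) (\<Union>n. grid_sets n (after s n))"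
    unfolding future_def by (rule sets_measure_of)
  then show ?thesis by (auto intro: sigma_sets.Basic)
qed

lemma incr_measurable_aux:
  assumes "u \<in> dyadics" "t \<in> dyadics" "u \<le> t"
    and "\<And>n. grid_sets n {i. u \<le> real i / 2 ^ n \<and> real (Suc i) / 2 ^ n \<le> t} \<subseteq> sets N"
    and "space N = space M"
  shows "(\<lambda>\<omega>. X t \<omega> - X u \<omega>) \<in> borel_measurable N"
proof -
  obtain i j n where *: "u = real i / 2 ^ n" "t = real j / 2 ^ n"
    using assms(1,2) by (rule dyadics_common_level)
  let ?K = "{i. u \<le> real i / 2 ^ n \<and> real (Suc i) / 2 ^ n \<le> t}"
  have "(\<lambda>\<omega>. X t \<omega> - X u \<omega>) \<in> borel_measurable (sigma (space M) (grid_sets n ?K))"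
    unfolding *
  proof (rule incr_grid_measurable)
    show ij: "i \<le> j" using assms(3) by (simp add: * divide_le_cancel)
    show "{i..<j} \<subseteq> {l. real i / 2 ^ n \<le> real l / 2 ^ n \<and> real (Suc l) / 2 ^ n \<le> real j / 2 ^ n}"
    proof
      fix l assume "l \<in> {i..<j}"
      then have "real i \<le> real l" "real (Suc l) \<le> real j" by simp_all
      then show "l \<in> {l. real i / 2 ^ n \<le> real l / 2 ^ n \<and> real (Suc l) / 2 ^ n \<le> real j / 2 ^ n}"
        by (simp add: divide_right_mono del: of_nat_Suc)
    qed
  qed
  moreover have "subalgebra N (sigma (space M) (grid_sets n ?K))"
    unfolding subalgebra_def grid_sets_sets assms(5)
    by (intro conjI assms(4)) (simp add: space_measure_of_conv)
  ultimately show ?thesis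
    by (rule measurable_from_subalg[rotated])
qed

lemma incr_past:
  assumes "u \<in> dyadics" "t \<in> dyadics" "u \<le> t" "t \<le> s"
  shows "(\<lambda>\<omega>. X t \<omega> - X u \<omega>) \<in> borel_measurable (past s)"
  using assms(1-3)
proof (rule incr_measurable_aux)
  fix n show "grid_sets n {i. u \<le> real i / 2 ^ n \<and> real (Suc i) / 2 ^ n \<le> t} \<subseteq> sets (past s)"
    by (rule order_trans[OF grid_sets_mono grid_sets_past]) (use assms(4) in auto)
qed simp

lemma incr_future:
  assumes "u \<in> dyadics" "t \<in> dyadics" "u \<le> t" "s \<le> u"
  shows "(\<lambda>\<omega>. X t \<omega> - X u \<omega>) \<in> borel_measurable (future s)"
  using assms(1-3)
proof (rule incr_measurable_aux)
  fix n show "grid_sets n {i. u \<le> real i / 2 ^ n \<and> real (Suc i) / 2 ^ n \<le> t} \<subseteq> sets (future s)"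
    by (rule order_trans[OF grid_sets_mono grid_sets_future]) (use assms(4) in auto)
qed simp

lemma prob_past_future:
  "E \<in> sets (past s) \<Longrightarrow> F \<in> sets (future s) \<Longrightarrow> prob (E \<inter> F) = prob E * prob F"
  using indep_past_future by (rule indep_setD)

lemma indep_var_past_future:
  assumes f: "f \<in> measurable (past s) N" and g: "g \<in> measurable (future s) N'"
  shows "indep_var N f N' g"
  unfolding indep_var_eq
proof (intro conjI)
  show "random_variable N f" "random_variable N' g"
    using f g by (auto intro: measurable_past measurable_future)
  have "indep_set {f -` A \<inter> space M | A. A \<in> sets N} {g -` A \<inter> space M | A. A \<in> sets N'}"
    unfolding indep_set_def
  proof (rule indep_sets_mono_sets[OF indep_past_future[of s, unfolded indep_set_def]])
    show "(case b of True \<Rightarrow> {f -` A \<inter> space M |A. A \<in> sets N}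
          | False \<Rightarrow> {g -` A \<inter> space M |A. A \<in> sets N'})
         \<subseteq> (case b of True \<Rightarrow> sets (past s) | False \<Rightarrow> sets (future s))" for b
      using measurable_sets[OF f] measurable_sets[OF g] by (cases b) auto
  qed
  then show "indep_set (sigma_sets (space M) {f -` A \<inter> space M | A. A \<in> sets N})
     (sigma_sets (space M) {g -` A \<inter> space M | A. A \<in> sets N'})"
  proof (rule indep_set_sigma_sets)
    have "Int_stable {h -` A \<inter> space M | A. A \<in> sets K}" for h :: "'a \<Rightarrow> 'z" and K
    proof (rule Int_stableI, safe)
      fix A B assume "A \<in> sets K" "B \<in> sets K"
      then show "\<exists>C. h -` A \<inter> space M \<inter> (h -` B \<inter> space M) = h -` C \<inter> space M \<and> C \<in> sets K"
        by (intro exI[of _ "A \<inter> B"]) auto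
    qed
    note stable = this
    show "Int_stable {f -` A \<inter> space M | A. A \<in> sets N}"
      "Int_stable {g -` A \<inter> space M | A. A \<in> sets N'}" by (rule stable)+
  qed
qed

lemma incr_distr:
  assumes "0 \<le> u" "u \<le> t"
  shows "distr M borel (\<lambda>\<omega>. X t \<omega> - X u \<omega>) = distr M borel (X (t - u))"
proof -
  have "distr M borel (\<lambda>\<omega>. X (u + (t - u)) \<omega> - X u \<omega>) = distr M borel (X (t - u))"
    using levy assms unfolding levy_process_def by (meson diff_ge_0_iff_ge)
  then show ?thesis by simp
qed

end

section \<open>Cadlag paths and Stieltjes sums\<close>

text \<open>Right-continuity and the left limit each bound \<open>f\<close> on a one-sided
  neighbourhood, hence around every point of \<open>[0, b]\<close>; compactness leaves finitely many
  such bounds.\<close>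

lemma cadlag_bounded:
  fixes f :: "real \<Rightarrow> real"
  assumes "cadlag f"
  obtains K where "\<And>t. 0 \<le> t \<Longrightarrow> t \<le> b \<Longrightarrow> \<bar>f t\<bar> \<le> K"
proof -
  have "\<exists>d K. 0 < d \<and> (\<forall>r. 0 \<le> r \<longrightarrow> \<bar>r - t\<bar> < d \<longrightarrow> \<bar>f r\<bar> \<le> K)" if t: "0 \<le> t" for t
  proof -
    have near: "\<exists>d>0. \<forall>r\<in>S. 0 < \<bar>r - t\<bar> \<and> \<bar>r - t\<bar> < d \<longrightarrow> \<bar>f r\<bar> \<le> \<bar>l\<bar> + 1"
      if "(f \<longlongrightarrow> l) (at t within S)" for l S
    proof -
      have "eventually (\<lambda>r. dist (f r) l < 1) (at t within S)"
        using that by (rule tendstoD) simp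
      then obtain d where "d > 0" "\<And>r. r \<in> S \<Longrightarrow> r \<noteq> t \<Longrightarrow> dist r t < d \<Longrightarrow> dist (f r) l < 1"
        unfolding eventually_at by blast
      then show ?thesis
        by (intro exI[of _ d]) (fastforce simp: dist_real_def)
    qed
    have "(f \<longlongrightarrow> f t) (at_right t)"
      using assms t by (simp add: cadlag_def continuous_within)
    from near[OF this] obtain d1 where d1: "d1 > 0"
      "\<And>r. t < r \<Longrightarrow> \<bar>r - t\<bar> < d1 \<Longrightarrow> \<bar>f r\<bar> \<le> \<bar>f t\<bar> + 1" by auto
    \<comment> \<open>At \<open>t = 0\<close> no admissible time lies to the left, so any
      \<open>d2\<close> and \<open>l\<close> will do.\<close>
    have "\<exists>d2 l. 0 < d2 \<and> (\<forall>r. 0 \<le> r \<and> r < t \<and> \<bar>r - t\<bar> < d2 \<longrightarrow> \<bar>f r\<bar> \<le> \<bar>l\<bar> + 1)"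
    proof (cases "t = 0")
      case False
      then obtain l where "(f \<longlongrightarrow> l) (at_left t)"
        using assms t unfolding cadlag_def by (metis less_eq_real_def)
      from near[OF this] show ?thesis by fastforce
    qed (auto intro!: exI[of _ 1])
    then obtain d2 l where d2: "0 < d2"
      "\<And>r. 0 \<le> r \<Longrightarrow> r < t \<Longrightarrow> \<bar>r - t\<bar> < d2 \<Longrightarrow> \<bar>f r\<bar> \<le> \<bar>l\<bar> + 1" by blast
    show ?thesis
    proof (rule exI[of _ "min d1 d2"], rule exI[of _ "\<bar>f t\<bar> + \<bar>l\<bar> + 1"], intro conjI allI impI)
      fix r assume r: "0 \<le> r" "\<bar>r - t\<bar> < min d1 d2"
      consider "r < t" | "r = t" | "t < r" by linarith
      then show "\<bar>f r\<bar> \<le> \<bar>f t\<bar> + \<bar>l\<bar> + 1"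
        using d1(2)[of r] d2(2)[of r] r by cases auto
    qed (use d1 d2 in auto)
  qed
  then obtain d K where dK: "\<And>t. 0 \<le> t \<Longrightarrow> 0 < d t"
    "\<And>t r. 0 \<le> t \<Longrightarrow> 0 \<le> r \<Longrightarrow> \<bar>r - t\<bar> < d t \<Longrightarrow> \<bar>f r\<bar> \<le> K t" by metis
  have "{0..b} \<subseteq> (\<Union>t\<in>{0..b}. ball t (d t))" using dK(1) by auto
  then obtain T where T: "T \<subseteq> {0..b}" "finite T" "{0..b} \<subseteq> (\<Union>t\<in>T. ball t (d t))"
    by (auto elim: compactE_image[OF compact_Icc, rotated])
  show ?thesis
  proof (rule that)
    fix r assume r: "0 \<le> r" "r \<le> b"
    then obtain t where t: "t \<in> T" "r \<in> ball t (d t)" using T(3) by auto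
    then have "\<bar>f r\<bar> \<le> K t"
      using dK(2)[of t r] r T(1) by (auto simp: dist_real_def abs_minus_commute)
    also have "\<dots> \<le> \<bar>K t\<bar>" by simp
    also have "\<dots> \<le> (\<Sum>t\<in>T. \<bar>K t\<bar>)" using T(2) t(1) by (intro member_le_sum) auto
    finally show "\<bar>f r\<bar> \<le> (\<Sum>t\<in>T. \<bar>K t\<bar>)" .
  qed
qed

text \<open>Right-continuity carries a strict exceedance to slightly later times, among which there
  are dyadic ones. Both the strictness and the room to the right of \<open>t\<close> matter.\<close>

lemma cadlag_dyadic_exceeds:
  fixes f :: "real \<Rightarrow> real"
  assumes "cadlag f" "0 \<le> t" "t < t'" "u < f t"
  obtains r where "r \<in> dyadics" "t < r" "r < t'" "u < f r"
proof -
  have "(f \<longlongrightarrow> f t) (at_right t)"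
    using assms by (simp add: cadlag_def continuous_within)
  then have "eventually (\<lambda>r. u < f r) (at_right t)"
    using assms(4) by (rule order_tendstoD)
  then obtain b where b: "b > t" "\<And>y. y > t \<Longrightarrow> y < b \<Longrightarrow> u < f y"
    unfolding eventually_at_right_field by blast
  obtain r where "r \<in> dyadics" "t < r" "r < min b t'"
    using assms b by (auto elim: dyadic_between[of t "min b t'"])
  with b show ?thesis by (auto intro: that)
qed

definition stieltjes_cells :: "nat \<Rightarrow> real \<Rightarrow> real \<Rightarrow> nat set" where
  "stieltjes_cells n u t = {i. u \<le> real i / 2 ^ n \<and> real (Suc i) / 2 ^ n \<le> t}"

lemma finite_stieltjes_cells: "finite (stieltjes_cells n u t)"
proof (rule finite_subset)
  show "stieltjes_cells n u t \<subseteq> {..nat \<lceil>t * 2 ^ n\<rceil>}"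
  proof
    fix i assume "i \<in> stieltjes_cells n u t"
    then have "real (Suc i) \<le> t * 2 ^ n"
      by (simp add: stieltjes_cells_def pos_divide_le_eq)
    then show "i \<in> {..nat \<lceil>t * 2 ^ n\<rceil>}" by simp linarith
  qed
qed simp

text \<open>A left-point sum is the integral of a step function whose value on a cell is taken at
  its left end. As cells are open on the left, that end lies strictly before the argument, so the
  step functions converge to the left limit; boundedness of \<open>x\<close> on
  \<open>[0, t]\<close> gives an integrable majorant.\<close>

lemma exp_stieltjes_limit:
  fixes x e :: "real \<Rightarrow> real"
  assumes x: "cadlag x" and e: "cadlag e" and mono: "\<And>s t. 0 \<le> s \<Longrightarrow> s \<le> t \<Longrightarrow> e s \<le> e t"
    and t: "t \<in> dyadics"
  shows "(\<lambda>n. \<Sum>i\<in>stieltjes_cells n 0 t.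
            exp (x (real i / 2 ^ n)) * (e (real (Suc i) / 2 ^ n) - e (real i / 2 ^ n)))
    \<longlonglongrightarrow> (LINT s:{0<..t}|interval_measure (\<lambda>u. e (max 0 u)). exp (Lim (at_left s) x))"
proof -
  \<comment> \<open>\<open>interval_measure\<close> asks for a monotone right-continuous function on
    the whole line; the constant extension puts no mass on negative times or at 0.\<close>
  define F where "F = (\<lambda>u. e (max 0 u))"
  define \<mu> where "\<mu> = interval_measure F"
  have [measurable_cong]: "sets \<mu> = sets borel" by (simp add: \<mu>_def)
  have F_mono: "F u \<le> F v" if "u \<le> v" for u v
    unfolding F_def by (rule mono) (use that in auto)
  have F_rc: "continuous (at_right a) F" for a
  proof (cases "0 \<le> a")
    case True
    then have "(e \<longlongrightarrow> e a) (at_right a)" using e by (simp add: cadlag_def continuous_within)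
    moreover have "eventually (\<lambda>r. e r = F r) (at_right a)"
      using eventually_at_right_less[of a] by eventually_elim (use True in \<open>simp add: F_def\<close>)
    ultimately have "(F \<longlongrightarrow> e a) (at_right a)" by (blast intro: Lim_transform_eventually)
    then show ?thesis using True by (simp add: continuous_within F_def)
  next
    case False
    then have "eventually (\<lambda>r. r < 0) (at_right a)"
      by (intro eventually_at_rightI[of a 0]) auto
    then have "eventually (\<lambda>r. e 0 = F r) (at_right a)"
      by eventually_elim (simp add: F_def)
    then have "(F \<longlongrightarrow> e 0) (at_right a)" by (blast intro: Lim_transform_eventually tendsto_const)
    then show ?thesis using False by (simp add: continuous_within F_def)
  qed
  have \<mu>_Ioc: "emeasure \<mu> {a<..b} = ennreal (F b - F a)" if "a \<le> b" for a b
    unfolding \<mu>_def using that F_mono F_rc by (rule emeasure_interval_measure_Ioc)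
  have \<mu>_Ioc': "measure \<mu> {a<..b} = F b - F a" if "a \<le> b" for a b
    using \<mu>_Ioc[OF that] F_mono[OF that] by (simp add: measure_def)
  have cell: "real i / 2 ^ n \<le> real (Suc i) / 2 ^ n" for i n :: nat
    by (simp add: divide_right_mono)
  define c where "c n i = exp (x (real i / 2 ^ n))" for n i :: nat
  define g where "g n s = (\<Sum>i\<in>stieltjes_cells n 0 t.
    c n i * indicator {real i / 2 ^ n<..real (Suc i) / 2 ^ n} s)" for n and s :: real
  \<comment> \<open>The index of the unique cell containing \<open>s\<close>: the ceiling minus one,
    rather than the floor, because cells are closed on the right.\<close>
  define idx where "idx n s = nat (\<lceil>s * 2 ^ n\<rceil> - 1)" for n :: nat and s :: real
  have idx: "s \<in> {real i / 2 ^ n<..real (Suc i) / 2 ^ n} \<longleftrightarrow> idx n s = i" if "0 < s" for n i and s :: real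
  proof -
    have pos: "0 < s * 2 ^ n" using that by simp
    have "s \<in> {real i / 2 ^ n<..real (Suc i) / 2 ^ n} \<longleftrightarrow> real i < s * 2 ^ n \<and> s * 2 ^ n \<le> real i + 1"
      by (simp add: field_simps)
    also have "\<dots> \<longleftrightarrow> \<lceil>s * 2 ^ n\<rceil> = int i + 1" by (simp add: ceiling_eq_iff)
    also have "\<dots> \<longleftrightarrow> idx n s = i" using pos unfolding idx_def by linarith
    finally show ?thesis .
  qed
  have g_eq: "g n s = (if 0 < s \<and> idx n s \<in> stieltjes_cells n 0 t then c n (idx n s) else 0)" for n s
  proof (cases "0 < s")
    case True
    have "g n s = (\<Sum>i\<in>stieltjes_cells n 0 t. if idx n s = i then c n i else 0)"
      unfolding g_def by (rule sum.cong[OF refl]) (use idx[OF True] in \<open>simp add: indicator_def\<close>)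
    then show ?thesis using True by (simp add: finite_stieltjes_cells)
  next
    case False
    have "s \<notin> {real i / 2 ^ n<..real (Suc i) / 2 ^ n}" for i
    proof -
      have "0 \<le> real i / 2 ^ n" by simp
      with False show ?thesis by (simp only: greaterThanAtMost_iff) linarith
    qed
    then show ?thesis using False by (simp add: g_def)
  qed
  have cells_iff: "idx n s \<in> stieltjes_cells n 0 t \<longleftrightarrow> real (Suc (idx n s)) / 2 ^ n \<le> t" for n s
    by (simp add: stieltjes_cells_def)
  have idx_bounds: "real (idx n s) / 2 ^ n < s" "s \<le> real (Suc (idx n s)) / 2 ^ n" if "0 < s" for n s
    using idx[OF that, of "idx n s" n] by auto
  obtain K where K: "\<And>s. 0 \<le> s \<Longrightarrow> s \<le> t \<Longrightarrow> \<bar>x s\<bar> \<le> K"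
    using cadlag_bounded[OF x, of t] by blast
  have bound: "norm (g n s) \<le> exp K * indicator {0<..t} s" for n s
  proof (cases "0 < s \<and> idx n s \<in> stieltjes_cells n 0 t")
    case True
    then have "real (idx n s) / 2 ^ n \<le> t" "s \<le> t"
      using cells_iff[of n s] idx_bounds[of s n] cell[of "idx n s" n] by linarith+
    then have "x (real (idx n s) / 2 ^ n) \<le> K"
      using K[of "real (idx n s) / 2 ^ n"] by simp
    then show ?thesis using True \<open>s \<le> t\<close> by (simp add: g_eq c_def indicator_def)
  qed (auto simp: g_eq)
  obtain j m where jm: "t = real j / 2 ^ m" using t by (auto simp: dyadics_def)
  have lim: "(\<lambda>n. g n s) \<longlonglongrightarrow> indicator {0<..t} s * exp (Lim (at_left s) x)" for s
  proof (cases "s \<in> {0<..t}")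
    case True
    then have s: "0 < s" "s \<le> t" by auto
    obtain l where l: "(x \<longlongrightarrow> l) (at_left s)" using x s by (auto simp: cadlag_def)
    then have Lim: "Lim (at_left s) x = l" by (intro tendsto_Lim) auto
    have "(\<lambda>n. s - (1/2) ^ n) \<longlonglongrightarrow> s - 0" by (intro tendsto_intros LIMSEQ_power_zero) auto
    moreover have "s - (1/2) ^ n \<le> real (idx n s) / 2 ^ n" for n
      using idx_bounds(2)[OF s(1), of n] unfolding of_nat_Suc add_divide_distrib power_one_over by linarith
    ultimately have "(\<lambda>n. real (idx n s) / 2 ^ n) \<longlonglongrightarrow> s"
    proof -
      assume l: "(\<lambda>n. s - (1/2) ^ n) \<longlonglongrightarrow> s - 0"
        and le: "\<And>n. s - (1/2) ^ n \<le> real (idx n s) / 2 ^ n"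
      from l have l: "(\<lambda>n. s - (1/2) ^ n) \<longlonglongrightarrow> s" by simp
      show ?thesis
      proof (rule tendsto_sandwich[OF _ _ l tendsto_const])
        show "\<forall>\<^sub>F n in sequentially. real (idx n s) / 2 ^ n \<le> s"
          by (rule always_eventually) (blast intro: less_imp_le idx_bounds(1)[OF s(1)])
        show "\<forall>\<^sub>F n in sequentially. s - (1/2) ^ n \<le> real (idx n s) / 2 ^ n"
          by (rule always_eventually) (blast intro: le)
      qed
    qed
    \<comment> \<open>Approach from strictly below is what produces the left limit and not the value
      \<open>x s\<close>.\<close>
    then have "filterlim (\<lambda>n. real (idx n s) / 2 ^ n) (at_left s) sequentially"
    proof -
      assume "(\<lambda>n. real (idx n s) / 2 ^ n) \<longlonglongrightarrow> s"
      moreover have "\<forall>\<^sub>F n in sequentially. real (idx n s) / 2 ^ n \<in> {..<s} \<and> real (idx n s) / 2 ^ n \<noteq> s"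
        by (rule always_eventually) (metis idx_bounds(1)[OF s(1)] lessThan_iff less_irrefl)
      ultimately show ?thesis unfolding filterlim_at by blast
    qed
    from filterlim_compose[OF l this] have "(\<lambda>n. c n (idx n s)) \<longlonglongrightarrow> exp l"
      unfolding c_def by (rule tendsto_exp)
    \<comment> \<open>From level \<open>m\<close> on, \<open>t\<close> is a grid point, so the cell
      containing \<open>s \<le> t\<close> does not stick out beyond \<open>t\<close> and is
      counted.\<close>
    moreover have "eventually (\<lambda>n. c n (idx n s) = g n s) sequentially"
      using eventually_ge_at_top[of m]
    proof eventually_elim
      case (elim n)
      have "s * 2 ^ n \<le> real (j * 2 ^ (n - m))"
      proof -
        have "s * 2 ^ m \<le> real j" using s(2) by (simp add: jm pos_le_divide_eq)
        then have "s * 2 ^ m * 2 ^ (n - m) \<le> real j * 2 ^ (n - m)" by (rule mult_right_mono) simp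
        moreover have "(2::real) ^ m * 2 ^ (n - m) = 2 ^ n" using elim by (simp flip: power_add)
        ultimately show ?thesis by (simp add: mult.assoc)
      qed
      then have "\<lceil>s * 2 ^ n\<rceil> \<le> int (j * 2 ^ (n - m))" by (simp add: ceiling_le_iff)
      moreover have "0 < \<lceil>s * 2 ^ n\<rceil>" using s by simp
      ultimately have "Suc (idx n s) \<le> j * 2 ^ (n - m)" unfolding idx_def by linarith
      then have "real (Suc (idx n s)) \<le> real (j * 2 ^ (n - m))" by (simp only: of_nat_le_iff)
      then have "real (Suc (idx n s)) / 2 ^ n \<le> real (j * 2 ^ (n - m)) / 2 ^ n"
        by (rule divide_right_mono) simp
      also have "\<dots> = t" using elim by (auto simp: jm le_iff_add power_add)
      finally show ?case using s(1) by (simp add: g_eq cells_iff)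
    qed
    ultimately show ?thesis using True by (simp add: Lim Lim_transform_eventually)
  next
    case False
    then have "g n s = 0" for n using bound[of n s] by simp
    then show ?thesis using False by simp
  qed
  have meas: "g n \<in> borel_measurable \<mu>" for n unfolding g_def by measurable
  have "(\<lambda>n. integral\<^sup>L \<mu> (g n)) \<longlonglongrightarrow> (LINT s|\<mu>. indicator {0<..t} s * exp (Lim (at_left s) x))"
  proof (rule integral_dominated_convergence)
    show "(\<lambda>s. indicator {0<..t} s * exp (Lim (at_left s) x)) \<in> borel_measurable \<mu>"
      by (rule borel_measurable_LIMSEQ_real[OF lim meas])
    show "integrable \<mu> (\<lambda>s. exp K * indicator {0<..t} s)"
      using \<mu>_Ioc[OF dyadics_nonneg[OF t]] by (intro integrable_mult_right) (simp add: ennreal_less_top)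
  qed (use meas lim bound in auto)
  moreover have "integral\<^sup>L \<mu> (g n) = (\<Sum>i\<in>stieltjes_cells n 0 t.
      exp (x (real i / 2 ^ n)) * (e (real (Suc i) / 2 ^ n) - e (real i / 2 ^ n)))" for n
  proof -
    have "integral\<^sup>L \<mu> (g n) = (\<Sum>i\<in>stieltjes_cells n 0 t.
        c n i * measure \<mu> {real i / 2 ^ n<..real (Suc i) / 2 ^ n})"
      unfolding g_def
      by (subst Bochner_Integration.integral_sum)
        (auto intro!: integrable_mult_right integrable_real_indicator
          simp: \<mu>_Ioc[OF cell] ennreal_less_top simp del: of_nat_Suc)
    then show ?thesis unfolding \<mu>_Ioc'[OF cell] by (simp add: c_def F_def max_absorb2)
  qed
  ultimately show ?thesis by (simp add: set_lebesgue_integral_def \<mu>_def F_def)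
qed

section \<open>Breiman's lemma\<close>

context prob_space
begin

lemma emeasure_indep_pair:
  assumes ind: "indep_var N Y N' Z" and Q: "Q \<in> sets (N \<Otimes>\<^sub>M N')"
  shows "emeasure M {\<omega> \<in> space M. (Y \<omega>, Z \<omega>) \<in> Q} =
    (\<integral>\<^sup>+\<omega>. emeasure M {\<omega>' \<in> space M. (Y \<omega>', Z \<omega>) \<in> Q} \<partial>M)"
proof -
  have Y [measurable]: "Y \<in> measurable M N" and Z [measurable]: "Z \<in> measurable M N'"
    using ind by (rule indep_var_rv1, rule indep_var_rv2)
  interpret DY: prob_space "distr M N Y" by (rule prob_space_distr) fact
  interpret DZ: prob_space "distr M N' Z" by (rule prob_space_distr) fact
  interpret P: pair_sigma_finite "distr M N Y" "distr M N' Z" ..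
  have "emeasure M {\<omega> \<in> space M. (Y \<omega>, Z \<omega>) \<in> Q}
      = emeasure (distr M (N \<Otimes>\<^sub>M N') (\<lambda>\<omega>. (Y \<omega>, Z \<omega>))) Q"
    using Q by (subst emeasure_distr) (auto intro!: arg_cong[where f = "emeasure M"])
  also have "\<dots> = emeasure (distr M N Y \<Otimes>\<^sub>M distr M N' Z) Q"
    using ind by (simp add: indep_var_distribution_eq)
  also have "\<dots> = (\<integral>\<^sup>+z. emeasure (distr M N Y) ((\<lambda>y. (y, z)) -` Q) \<partial>distr M N' Z)"
    using Q by (intro P.emeasure_pair_measure_alt2) (simp cong: sets_pair_measure_cong)
  also have "\<dots> = (\<integral>\<^sup>+\<omega>. emeasure (distr M N Y) ((\<lambda>y. (y, Z \<omega>)) -` Q) \<partial>M)"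
  proof (rule nn_integral_distr[OF Z])
    show "(\<lambda>z. emeasure (distr M N Y) ((\<lambda>y. (y, z)) -` Q)) \<in> borel_measurable (distr M N' Z)"
      using Q P.measurable_emeasure_Pair2[of Q] by (simp cong: sets_pair_measure_cong)
  qed
  also have "\<dots> = (\<integral>\<^sup>+\<omega>. emeasure M {\<omega>' \<in> space M. (Y \<omega>', Z \<omega>) \<in> Q} \<partial>M)"
  proof (rule nn_integral_cong)
    fix \<omega> assume "\<omega> \<in> space M"
    have "(\<lambda>y. (y, Z \<omega>)) -` Q \<in> sets N" by (rule sets_Pair2[OF Q])
    then show "emeasure (distr M N Y) ((\<lambda>y. (y, Z \<omega>)) -` Q)
      = emeasure M {\<omega>' \<in> space M. (Y \<omega>', Z \<omega>) \<in> Q}"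
      by (subst emeasure_distr) (auto intro!: arg_cong[where f = "emeasure M"])
  qed
  finally show ?thesis .
qed

lemma tail_bound:
  assumes "((\<lambda>y. y powr \<alpha> * prob {\<omega> \<in> space M. V \<omega> > y}) \<longlongrightarrow> C) at_top" "0 < (\<alpha>::real)"
  obtains K where "0 < K" "\<And>y. 0 < y \<Longrightarrow> prob {\<omega> \<in> space M. V \<omega> > y} \<le> K * y powr (- \<alpha>)"
proof -
  have "eventually (\<lambda>y. y powr \<alpha> * prob {\<omega> \<in> space M. V \<omega> > y} < C + 1) at_top"
    using assms(1) by (rule order_tendstoD) simp
  then obtain y0 where y0: "\<And>y. y \<ge> y0 \<Longrightarrow> y powr \<alpha> * prob {\<omega> \<in> space M. V \<omega> > y} < C + 1"
    by (auto simp: eventually_at_top_linorder)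
  \<comment> \<open>\<open>C + 1\<close> serves for \<open>y \<ge> y0\<close>,
    \<open>y0 powr \<alpha>\<close> for smaller \<open>y\<close>, where the probability is at most
    1, and the entry 1 makes \<open>K\<close> positive.\<close>
  define K where "K = max 1 (max (C + 1) (y0 powr \<alpha>))"
  show ?thesis
  proof (rule that[of K])
    fix y :: real assume y: "0 < y"
    have "y powr \<alpha> * prob {\<omega> \<in> space M. V \<omega> > y} \<le> K"
    proof (cases "y0 \<le> y")
      case True
      then show ?thesis using y0[OF True] by (simp add: K_def)
    next
      case False
      then have "y powr \<alpha> * prob {\<omega> \<in> space M. V \<omega> > y} \<le> y0 powr \<alpha> * 1"
        using y assms(2) by (intro mult_mono powr_mono2) auto
      then show ?thesis by (simp add: K_def)
    qed
    then show "prob {\<omega> \<in> space M. V \<omega> > y} \<le> K * y powr (- \<alpha>)"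
      using y by (simp add: powr_minus field_simps)
  qed (simp add: K_def)
qed

text \<open>\<open>C\<close> is not assumed positive: the case \<open>C = 0\<close> expresses a
  lighter tail and is later applied to a constant \<open>V\<close>.\<close>

context
  fixes V S :: "'a \<Rightarrow> real" and \<alpha> C :: real
  assumes ind: "indep_var borel V borel S"
    and S_nonneg: "\<And>\<omega>. 0 \<le> S \<omega>"
    and \<alpha>_pos: "0 < \<alpha>"
    and tail: "((\<lambda>y. y powr \<alpha> * prob {\<omega> \<in> space M. V \<omega> > y}) \<longlongrightarrow> C) at_top"
begin

text \<open>The conditional probability of \<open>S * V > u\<close> given \<open>S = s\<close>. The
  value 0 at \<open>s = 0\<close> is the right one for \<open>u > 0\<close>, whereas the quotient
  \<open>u / s\<close> would there take the default value 0 and give a wrong level.\<close>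

definition scaled_tail :: "real \<Rightarrow> real \<Rightarrow> real" where
  "scaled_tail u s = (if 0 < s then prob {\<omega> \<in> space M. V \<omega> > u / s} else 0)"

lemma V_S_measurable: "V \<in> borel_measurable M" "S \<in> borel_measurable M"
  using ind by (rule indep_var_rv1, rule indep_var_rv2)

lemma prob_product:
  assumes u: "0 < u"
  shows "ennreal (prob {\<omega> \<in> space M. S \<omega> * V \<omega> > u}) = (\<integral>\<^sup>+\<omega>. ennreal (scaled_tail u (S \<omega>)) \<partial>M)"
proof -
  have "ennreal (prob {\<omega> \<in> space M. S \<omega> * V \<omega> > u})
      = emeasure M {\<omega> \<in> space M. (V \<omega>, S \<omega>) \<in> {p. snd p * fst p > u}}"
    by (simp add: emeasure_eq_measure)
  also have "\<dots> = (\<integral>\<^sup>+\<omega>. emeasure M {\<omega>' \<in> space M. (V \<omega>', S \<omega>) \<in> {p. snd p * fst p > u}} \<partial>M)"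
  proof (rule emeasure_indep_pair[OF ind])
    have "{p \<in> space (borel \<Otimes>\<^sub>M borel). snd p * fst p > u} \<in> sets (borel \<Otimes>\<^sub>M borel)"
      by measurable
    then show "{p. snd p * fst p > u} \<in> sets (borel \<Otimes>\<^sub>M borel)"
      by (simp add: space_pair_measure)
  qed
  also have "\<dots> = (\<integral>\<^sup>+\<omega>. ennreal (scaled_tail u (S \<omega>)) \<partial>M)"
  proof (rule nn_integral_cong)
    fix \<omega>
    show "emeasure M {\<omega>' \<in> space M. (V \<omega>', S \<omega>) \<in> {p. snd p * fst p > u}} = ennreal (scaled_tail u (S \<omega>))"
    proof (cases "0 < S \<omega>")
      case True
      then have "{\<omega>' \<in> space M. (V \<omega>', S \<omega>) \<in> {p. snd p * fst p > u}} = {\<omega>' \<in> space M. V \<omega>' > u / S \<omega>}"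
        by (auto simp: field_simps)
      then show ?thesis using True by (simp add: scaled_tail_def emeasure_eq_measure)
    next
      case False
      then have "S \<omega> = 0" using S_nonneg[of \<omega>] by simp
      then show ?thesis using u by (simp add: scaled_tail_def)
    qed
  qed
  finally show ?thesis .
qed

lemma scaled_tail_nonneg: "0 \<le> scaled_tail u s"
  by (simp add: scaled_tail_def)

lemma scaled_tail_tendsto:
  assumes "0 \<le> s"
  shows "((\<lambda>u. u powr \<alpha> * scaled_tail u s) \<longlongrightarrow> C * s powr \<alpha>) at_top"
proof (cases "s = 0")
  case True
  then show ?thesis using \<alpha>_pos by (simp add: scaled_tail_def)
next
  case False
  then have s: "0 < s" using assms by simp
  have "filterlim (\<lambda>u. u / s) at_top at_top"
    using filterlim_tendsto_pos_mult_at_top[OF tendsto_const[of "inverse s"] _ filterlim_ident] s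
    by (simp add: divide_inverse mult.commute)
  from tendsto_mult[OF filterlim_compose[OF tail this] tendsto_const[of "s powr \<alpha>"]]
  have "((\<lambda>u. (u / s) powr \<alpha> * prob {\<omega> \<in> space M. V \<omega> > u / s} * s powr \<alpha>) \<longlongrightarrow> C * s powr \<alpha>) at_top" .
  then show ?thesis
  proof (rule Lim_transform_eventually)
    show "eventually (\<lambda>u. (u / s) powr \<alpha> * prob {\<omega> \<in> space M. V \<omega> > u / s} * s powr \<alpha>
        = u powr \<alpha> * scaled_tail u s) at_top"
      using eventually_gt_at_top[of 0]
      by eventually_elim (use s in \<open>simp add: scaled_tail_def powr_divide\<close>)
  qed
qed

lemma scaled_tail_borel: "scaled_tail u \<in> borel_measurable borel"
proof -
  have "(\<lambda>y. prob {\<omega> \<in> space M. V \<omega> > y}) \<in> borel_measurable borel"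
  proof -
    have [measurable]: "V \<in> borel_measurable M" by (rule V_S_measurable)
    have "mono (\<lambda>y. - prob {\<omega> \<in> space M. V \<omega> > y})"
      by (auto simp: mono_def intro!: finite_measure_mono)
    from borel_measurable_uminus[OF borel_measurable_mono[OF this]] show ?thesis by simp
  qed
  then show ?thesis unfolding scaled_tail_def[abs_def] by measurable
qed

lemma scaled_tail_measurable [measurable]: "(\<lambda>\<omega>. scaled_tail u (S \<omega>)) \<in> borel_measurable M"
  by (rule measurable_compose[OF V_S_measurable(2) scaled_tail_borel])

text \<open>Fatou's lemma along the integers, applied to the conditional tails: their scaled limit
  is \<open>C * S powr \<alpha>\<close>, and the assumed bound caps the integrals. This converse to
  Breiman's lemma replaces a direct moment estimate for suprema.\<close>

lemma breiman_bound_integrable: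
  assumes C: "0 < C" and K: "\<And>u. 0 < u \<Longrightarrow> prob {\<omega> \<in> space M. S \<omega> * V \<omega> > u} \<le> K * u powr (- \<alpha>)"
  shows "integrable M (\<lambda>\<omega>. S \<omega> powr \<alpha>)"
proof -
  have [measurable]: "S \<in> borel_measurable M" by (rule V_S_measurable)
  have "(\<integral>\<^sup>+\<omega>. ennreal (C * S \<omega> powr \<alpha>) \<partial>M)
      = (\<integral>\<^sup>+\<omega>. liminf (\<lambda>n. ennreal (real (Suc n) powr \<alpha> * scaled_tail (real (Suc n)) (S \<omega>))) \<partial>M)"
  proof (rule nn_integral_cong)
    fix \<omega>
    have "filterlim (\<lambda>n. real (Suc n)) at_top sequentially"
      by (intro filterlim_compose[OF filterlim_real_sequentially] filterlim_Suc)
    from filterlim_compose[OF scaled_tail_tendsto[OF S_nonneg] this]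
    have "(\<lambda>n. ennreal (real (Suc n) powr \<alpha> * scaled_tail (real (Suc n)) (S \<omega>))) \<longlonglongrightarrow> ennreal (C * S \<omega> powr \<alpha>)"
      by (rule tendsto_ennrealI)
    then show "ennreal (C * S \<omega> powr \<alpha>)
      = liminf (\<lambda>n. ennreal (real (Suc n) powr \<alpha> * scaled_tail (real (Suc n)) (S \<omega>)))"
      by (simp add: lim_imp_Liminf)
  qed
  also have "\<dots> \<le> liminf (\<lambda>n. \<integral>\<^sup>+\<omega>. ennreal (real (Suc n) powr \<alpha> * scaled_tail (real (Suc n)) (S \<omega>)) \<partial>M)"
    by (rule nn_integral_liminf, rule measurable_compose[OF _ measurable_ennreal],
      rule borel_measurable_times[OF borel_measurable_const scaled_tail_measurable])
  also have "\<dots> \<le> ennreal K"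
  proof (rule Liminf_le, simp, intro always_eventually allI)
    fix n
    have "(\<integral>\<^sup>+\<omega>. ennreal (real (Suc n) powr \<alpha> * scaled_tail (real (Suc n)) (S \<omega>)) \<partial>M)
      = ennreal (real (Suc n) powr \<alpha>) * (\<integral>\<^sup>+\<omega>. ennreal (scaled_tail (real (Suc n)) (S \<omega>)) \<partial>M)"
      by (subst nn_integral_cmult[symmetric]) (auto simp: ennreal_mult' scaled_tail_nonneg)
    also have "\<dots> = ennreal (real (Suc n) powr \<alpha> * prob {\<omega> \<in> space M. S \<omega> * V \<omega> > real (Suc n)})"
      by (subst prob_product[symmetric]) (auto simp: ennreal_mult')
    also have "\<dots> \<le> ennreal K"
      using K[of "real (Suc n)"] by (intro ennreal_leI) (simp add: powr_minus field_simps del: of_nat_Suc)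
    finally show "(\<integral>\<^sup>+\<omega>. ennreal (real (Suc n) powr \<alpha> * scaled_tail (real (Suc n)) (S \<omega>)) \<partial>M) \<le> ennreal K" .
  qed
  finally have "(\<integral>\<^sup>+\<omega>. ennreal (C * S \<omega> powr \<alpha>) \<partial>M) < \<infinity>"
    using ennreal_less_top le_less_trans infinity_ennreal_def by metis
  then have "integrable M (\<lambda>\<omega>. C * S \<omega> powr \<alpha>)"
    using C by (intro integrableI_nonneg) auto
  then show ?thesis using C by simp
qed

text \<open>The tail of \<open>V\<close> is below a pure power at all levels, so
  \<open>K * S powr \<alpha>\<close> majorises the scaled conditional tails for every
  \<open>u > 0\<close>; this is why the moment of order exactly \<alpha> suffices, with no
  margin.\<close>

lemma breiman:
  assumes int: "integrable M (\<lambda>\<omega>. S \<omega> powr \<alpha>)"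
  shows "((\<lambda>u. u powr \<alpha> * prob {\<omega> \<in> space M. S \<omega> * V \<omega> > u}) \<longlongrightarrow> C * expectation (\<lambda>\<omega>. S \<omega> powr \<alpha>)) at_top"
proof -
  have [measurable]: "S \<in> borel_measurable M" by (rule V_S_measurable)
  obtain K where K: "0 < K" "\<And>y. 0 < y \<Longrightarrow> prob {\<omega> \<in> space M. V \<omega> > y} \<le> K * y powr (- \<alpha>)"
    using tail_bound[OF tail \<alpha>_pos] by blast
  have "((\<lambda>u. \<integral>\<omega>. u powr \<alpha> * scaled_tail u (S \<omega>) \<partial>M) \<longlongrightarrow> (\<integral>\<omega>. C * S \<omega> powr \<alpha> \<partial>M)) at_top"
  proof (rule integral_dominated_convergence_at_top)
    show "integrable M (\<lambda>\<omega>. K * S \<omega> powr \<alpha>)" using int by simp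
    show "AE \<omega> in M. ((\<lambda>u. u powr \<alpha> * scaled_tail u (S \<omega>)) \<longlongrightarrow> C * S \<omega> powr \<alpha>) at_top"
      using scaled_tail_tendsto[OF S_nonneg] by simp
    show "\<forall>\<^sub>F u in at_top. AE \<omega> in M. norm (u powr \<alpha> * scaled_tail u (S \<omega>)) \<le> K * S \<omega> powr \<alpha>"
      using eventually_gt_at_top[of 0]
    proof eventually_elim
      case (elim u)
      have "norm (u powr \<alpha> * scaled_tail u s) \<le> K * s powr \<alpha>" if "0 \<le> s" for s
      proof (cases "s = 0")
        case False
        then have s: "0 < s" using that by simp
        have "u powr \<alpha> * prob {\<omega> \<in> space M. V \<omega> > u / s} \<le> u powr \<alpha> * (K * (u / s) powr (- \<alpha>))"
          using elim s by (intro mult_left_mono K) auto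
        also have "\<dots> = K * s powr \<alpha>"
          using elim s by (simp add: powr_divide powr_minus field_simps)
        finally show ?thesis using s by (simp add: scaled_tail_def)
      qed (use K in \<open>simp add: scaled_tail_def\<close>)
      then show ?case using S_nonneg by simp
    qed
  qed (auto intro!: borel_measurable_times scaled_tail_measurable)
  moreover have "eventually (\<lambda>u. (\<integral>\<omega>. u powr \<alpha> * scaled_tail u (S \<omega>) \<partial>M)
      = u powr \<alpha> * prob {\<omega> \<in> space M. S \<omega> * V \<omega> > u}) at_top"
    using eventually_gt_at_top[of 0]
  proof eventually_elim
    case (elim u)
    have "(\<integral>\<omega>. scaled_tail u (S \<omega>) \<partial>M) = enn2real (\<integral>\<^sup>+\<omega>. ennreal (scaled_tail u (S \<omega>)) \<partial>M)"
      by (rule integral_eq_nn_integral) (auto simp: scaled_tail_nonneg)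
    then show ?case using prob_product[OF elim, symmetric] by simp
  qed
  ultimately show ?thesis by (simp add: Lim_transform_eventually)
qed

end

end

section \<open>Pathwise structure of the process\<close>

lemma countable_finite_exhaustion:
  assumes "countable S"
  obtains T :: "nat \<Rightarrow> 'c set" where "incseq T" "\<And>n. finite (T n)" "(\<Union>n. T n) = S"
proof (cases "S = {}")
  case True
  then show ?thesis by (intro that[of "\<lambda>_. {}"]) auto
next
  case False
  show ?thesis
  proof (rule that[of "\<lambda>n. from_nat_into S ` {..n}"])
    show "incseq (\<lambda>n. from_nat_into S ` {..n})" by (intro monoI image_mono) auto
    have "(\<Union>n. from_nat_into S ` {..n}) = range (from_nat_into S)" by auto
    then show "(\<Union>n. from_nat_into S ` {..n}) = S"
      using range_from_nat_into[OF False assms] by simp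
  qed simp
qed

lemma sets_Collect_bex_countable:
  assumes "countable S" "\<And>r. r \<in> S \<Longrightarrow> {\<omega> \<in> space N. P r \<omega>} \<in> sets N"
  shows "{\<omega> \<in> space N. \<exists>r\<in>S. P r \<omega>} \<in> sets N"
proof -
  have "{\<omega> \<in> space N. \<exists>r\<in>S. P r \<omega>} = (\<Union>r\<in>S. {\<omega> \<in> space N. P r \<omega>})" by auto
  also have "\<dots> \<in> sets N" using assms by (intro sets.countable_UN') auto
  finally show ?thesis .
qed

lemma sets_Collect_ball_countable:
  assumes "countable S" "\<And>r. r \<in> S \<Longrightarrow> {\<omega> \<in> space N. P r \<omega>} \<in> sets N"
  shows "{\<omega> \<in> space N. \<forall>r\<in>S. P r \<omega>} \<in> sets N"
proof -
  have "{\<omega> \<in> space N. \<forall>r\<in>S. P r \<omega>} = space N - (\<Union>r\<in>S. space N - {\<omega> \<in> space N. P r \<omega>})" by auto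
  also have "\<dots> \<in> sets N" using assms by (intro sets.Diff sets.countable_UN') auto
  finally show ?thesis .
qed

text \<open>Continuity from below. Only among finitely many times is there sure to be a first one
  with a given property, and decompositions by first exceedance rest on that.\<close>

lemma (in prob_space) prob_ex_le:
  assumes "countable S" "\<And>r. r \<in> S \<Longrightarrow> {\<omega> \<in> space M. P r \<omega>} \<in> events"
    and "\<And>T. finite T \<Longrightarrow> T \<subseteq> S \<Longrightarrow> prob {\<omega> \<in> space M. \<exists>r\<in>T. P r \<omega>} \<le> c"
  shows "prob {\<omega> \<in> space M. \<exists>r\<in>S. P r \<omega>} \<le> c"
proof -
  obtain T where T: "incseq T" "\<And>n. finite (T n)" "(\<Union>n. T n) = S"
    using countable_finite_exhaustion[OF assms(1)] by metis
  define E where "E n = {\<omega> \<in> space M. \<exists>r\<in>T n. P r \<omega>}" for n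
  have "E n = (\<Union>r\<in>T n. {\<omega> \<in> space M. P r \<omega>})" for n by (auto simp: E_def)
  moreover have "(\<Union>r\<in>T n. {\<omega> \<in> space M. P r \<omega>}) \<in> events" for n
    using T by (intro sets.finite_UN assms(2)) auto
  ultimately have "E n \<in> events" for n by metis
  moreover have "incseq E"
    using T(1) by (fastforce simp: E_def incseq_def)
  ultimately have "(\<lambda>n. prob (E n)) \<longlonglongrightarrow> prob (\<Union>n. E n)"
    by (intro finite_Lim_measure_incseq) auto
  moreover have "prob (E n) \<le> c" for n
    unfolding E_def using T by (intro assms(3)) auto
  ultimately have "prob (\<Union>n. E n) \<le> c" by (intro LIMSEQ_le_const2) auto
  also have "(\<Union>n. E n) = {\<omega> \<in> space M. \<exists>r\<in>S. P r \<omega>}" unfolding E_def T(3)[symmetric] by auto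
  finally show ?thesis .
qed

lemma fst_borel: "fst \<in> borel_measurable (borel :: ('b::euclidean_space \<times> 'c::euclidean_space) measure)"
  and snd_borel: "snd \<in> borel_measurable (borel :: ('b::euclidean_space \<times> 'c::euclidean_space) measure)"
  by (intro borel_measurable_continuous_onI continuous_intros)+

lemma cadlag_compose:
  assumes "cadlag f" "continuous_on UNIV g"
  shows "cadlag (\<lambda>t. g (f t))"
  unfolding cadlag_def continuous_within
proof (intro conjI allI impI)
  fix t :: real
  have g: "(h \<longlongrightarrow> l) F \<Longrightarrow> ((\<lambda>t. g (h t)) \<longlongrightarrow> g l) F" for h l and F :: "real filter"
    using assms(2) by (auto intro: continuous_on_tendsto_compose)
  show "((\<lambda>t. g (f t)) \<longlongrightarrow> g (f t)) (at_right t)" if "0 \<le> t"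
    using assms(1) that by (intro g) (simp add: cadlag_def continuous_within)
  show "\<exists>l. ((\<lambda>t. g (f t)) \<longlongrightarrow> l) (at_left t)" if t: "0 < t"
  proof -
    obtain l where "(f \<longlongrightarrow> l) (at_left t)" using assms(1) t by (auto simp: cadlag_def)
    from g[OF this] show ?thesis by blast
  qed
qed

section \<open>Almost sure path properties and the affine recursion at dyadic times\<close>

locale gou = prob_space M for M :: "'a measure" +
  fixes \<xi> \<eta> L V :: "real \<Rightarrow> 'a \<Rightarrow> real" and \<alpha> :: real
  assumes triple_levy: "levy_process M (\<lambda>t \<omega>. (\<xi> t \<omega>, \<eta> t \<omega>, L t \<omega>))"
    and V0_indep: "indep_set
           (sets (vimage_algebra (space M) (\<lambda>\<omega>. \<lambda>t\<in>{0..}. (\<xi> t \<omega>, \<eta> t \<omega>, L t \<omega>))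
                    (PiM {0..} (\<lambda>_. borel))))
           (sets (vimage_algebra (space M) (V 0) borel))"
    and sub: "subordinator M \<eta>"
    and tail_cond: "tail_condition M \<xi> \<eta> V \<alpha>"
begin

lemma V_measurable: "0 \<le> t \<Longrightarrow> V t \<in> borel_measurable M"
  using tail_cond by (simp add: tail_condition_def gen_OU_def)

sublocale levy_initial M "\<lambda>t \<omega>. (\<xi> t \<omega>, \<eta> t \<omega>, L t \<omega>)" "V 0"
  by unfold_locales (auto intro: triple_levy V0_indep V_measurable)

lemma \<alpha>_pos: "0 < \<alpha>"
  using tail_cond by (simp add: tail_condition_def)

lemma V_cadlag: "\<omega> \<in> space M \<Longrightarrow> cadlag (\<lambda>t. V t \<omega>)"
  using tail_cond by (simp add: tail_condition_def)

lemma \<xi>_measurable: "0 \<le> t \<Longrightarrow> \<xi> t \<in> borel_measurable M"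
  using measurable_compose[OF X_measurable[of t] fst_borel] by simp

lemma \<xi>_incr_distr:
  assumes "0 \<le> u" "u \<le> t"
  shows "distr M borel (\<lambda>\<omega>. \<xi> t \<omega> - \<xi> u \<omega>) = distr M borel (\<xi> (t - u))"
proof -
  have "distr (distr M borel (\<lambda>\<omega>. (\<xi> t \<omega>, \<eta> t \<omega>, L t \<omega>) - (\<xi> u \<omega>, \<eta> u \<omega>, L u \<omega>))) borel fst
      = distr M borel (\<lambda>\<omega>. fst ((\<xi> t \<omega>, \<eta> t \<omega>, L t \<omega>) - (\<xi> u \<omega>, \<eta> u \<omega>, L u \<omega>)))"
    using assms by (subst distr_distr)
      (auto intro!: borel_measurable_diff X_measurable fst_borel simp: comp_def simp del: diff_Pair)
  moreover have "distr (distr M borel (\<lambda>\<omega>. (\<xi> (t - u) \<omega>, \<eta> (t - u) \<omega>, L (t - u) \<omega>))) borel fst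
      = distr M borel (\<lambda>\<omega>. fst (\<xi> (t - u) \<omega>, \<eta> (t - u) \<omega>, L (t - u) \<omega>))"
    using assms by (subst distr_distr)
      (auto intro!: X_measurable fst_borel simp: comp_def)
  ultimately show ?thesis using incr_distr[OF assms] by simp
qed

lemma \<xi>_incr_past:
  assumes "u \<in> dyadics" "t \<in> dyadics" "u \<le> t" "t \<le> s"
  shows "(\<lambda>\<omega>. \<xi> t \<omega> - \<xi> u \<omega>) \<in> borel_measurable (past s)"
  using measurable_compose[OF incr_past[OF assms] fst_borel] by simp

lemma \<xi>_incr_future:
  assumes "u \<in> dyadics" "t \<in> dyadics" "u \<le> t" "s \<le> u"
  shows "(\<lambda>\<omega>. \<xi> t \<omega> - \<xi> u \<omega>) \<in> borel_measurable (future s)"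
  using measurable_compose[OF incr_future[OF assms] fst_borel] by simp

lemma \<eta>_incr_past:
  assumes "u \<in> dyadics" "t \<in> dyadics" "u \<le> t" "t \<le> s"
  shows "(\<lambda>\<omega>. \<eta> t \<omega> - \<eta> u \<omega>) \<in> borel_measurable (past s)"
  using measurable_compose[OF incr_past[OF assms] measurable_compose[OF snd_borel fst_borel]] by simp

lemma \<eta>_incr_future:
  assumes "u \<in> dyadics" "t \<in> dyadics" "u \<le> t" "s \<le> u"
  shows "(\<lambda>\<omega>. \<eta> t \<omega> - \<eta> u \<omega>) \<in> borel_measurable (future s)"
  using measurable_compose[OF incr_future[OF assms] measurable_compose[OF snd_borel fst_borel]] by simp

text \<open>The affine identity is demanded at dyadic times only, as its null set depends on the
  time. The set of good points is not claimed to be an event; it is used through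
  \<open>AE_good\<close>.\<close>

definition good :: "'a \<Rightarrow> bool" where
  "good \<omega> \<longleftrightarrow> \<omega> \<in> space M \<and> cadlag (\<lambda>t. \<xi> t \<omega>) \<and> cadlag (\<lambda>t. \<eta> t \<omega>) \<and> \<xi> 0 \<omega> = 0 \<and>
     (\<forall>s t. 0 \<le> s \<longrightarrow> s \<le> t \<longrightarrow> \<eta> s \<omega> \<le> \<eta> t \<omega>) \<and>
     (\<forall>t\<in>dyadics. V t \<omega> = exp (- \<xi> t \<omega>) * (exp_integral \<xi> \<eta> t \<omega> + V 0 \<omega>)) \<and>
     (\<forall>t\<ge>0. 0 \<le> V t \<omega>)"

lemma \<eta>_mono_dyadics: "AE \<omega> in M. \<forall>s\<in>dyadics. \<forall>t\<in>dyadics. s \<le> t \<longrightarrow> \<eta> s \<omega> \<le> \<eta> t \<omega>"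
proof (intro AE_ball_countable' countable_dyadics)
  fix s t assume st: "s \<in> dyadics" "t \<in> dyadics"
  show "AE \<omega> in M. s \<le> t \<longrightarrow> \<eta> s \<omega> \<le> \<eta> t \<omega>"
  proof (cases "s \<le> t")
    case True
    have \<eta>: "levy_process M \<eta>" and pos: "AE \<omega> in M. 0 \<le> \<eta> (t - s) \<omega>"
      using sub True by (simp_all add: subordinator_def)
    have [measurable]: "\<eta> s \<in> borel_measurable M" "\<eta> t \<in> borel_measurable M" "\<eta> (t - s) \<in> borel_measurable M"
      using \<eta> True dyadics_nonneg[OF st(1)] by (auto simp: levy_process_def)
    have "distr M borel (\<lambda>\<omega>. \<eta> (s + (t - s)) \<omega> - \<eta> s \<omega>) = distr M borel (\<eta> (t - s))"
      using \<eta> True dyadics_nonneg[OF st(1)] unfolding levy_process_def by (meson diff_ge_0_iff_ge)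
    then have eq: "distr M borel (\<lambda>\<omega>. \<eta> t \<omega> - \<eta> s \<omega>) = distr M borel (\<eta> (t - s))" by simp
    have "AE y in distr M borel (\<eta> (t - s)). 0 \<le> y"
      using pos by (subst AE_distr_iff) auto
    then have "AE y in distr M borel (\<lambda>\<omega>. \<eta> t \<omega> - \<eta> s \<omega>). 0 \<le> y" unfolding eq .
    then have "AE \<omega> in M. 0 \<le> \<eta> t \<omega> - \<eta> s \<omega>"
      by (subst (asm) AE_distr_iff) auto
    then show ?thesis by simp
  qed simp
qed

lemma AE_good: "AE \<omega> in M. good \<omega>"
proof -
  have V: "AE \<omega> in M. \<forall>t\<in>dyadics. V t \<omega> = exp (- \<xi> t \<omega>) * (exp_integral \<xi> \<eta> t \<omega> + V 0 \<omega>)"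
    using tail_cond dyadics_nonneg
    by (intro AE_ball_countable' countable_dyadics) (auto simp: tail_condition_def gen_OU_def)
  have pos: "AE \<omega> in M. \<forall>t\<ge>0. 0 \<le> V t \<omega>"
    using tail_cond by (simp add: tail_condition_def)
  have zero: "AE \<omega> in M. (\<xi> 0 \<omega>, \<eta> 0 \<omega>, L 0 \<omega>) = 0"
    and cadlag: "AE \<omega> in M. cadlag (\<lambda>t. (\<xi> t \<omega>, \<eta> t \<omega>, L t \<omega>))"
    using triple_levy by (simp_all add: levy_process_def)
  show ?thesis
    using V pos zero cadlag \<eta>_mono_dyadics AE_space
  proof eventually_elim
    case (elim \<omega>)
    have \<xi>: "cadlag (\<lambda>t. \<xi> t \<omega>)" using cadlag_compose[OF elim(4) continuous_on_fst[OF continuous_on_id]] by simp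
    have \<eta>: "cadlag (\<lambda>t. \<eta> t \<omega>)" using cadlag_compose[OF elim(4) continuous_on_fst[OF continuous_on_snd[OF continuous_on_id]]] by simp
    \<comment> \<open>Monotonicity at dyadic times passes to all times: a violation with a level
      \<open>c\<close> strictly in between persists at a dyadic time just after \<open>s\<close>
      and, for the reflected path, at one just after \<open>t\<close>.\<close>
    have "\<eta> s \<omega> \<le> \<eta> t \<omega>" if st: "0 \<le> s" "s \<le> t" for s t
    proof (rule ccontr)
      assume "\<not> \<eta> s \<omega> \<le> \<eta> t \<omega>"
      then have "\<eta> t \<omega> < \<eta> s \<omega>" by simp
      from dense[OF this] obtain c where c: "\<eta> t \<omega> < c" "c < \<eta> s \<omega>" by blast
      have "s \<noteq> t" using c by auto
      with st have "s < t" by simp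
      from cadlag_dyadic_exceeds[OF \<eta> st(1) this c(2)]
      obtain r where r: "r \<in> dyadics" "r < t" "c < \<eta> r \<omega>" by blast
      have "- c < - \<eta> t \<omega>" "t < t + 1" "0 \<le> t" using c st by auto
      from cadlag_dyadic_exceeds[OF cadlag_compose[OF \<eta> continuous_on_minus[OF continuous_on_id]] this(3,2,1)]
      obtain r' where r': "r' \<in> dyadics" "t < r'" "- c < - \<eta> r' \<omega>" by blast
      have "\<eta> r \<omega> \<le> \<eta> r' \<omega>" using elim(5) r r' by auto
      with r r' show False by simp
    qed
    moreover have "\<xi> 0 \<omega> = 0" using elim(3) by (simp add: zero_prod_def)
    ultimately show ?case
      unfolding good_def using elim(1,2,6) \<xi> \<eta> by blast
  qed
qed

lemma prob_mono_good:
  assumes "\<And>\<omega>. good \<omega> \<Longrightarrow> \<omega> \<in> A \<Longrightarrow> \<omega> \<in> B" "B \<in> events"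
  shows "prob A \<le> prob B"
  by (rule finite_measure_mono_AE[OF AE_mp[OF AE_good] assms(2)]) (use assms(1) in simp)

lemma prob_cong_good:
  assumes "\<And>\<omega>. good \<omega> \<Longrightarrow> \<omega> \<in> A \<longleftrightarrow> \<omega> \<in> B" "A \<in> events" "B \<in> events"
  shows "prob A = prob B"
  using assms by (intro antisym prob_mono_good) auto

text \<open>The factor \<open>exp (- \<xi> t)\<close> in front of the integral is absorbed into the
  summands, so that every term depends on increments inside \<open>[u, t]\<close> only.\<close>

definition riemann_B :: "nat \<Rightarrow> real \<Rightarrow> real \<Rightarrow> 'a \<Rightarrow> real" where
  "riemann_B n u t \<omega> = (\<Sum>i\<in>stieltjes_cells n u t.
     exp (- (\<xi> t \<omega> - \<xi> (real i / 2 ^ n) \<omega>)) * (\<eta> (real (Suc i) / 2 ^ n) \<omega> - \<eta> (real i / 2 ^ n) \<omega>))"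

text \<open>At good points and dyadic times this is \<open>exp (- \<xi> t)\<close> times the
  integral over \<open>(u, t]\<close>. It is introduced as a limit and not by that formula because
  the limit inherits measurability from the sums, both for the future of \<open>u\<close> and for
  the past of \<open>t\<close>.\<close>

definition B :: "real \<Rightarrow> real \<Rightarrow> 'a \<Rightarrow> real" where
  "B u t \<omega> = lim (\<lambda>n. riemann_B n u t \<omega>)"

lemma stieltjes_cell_bounds:
  assumes "i \<in> stieltjes_cells n u t"
  shows "u \<le> real i / 2 ^ n" "real i / 2 ^ n \<le> real (Suc i) / 2 ^ n" "real (Suc i) / 2 ^ n \<le> t"
    "real i / 2 ^ n \<le> t"
proof -
  show *: "real i / 2 ^ n \<le> real (Suc i) / 2 ^ n" by (simp add: divide_right_mono)
  show "u \<le> real i / 2 ^ n" and **: "real (Suc i) / 2 ^ n \<le> t"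
    using assms by (simp_all add: stieltjes_cells_def)
  show "real i / 2 ^ n \<le> t" using * ** by (rule order_trans)
qed

lemma B_future:
  assumes "u \<in> dyadics" "t \<in> dyadics"
  shows "B u t \<in> borel_measurable (future u)"
  unfolding B_def riemann_B_def
  by (intro borel_measurable_lim_metric borel_measurable_sum borel_measurable_times
      measurable_compose[OF _ borel_measurable_exp] borel_measurable_uminus \<xi>_incr_future \<eta>_incr_future)
    (use assms stieltjes_cell_bounds in \<open>auto intro: dyadicsI simp del: of_nat_Suc\<close>)

lemma B_past:
  assumes "u \<in> dyadics" "t \<in> dyadics"
  shows "B u t \<in> borel_measurable (past t)"
  unfolding B_def riemann_B_def
  by (intro borel_measurable_lim_metric borel_measurable_sum borel_measurable_times
      measurable_compose[OF _ borel_measurable_exp] borel_measurable_uminus \<xi>_incr_past \<eta>_incr_past)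
    (use assms stieltjes_cell_bounds in \<open>auto intro: dyadicsI simp del: of_nat_Suc\<close>)

lemma stieltjes_cells_split:
  assumes "u = real j / 2 ^ m" "m \<le> n" "u \<le> t"
  shows "stieltjes_cells n 0 t = stieltjes_cells n 0 u \<union> stieltjes_cells n u t"
    and "stieltjes_cells n 0 u \<inter> stieltjes_cells n u t = {}"
proof -
  define J where "J = j * 2 ^ (n - m)"
  have u: "u = real J / 2 ^ n" using assms(1,2) by (auto simp: J_def le_iff_add power_add)
  have le: "real a / 2 ^ n \<le> real b / 2 ^ n \<longleftrightarrow> a \<le> b" for a b :: nat
    by (simp add: divide_le_cancel)
  show "stieltjes_cells n 0 t = stieltjes_cells n 0 u \<union> stieltjes_cells n u t"
  proof -
    have "real (Suc i) / 2 ^ n \<le> t" if "Suc i \<le> J" for i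
      using le[of "Suc i" J] that assms(3) u by simp
    moreover have "0 \<le> u" by (simp add: u)
    ultimately show ?thesis
      unfolding stieltjes_cells_def by (auto simp: u le simp del: of_nat_Suc)
  qed
  show "stieltjes_cells n 0 u \<inter> stieltjes_cells n u t = {}"
    unfolding stieltjes_cells_def by (auto simp: u le simp del: of_nat_Suc)
qed

lemma riemann_B_limit:
  assumes g: "good \<omega>" and ut: "u \<in> dyadics" "t \<in> dyadics" "u \<le> t"
  shows "(\<lambda>n. riemann_B n u t \<omega>) \<longlonglongrightarrow> exp (- \<xi> t \<omega>) * (exp_integral \<xi> \<eta> t \<omega> - exp_integral \<xi> \<eta> u \<omega>)"
proof -
  define c where "c n i = exp (\<xi> (real i / 2 ^ n) \<omega>) * (\<eta> (real (Suc i) / 2 ^ n) \<omega> - \<eta> (real i / 2 ^ n) \<omega>)"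
    for n i :: nat
  have lim: "(\<lambda>n. \<Sum>i\<in>stieltjes_cells n 0 s. c n i) \<longlonglongrightarrow> exp_integral \<xi> \<eta> s \<omega>" if "s \<in> dyadics" for s
    unfolding exp_integral_def c_def
    by (rule exp_stieltjes_limit) (use g that in \<open>simp_all add: good_def\<close>)
  obtain j m where jm: "u = real j / 2 ^ m" using ut(1) by (auto simp: dyadics_def)
  have "(\<lambda>n. exp (- \<xi> t \<omega>) * ((\<Sum>i\<in>stieltjes_cells n 0 t. c n i) - (\<Sum>i\<in>stieltjes_cells n 0 u. c n i)))
    \<longlonglongrightarrow> exp (- \<xi> t \<omega>) * (exp_integral \<xi> \<eta> t \<omega> - exp_integral \<xi> \<eta> u \<omega>)"
    using ut by (intro tendsto_mult tendsto_const tendsto_diff lim) auto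
  moreover have "\<forall>\<^sub>F n in sequentially.
    exp (- \<xi> t \<omega>) * ((\<Sum>i\<in>stieltjes_cells n 0 t. c n i) - (\<Sum>i\<in>stieltjes_cells n 0 u. c n i)) = riemann_B n u t \<omega>"
    using eventually_ge_at_top[of m]
  proof eventually_elim
    case (elim n)
    have "(\<Sum>i\<in>stieltjes_cells n 0 t. c n i) = (\<Sum>i\<in>stieltjes_cells n 0 u. c n i) + (\<Sum>i\<in>stieltjes_cells n u t. c n i)"
      using stieltjes_cells_split[OF jm elim ut(3)] by (simp add: sum.union_disjoint finite_stieltjes_cells)
    then show ?case
      by (simp add: riemann_B_def c_def sum_distrib_left exp_diff exp_minus field_simps)
  qed
  ultimately show ?thesis by (rule Lim_transform_eventually)
qed

lemma V_eq_B:
  assumes g: "good \<omega>" and ut: "u \<in> dyadics" "t \<in> dyadics" "u \<le> t"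
  shows "V t \<omega> = exp (- (\<xi> t \<omega> - \<xi> u \<omega>)) * V u \<omega> + B u t \<omega>"
proof -
  have B: "B u t \<omega> = exp (- \<xi> t \<omega>) * (exp_integral \<xi> \<eta> t \<omega> - exp_integral \<xi> \<eta> u \<omega>)"
    unfolding B_def by (rule limI[OF riemann_B_limit[OF assms]])
  have "V t \<omega> = exp (- \<xi> t \<omega>) * (exp_integral \<xi> \<eta> t \<omega> + V 0 \<omega>)"
    "V u \<omega> = exp (- \<xi> u \<omega>) * (exp_integral \<xi> \<eta> u \<omega> + V 0 \<omega>)"
    using g ut by (auto simp: good_def)
  moreover have "exp (- (\<xi> t \<omega> - \<xi> u \<omega>)) * exp (- \<xi> u \<omega>) = exp (- \<xi> t \<omega>)"
    by (simp flip: exp_add)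
  ultimately show ?thesis by (simp add: B mult.assoc[symmetric]) (simp add: algebra_simps)
qed

lemma B_nonneg:
  assumes g: "good \<omega>" and ut: "u \<in> dyadics" "t \<in> dyadics" "u \<le> t"
  shows "0 \<le> B u t \<omega>"
proof -
  have "0 \<le> riemann_B n u t \<omega>" for n
    unfolding riemann_B_def
  proof (intro sum_nonneg mult_nonneg_nonneg)
    fix i assume "i \<in> stieltjes_cells n u t"
    show "0 \<le> \<eta> (real (Suc i) / 2 ^ n) \<omega> - \<eta> (real i / 2 ^ n) \<omega>"
      using g unfolding good_def by (simp add: divide_right_mono)
  qed simp
  then have "0 \<le> exp (- \<xi> t \<omega>) * (exp_integral \<xi> \<eta> t \<omega> - exp_integral \<xi> \<eta> u \<omega>)"
    by (intro LIMSEQ_le_const[OF riemann_B_limit[OF assms]]) auto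
  then show ?thesis unfolding B_def limI[OF riemann_B_limit[OF assms]] .
qed

lemma V_ge_scaled:
  assumes "good \<omega>" "u \<in> dyadics" "t \<in> dyadics" "u \<le> t"
  shows "exp (- (\<xi> t \<omega> - \<xi> u \<omega>)) * V u \<omega> \<le> V t \<omega>"
  using V_eq_B[OF assms] B_nonneg[OF assms] by simp

text \<open>Inserting \<open>V_eq_B\<close> with initial time 0 on both sides of
  \<open>V_ge_scaled\<close> makes the terms with \<open>V 0\<close> coincide, and they
  cancel.\<close>

lemma B_ge_scaled:
  assumes g: "good \<omega>" and ut: "u \<in> dyadics" "t \<in> dyadics" "u \<le> t"
  shows "exp (- (\<xi> t \<omega> - \<xi> u \<omega>)) * B 0 u \<omega> \<le> B 0 t \<omega>"
proof -
  have nn: "0 \<le> u" "0 \<le> t" using ut dyadics_nonneg by auto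
  have "exp (- (\<xi> t \<omega> - \<xi> u \<omega>)) * (exp (- (\<xi> u \<omega> - \<xi> 0 \<omega>)) * V 0 \<omega> + B 0 u \<omega>)
    \<le> exp (- (\<xi> t \<omega> - \<xi> 0 \<omega>)) * V 0 \<omega> + B 0 t \<omega>"
    using V_ge_scaled[OF assms] V_eq_B[OF g zero_dyadics ut(1) nn(1)] V_eq_B[OF g zero_dyadics ut(2) nn(2)]
    by simp
  moreover have "exp (- (\<xi> t \<omega> - \<xi> u \<omega>)) * exp (- (\<xi> u \<omega> - \<xi> 0 \<omega>)) = exp (- (\<xi> t \<omega> - \<xi> 0 \<omega>))"
    by (simp flip: exp_add)
  ultimately show ?thesis by (simp add: distrib_left mult.assoc[symmetric])
qed

text \<open>\<open>V t\<close> is only known to be measurable for \<open>M\<close>, since it agrees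
  with a functional of \<open>V 0\<close> and the increments up to a null set. This copy is
  measurable for the past and agrees with \<open>V\<close> at dyadic times of good points.\<close>

definition V_adapted :: "real \<Rightarrow> 'a \<Rightarrow> real" where
  "V_adapted t \<omega> = exp (- (\<xi> t \<omega> - \<xi> 0 \<omega>)) * V 0 \<omega> + B 0 t \<omega>"

lemma V_adapted_eq: "good \<omega> \<Longrightarrow> t \<in> dyadics \<Longrightarrow> V_adapted t \<omega> = V t \<omega>"
  unfolding V_adapted_def using V_eq_B[OF _ zero_dyadics _ dyadics_nonneg, of \<omega> t] by simp

lemma V_adapted_past:
  assumes "t \<in> dyadics" "t \<le> s"
  shows "V_adapted t \<in> borel_measurable (past s)"
  unfolding V_adapted_def[abs_def]
  by (intro borel_measurable_add borel_measurable_times measurable_compose[OF _ borel_measurable_exp]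
      borel_measurable_uminus \<xi>_incr_past past_le[OF B_past] U_past zero_dyadics assms dyadics_nonneg)

lemma V_adapted_measurable: "t \<in> dyadics \<Longrightarrow> V_adapted t \<in> borel_measurable M"
  using V_adapted_past[OF _ order_refl] by (rule measurable_past)

text \<open>One bound serves all pairs of times, because the law of an increment depends on
  \<open>t - r\<close> only and the path of \<xi> is almost surely bounded on \<open>[0, m]\<close>:
  some \<open>k\<close> is an upper bound there with probability above 1/2.\<close>

lemma \<xi>_bound_prob:
  obtains b :: real where "\<And>r t. r \<in> dyadics \<Longrightarrow> t \<in> dyadics \<Longrightarrow> r \<le> t \<Longrightarrow> t - r \<le> m \<Longrightarrow>
    1 / 2 \<le> prob {\<omega> \<in> space M. \<xi> t \<omega> - \<xi> r \<omega> \<le> b}"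
proof -
  define E where "E k = {\<omega> \<in> space M. \<forall>u\<in>dyadics \<inter> {..m}. \<xi> u \<omega> \<le> real k}" for k :: nat
  have [measurable]: "u \<in> dyadics \<Longrightarrow> \<xi> u \<in> borel_measurable M" for u
    using \<xi>_measurable dyadics_nonneg by blast
  have E: "E k \<in> events" for k
    unfolding E_def using dyadics_nonneg
    by (intro sets_Collect_ball_countable countable_Int1[OF countable_dyadics]) auto
  have "incseq E"
  proof (rule incseq_SucI)
    show "E k \<subseteq> E (Suc k)" for k unfolding E_def by force
  qed
  then have "(\<lambda>k. prob (E k)) \<longlonglongrightarrow> prob (\<Union>k. E k)"
    using E by (intro finite_Lim_measure_incseq) auto
  also have "prob (\<Union>k. E k) = 1"
  proof (rule prob_eq_1[THEN iffD2])
    show "AE \<omega> in M. \<omega> \<in> (\<Union>k. E k)"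
      using AE_good
    proof eventually_elim
      case (elim \<omega>)
      then obtain K where K: "\<And>t. 0 \<le> t \<Longrightarrow> t \<le> m \<Longrightarrow> \<bar>\<xi> t \<omega>\<bar> \<le> K"
        unfolding good_def using cadlag_bounded by blast
      obtain k :: nat where "K \<le> real k" using real_arch_simple by blast
      have "\<xi> u \<omega> \<le> real k" if "u \<in> dyadics \<inter> {..m}" for u
        using K[of u] dyadics_nonneg[of u] that \<open>K \<le> real k\<close> by auto
      then have "\<omega> \<in> E k" using elim by (simp add: E_def good_def)
      then show ?case by blast
    qed
  qed (use E in auto)
  finally have "\<forall>\<^sub>F k in sequentially. 1 / 2 < prob (E k)"
    by (rule order_tendstoD) simp
  then obtain k where k: "1 / 2 < prob (E k)" by (auto simp: eventually_sequentially)
  show ?thesis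
  proof (rule that[of "real k"])
    fix r t assume rt: "r \<in> dyadics" "t \<in> dyadics" "r \<le> t" "t - r \<le> m"
    then have d: "t - r \<in> dyadics" and r0: "0 \<le> r" by (auto intro: dyadics_diff dyadics_nonneg)
    have "prob (E k) \<le> prob {\<omega> \<in> space M. \<xi> (t - r) \<omega> \<le> real k}"
      using d rt by (intro finite_measure_mono) (auto simp: E_def)
    also have "\<dots> = measure (distr M borel (\<xi> (t - r))) {..real k}"
      using d by (subst measure_distr) (auto intro!: arg_cong[where f = prob])
    also have "\<dots> = measure (distr M borel (\<lambda>\<omega>. \<xi> t \<omega> - \<xi> r \<omega>)) {..real k}"
      using \<xi>_incr_distr[OF r0 rt(3)] by simp
    also have "\<dots> = prob {\<omega> \<in> space M. \<xi> t \<omega> - \<xi> r \<omega> \<le> real k}"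
      using rt by (subst measure_distr) (auto intro!: arg_cong[where f = prob])
    finally show "1 / 2 \<le> prob {\<omega> \<in> space M. \<xi> t \<omega> - \<xi> r \<omega> \<le> real k}" using k by simp
  qed
qed

text \<open>
  Decomposition at the first time \<open>r\<close> with \<open>Z r > y\<close>: from then on \<open>\<xi>\<close> increases by at most \<open>b\<close> with
  probability at least \<open>1 / 2\<close>, independently of the past.
\<close>

lemma ottaviani:
  assumes st: "s \<in> dyadics" "t \<in> dyadics" and A: "A \<in> sets (past s)"
    and Z: "\<And>r. r \<in> dyadics \<Longrightarrow> s \<le> r \<Longrightarrow> r \<le> t \<Longrightarrow> Z r \<in> borel_measurable (past r)"
    and half: "\<And>r. r \<in> dyadics \<Longrightarrow> s \<le> r \<Longrightarrow> r \<le> t \<Longrightarrow> 1 / 2 \<le> prob {\<omega> \<in> space M. \<xi> t \<omega> - \<xi> r \<omega> \<le> b}"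
    and grow: "\<And>\<omega> r. good \<omega> \<Longrightarrow> r \<in> dyadics \<Longrightarrow> s \<le> r \<Longrightarrow> r \<le> t \<Longrightarrow>
      exp (- (\<xi> t \<omega> - \<xi> r \<omega>)) * Z r \<omega> \<le> Z t \<omega>"
    and y: "0 < y" and stle: "s \<le> t"
  shows "prob {\<omega> \<in> space M. \<exists>r\<in>dyadics \<inter> {s..t}. \<omega> \<in> A \<and> y < Z r \<omega>}
    \<le> 2 * prob {\<omega> \<in> space M. \<omega> \<in> A \<and> y * exp (- b) < Z t \<omega>}"
proof (rule prob_ex_le)
  show "countable (dyadics \<inter> {s..t})" using countable_dyadics by simp
  have A_events: "A \<in> events" using A sets_past_subset by blast
  have Zm: "r \<in> dyadics \<Longrightarrow> s \<le> r \<Longrightarrow> r \<le> t \<Longrightarrow> Z r \<in> borel_measurable M" for r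
    using Z measurable_past by blast
  show "{\<omega> \<in> space M. \<omega> \<in> A \<and> y < Z r \<omega>} \<in> events" if "r \<in> dyadics \<inter> {s..t}" for r
  proof -
    have [measurable]: "Z r \<in> borel_measurable M" using Zm that by auto
    show ?thesis using A_events by measurable
  qed
  fix T assume T: "finite T" "T \<subseteq> dyadics \<inter> {s..t}"
  let ?C = "{\<omega> \<in> space M. \<omega> \<in> A \<and> y * exp (- b) < Z t \<omega>}"
  have [measurable]: "Z t \<in> borel_measurable M" using Zm st stle by auto
  have C: "?C \<in> events" using A_events by measurable
  define E where "E r = {\<omega> \<in> space M. \<omega> \<in> A \<and> y < Z r \<omega> \<and> (\<forall>r'\<in>{r'\<in>T. r' < r}. Z r' \<omega> \<le> y)}" for r
  define D where "D r = {\<omega> \<in> space M. \<xi> t \<omega> - \<xi> r \<omega> \<le> b}" for r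
  have E: "E r \<in> sets (past r)" and D: "D r \<in> sets (future r)" if "r \<in> T" for r
  proof -
    have r: "r \<in> dyadics" "s \<le> r" "r \<le> t" using that T by auto
    have [measurable]: "Z r \<in> borel_measurable (past r)" by (rule Z[OF r])
    have [measurable]: "A \<in> sets (past r)" using A sets_past_mono[OF r(2)] by blast
    have "{\<omega> \<in> space (past r). Z r' \<omega> \<le> y} \<in> sets (past r)" if "r' \<in> {r'\<in>T. r' < r}" for r'
    proof -
      have "Z r' \<in> borel_measurable (past r)"
        using that T r by (intro past_le[OF Z[of r']]) auto
      then show ?thesis by measurable
    qed
    then have "{\<omega> \<in> space (past r). \<forall>r'\<in>{r'\<in>T. r' < r}. Z r' \<omega> \<le> y} \<in> sets (past r)"
      using T(1) by (intro sets.sets_Collect_finite_All) auto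
    moreover have "{\<omega> \<in> space (past r). \<omega> \<in> A \<and> y < Z r \<omega>} \<in> sets (past r)" by measurable
    ultimately have "{\<omega> \<in> space (past r). (\<omega> \<in> A \<and> y < Z r \<omega>) \<and> (\<forall>r'\<in>{r'\<in>T. r' < r}. Z r' \<omega> \<le> y)} \<in> sets (past r)"
      by (rule sets.sets_Collect_conj)
    then show "E r \<in> sets (past r)" by (simp add: E_def)
    have [measurable]: "(\<lambda>\<omega>. \<xi> t \<omega> - \<xi> r \<omega>) \<in> borel_measurable (future r)"
      using r st by (intro \<xi>_incr_future) auto
    have "{\<omega> \<in> space (future r). \<xi> t \<omega> - \<xi> r \<omega> \<le> b} \<in> sets (future r)" by measurable
    then show "D r \<in> sets (future r)" by (simp add: D_def)
  qed
  have Ev: "E r \<in> events" "D r \<in> events" if "r \<in> T" for r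
    using E[OF that] D[OF that] sets_past_subset sets_future_subset by blast+
  have disj: "disjoint_family_on E T"
    unfolding disjoint_family_on_def E_def by (force simp: not_less neq_iff)
  have "{\<omega> \<in> space M. \<exists>r\<in>T. \<omega> \<in> A \<and> y < Z r \<omega>} \<subseteq> (\<Union>r\<in>T. E r)"
  proof clarify
    fix \<omega> r assume *: "\<omega> \<in> space M" "r \<in> T" "\<omega> \<in> A" "y < Z r \<omega>"
    define r0 where "r0 = Min {r\<in>T. y < Z r \<omega>}"
    have "r0 \<in> {r\<in>T. y < Z r \<omega>}" unfolding r0_def using * T(1) by (intro Min_in) auto
    moreover have "Z r' \<omega> \<le> y" if "r' \<in> T" "r' < r0" for r'
    proof (rule ccontr)
      assume "\<not> Z r' \<omega> \<le> y"
      then have "r0 \<le> r'" unfolding r0_def using that T(1) by (intro Min_le) auto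
      with that show False by simp
    qed
    ultimately have "\<omega> \<in> E r0" "r0 \<in> T" using * by (auto simp: E_def)
    then show "\<omega> \<in> (\<Union>r\<in>T. E r)" by blast
  qed
  then have "prob {\<omega> \<in> space M. \<exists>r\<in>T. \<omega> \<in> A \<and> y < Z r \<omega>} \<le> prob (\<Union>r\<in>T. E r)"
    using Ev T(1) by (intro finite_measure_mono) auto
  also have "\<dots> = (\<Sum>r\<in>T. prob (E r))"
    using Ev T(1) disj by (intro finite_measure_finite_Union) auto
  also have "\<dots> \<le> (\<Sum>r\<in>T. 2 * prob (E r \<inter> D r))"
  proof (rule sum_mono)
    fix r assume r: "r \<in> T"
    then have "1 / 2 \<le> prob (D r)" unfolding D_def using T by (intro half) auto
    then have "prob (E r) * (1 / 2) \<le> prob (E r) * prob (D r)" by (intro mult_left_mono) auto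
    also have "\<dots> = prob (E r \<inter> D r)" using E[OF r] D[OF r] by (rule prob_past_future[symmetric])
    finally show "prob (E r) \<le> 2 * prob (E r \<inter> D r)" by simp
  qed
  also have "\<dots> = 2 * prob (\<Union>r\<in>T. E r \<inter> D r)"
  proof -
    have "disjoint_family_on (\<lambda>r. E r \<inter> D r) T"
      using disj unfolding disjoint_family_on_def by blast
    then have "prob (\<Union>r\<in>T. E r \<inter> D r) = (\<Sum>r\<in>T. prob (E r \<inter> D r))"
      using Ev T(1) by (intro finite_measure_finite_Union) auto
    then show ?thesis by (simp add: sum_distrib_left)
  qed
  also have "prob (\<Union>r\<in>T. E r \<inter> D r) \<le> prob ?C"
  proof (rule prob_mono_good[OF _ C])
    fix \<omega> assume g: "good \<omega>" and "\<omega> \<in> (\<Union>r\<in>T. E r \<inter> D r)"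
    then obtain r where r: "r \<in> T" and \<omega>: "\<omega> \<in> E r" "\<omega> \<in> D r" by blast
    have "exp (- b) \<le> exp (- (\<xi> t \<omega> - \<xi> r \<omega>))" using \<omega>(2) by (simp add: D_def)
    moreover have "y < Z r \<omega>" using \<omega>(1) by (simp add: E_def)
    ultimately have "y * exp (- b) < Z r \<omega> * exp (- (\<xi> t \<omega> - \<xi> r \<omega>))"
      using y by (intro mult_less_le_imp_less) auto
    also have "\<dots> = exp (- (\<xi> t \<omega> - \<xi> r \<omega>)) * Z r \<omega>" by (rule mult.commute)
    also have "\<dots> \<le> Z t \<omega>" using r T(2) by (intro grow[OF g]) auto
    finally show "\<omega> \<in> ?C" using \<omega>(1) by (simp add: E_def)
  qed
  finally show "prob {\<omega> \<in> space M. \<exists>r\<in>T. \<omega> \<in> A \<and> y < Z r \<omega>} \<le> 2 * prob ?C" by simp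
qed

end

section \<open>Tails of suprema over bounded intervals\<close>

lemma (in prob_space) indep_var_nn_integral_mult:
  fixes f g :: "'a \<Rightarrow> ennreal"
  assumes "indep_var borel f borel g"
  shows "(\<integral>\<^sup>+\<omega>. f \<omega> * g \<omega> \<partial>M) = (\<integral>\<^sup>+\<omega>. f \<omega> \<partial>M) * (\<integral>\<^sup>+\<omega>. g \<omega> \<partial>M)"
proof -
  have eq: "case_bool borel borel = (\<lambda>_. borel)" by (rule ext) (simp split: bool.split)
  have "indep_vars (\<lambda>_. borel) (case_bool f g) UNIV"
    using assms unfolding indep_var_def eq .
  from indep_vars_nn_integral[OF finite this] show ?thesis by (simp add: UNIV_bool mult.commute)
qed

lemma powr_less_iff_base:
  "0 < a \<Longrightarrow> 0 \<le> x \<Longrightarrow> 0 \<le> y \<Longrightarrow> x powr a < y powr a \<longleftrightarrow> x < (y::real)"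
  using powr_less_mono2[of a x y] powr_mono2[of a y x] by linarith

text \<open>\<open>exp_moment\<close> is the condition \<open>Psi M \<xi> \<alpha> = 0\<close> freed
  of the logarithm, and \<open>V0_tail\<close> is the tail equivalence written as a limit.\<close>

locale gou_tail = gou M \<xi> \<eta> L V \<alpha>
  for M :: "'a measure" and \<xi> \<eta> L V :: "real \<Rightarrow> 'a \<Rightarrow> real" and \<alpha> :: real +
  fixes C :: real
  assumes C_pos: "0 < C"
    and V0_tail: "((\<lambda>y. y powr \<alpha> * prob {\<omega> \<in> space M. V 0 \<omega> > y}) \<longlongrightarrow> C) at_top"
    and exp_moment: "(\<integral>\<^sup>+\<omega>. ennreal (exp (- \<alpha> * \<xi> 1 \<omega>)) \<partial>M) = 1"
begin

section \<open>Exponential moments of the increments\<close>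

lemma \<xi>_dyadic [measurable]: "t \<in> dyadics \<Longrightarrow> \<xi> t \<in> borel_measurable M"
  using \<xi>_measurable dyadics_nonneg by blast

lemma V_dyadic [measurable]: "t \<in> dyadics \<Longrightarrow> V t \<in> borel_measurable M"
  using V_measurable dyadics_nonneg by blast

text \<open>Valued in the extended nonnegative reals, so that multiplicativity in time holds without
  any integrability.\<close>

definition exp_mom :: "real \<Rightarrow> real \<Rightarrow> ennreal" where
  "exp_mom c t = (\<integral>\<^sup>+\<omega>. ennreal (exp (- c * \<xi> t \<omega>)) \<partial>M)"

lemma exp_mom_incr:
  assumes "s \<in> dyadics" "t \<in> dyadics" "s \<le> t"
  shows "(\<integral>\<^sup>+\<omega>. ennreal (exp (- c * (\<xi> t \<omega> - \<xi> s \<omega>))) \<partial>M) = exp_mom c (t - s)"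
proof -
  have [measurable]: "\<xi> s \<in> borel_measurable M" "\<xi> t \<in> borel_measurable M" "\<xi> (t - s) \<in> borel_measurable M"
    using assms dyadics_diff by (auto intro: \<xi>_dyadic)
  have "(\<integral>\<^sup>+\<omega>. ennreal (exp (- c * (\<xi> t \<omega> - \<xi> s \<omega>))) \<partial>M)
    = (\<integral>\<^sup>+y. ennreal (exp (- c * y)) \<partial>distr M borel (\<lambda>\<omega>. \<xi> t \<omega> - \<xi> s \<omega>))"
    by (subst nn_integral_distr) auto
  also have "\<dots> = (\<integral>\<^sup>+y. ennreal (exp (- c * y)) \<partial>distr M borel (\<xi> (t - s)))"
    using assms dyadics_nonneg by (subst \<xi>_incr_distr) auto
  also have "\<dots> = exp_mom c (t - s)"
    unfolding exp_mom_def by (subst nn_integral_distr) auto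
  finally show ?thesis .
qed

lemma exp_mom_add:
  assumes s: "s \<in> dyadics" and t: "t \<in> dyadics"
  shows "exp_mom c (s + t) = exp_mom c s * exp_mom c t"
proof -
  have nn: "0 \<le> s" "0 \<le> t" and st: "s + t \<in> dyadics"
    using s t dyadics_nonneg dyadics_add by auto
  let ?f = "\<lambda>\<omega>. ennreal (exp (- c * (\<xi> s \<omega> - \<xi> 0 \<omega>)))"
  let ?g = "\<lambda>\<omega>. ennreal (exp (- c * (\<xi> (s + t) \<omega> - \<xi> s \<omega>)))"
  have exp_meas: "(\<lambda>y. ennreal (exp (- c * y))) \<in> borel_measurable borel" by measurable
  have f: "?f \<in> borel_measurable (past s)"
    by (rule measurable_compose[OF \<xi>_incr_past[OF zero_dyadics s nn(1) order_refl] exp_meas])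
  have g: "?g \<in> borel_measurable (future s)"
    by (rule measurable_compose[OF \<xi>_incr_future[OF s st _ order_refl] exp_meas]) (use nn in simp)
  have "exp_mom c (s + t) = (\<integral>\<^sup>+\<omega>. ennreal (exp (- c * (\<xi> (s + t) \<omega> - \<xi> 0 \<omega>))) \<partial>M)"
    using exp_mom_incr[OF zero_dyadics st] nn by simp
  also have "\<dots> = (\<integral>\<^sup>+\<omega>. ?f \<omega> * ?g \<omega> \<partial>M)"
    by (simp add: algebra_simps flip: ennreal_mult' exp_add)
  also have "\<dots> = (\<integral>\<^sup>+\<omega>. ?f \<omega> \<partial>M) * (\<integral>\<^sup>+\<omega>. ?g \<omega> \<partial>M)"
    by (rule indep_var_nn_integral_mult[OF indep_var_past_future[OF f g]])
  also have "\<dots> = exp_mom c s * exp_mom c t"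
    using exp_mom_incr[OF zero_dyadics s nn(1)] exp_mom_incr[OF s st] nn by simp
  finally show ?thesis .
qed

lemma exp_mom_zero: "exp_mom c 0 = 1"
proof -
  have "exp_mom c 0 = (\<integral>\<^sup>+\<omega>. 1 \<partial>M)"
    unfolding exp_mom_def
    by (rule nn_integral_cong_AE) (use AE_good in eventually_elim, simp add: good_def)
  then show ?thesis by (simp add: emeasure_space_1)
qed

lemma exp_mom_multiple:
  assumes "t \<in> dyadics" shows "real k * t \<in> dyadics" "exp_mom c (real k * t) = exp_mom c t ^ k"
proof (induction k)
  case (Suc k)
  have eq: "real (Suc k) * t = real k * t + t" by (simp add: algebra_simps)
  { case 1 show ?case unfolding eq using Suc.IH(1) assms by (rule dyadics_add) }
  { case 2 show ?case unfolding eq exp_mom_add[OF Suc.IH(1) assms] using Suc.IH(2) by (simp add: mult.commute) }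
qed (auto simp: zero_dyadics exp_mom_zero)

lemma exp_mom_nat: "exp_mom c (real k) = exp_mom c 1 ^ k"
  using exp_mom_multiple(2)[OF one_dyadics, of c k] by simp

text \<open>Stationarity is given for finite-dimensional laws; the event for countable
  \<open>S\<close> is the increasing union of those for finite subsets, which yields both
  inequalities.\<close>

lemma V_shift:
  assumes S: "countable S" "S \<subseteq> {0..}" and u: "0 \<le> u"
  shows "prob {\<omega> \<in> space M. \<exists>r\<in>S. y < V (r + u) \<omega>} = prob {\<omega> \<in> space M. \<exists>r\<in>S. y < V r \<omega>}"
proof -
  have st: "stationary M V" using tail_cond by (simp add: tail_condition_def)
  have fin: "prob {\<omega> \<in> space M. \<exists>r\<in>T. y < V (r + u) \<omega>} = prob {\<omega> \<in> space M. \<exists>r\<in>T. y < V r \<omega>}"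
    if T: "finite T" "T \<subseteq> S" for T
  proof -
    let ?N = "PiM T (\<lambda>_. borel :: real measure)"
    let ?Q = "{f \<in> space ?N. \<exists>r\<in>T. y < f r}"
    have T0: "T \<subseteq> {0..}" using T S by auto
    have Q: "?Q \<in> sets ?N"
      using T(1) by (intro sets.sets_Collect_finite_Ex) measurable
    have m: "(\<lambda>\<omega>. \<lambda>t\<in>T. V (t + v) \<omega>) \<in> measurable M ?N" if "0 \<le> v" for v
      using T0 that by (intro measurable_restrict V_measurable) auto
    have "prob {\<omega> \<in> space M. \<exists>r\<in>T. y < V (r + v) \<omega>}
      = measure (distr M ?N (\<lambda>\<omega>. \<lambda>t\<in>T. V (t + v) \<omega>)) ?Q" if "0 \<le> v" for v
      using Q m[OF that] by (subst measure_distr) (auto intro!: arg_cong[where f = prob] simp: space_PiM)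
    from this[OF u] this[of 0] show ?thesis
      using st T(1) T0 u unfolding stationary_def by simp
  qed
  have E: "{\<omega> \<in> space M. y < V r \<omega>} \<in> events" "{\<omega> \<in> space M. y < V (r + u) \<omega>} \<in> events" if "r \<in> S" for r
  proof -
    have [measurable]: "V r \<in> borel_measurable M" "V (r + u) \<in> borel_measurable M"
      using that S u by (auto intro!: V_measurable)
    show "{\<omega> \<in> space M. y < V r \<omega>} \<in> events" "{\<omega> \<in> space M. y < V (r + u) \<omega>} \<in> events" by measurable
  qed
  note ev = sets_Collect_bex_countable[OF S(1) E(1)] sets_Collect_bex_countable[OF S(1) E(2)]
  show ?thesis
  proof (rule antisym)
    show "prob {\<omega> \<in> space M. \<exists>r\<in>S. y < V (r + u) \<omega>} \<le> prob {\<omega> \<in> space M. \<exists>r\<in>S. y < V r \<omega>}"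
    proof (rule prob_ex_le[OF S(1) E(2)])
      fix T assume "finite T" "T \<subseteq> S"
      then show "prob {\<omega> \<in> space M. \<exists>r\<in>T. y < V (r + u) \<omega>} \<le> prob {\<omega> \<in> space M. \<exists>r\<in>S. y < V r \<omega>}"
        using ev by (subst fin) (auto intro!: finite_measure_mono)
    qed
    show "prob {\<omega> \<in> space M. \<exists>r\<in>S. y < V r \<omega>} \<le> prob {\<omega> \<in> space M. \<exists>r\<in>S. y < V (r + u) \<omega>}"
    proof (rule prob_ex_le[OF S(1) E(1)])
      fix T assume "finite T" "T \<subseteq> S"
      then show "prob {\<omega> \<in> space M. \<exists>r\<in>T. y < V r \<omega>} \<le> prob {\<omega> \<in> space M. \<exists>r\<in>S. y < V (r + u) \<omega>}"
        using ev by (subst fin[symmetric]) (auto intro!: finite_measure_mono)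
    qed
  qed
qed

section \<open>Exceedances over bounded intervals\<close>

lemma V_tail_eq: "0 \<le> t \<Longrightarrow> prob {\<omega> \<in> space M. y < V t \<omega>} = prob {\<omega> \<in> space M. y < V 0 \<omega>}"
  using V_shift[of "{0}" t y] by simp

text \<open>Restriction to dyadic times makes this an event and brings it within reach of
  \<open>good\<close>; on intervals from 0 to an integer nothing is lost, by
  \<open>exceed_all_nat\<close>.\<close>

definition exceed :: "real \<Rightarrow> real \<Rightarrow> real \<Rightarrow> 'a set" where
  "exceed s t y = {\<omega> \<in> space M. \<exists>r\<in>dyadics \<inter> {s..t}. y < V r \<omega>}"

lemma exceed_events [measurable]: "exceed s t y \<in> events"
  unfolding exceed_def
  by (intro sets_Collect_bex_countable countable_Int1[OF countable_dyadics]) measurable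

lemma prob_exceed_shift:
  assumes "u \<in> dyadics" "0 \<le> s"
  shows "prob (exceed (s + u) (t + u) y) = prob (exceed s t y)"
proof -
  have "exceed (s + u) (t + u) y = {\<omega> \<in> space M. \<exists>r\<in>dyadics \<inter> {s..t}. y < V (r + u) \<omega>}"
  proof -
    have "dyadics \<inter> {s + u..t + u} = (\<lambda>r. r + u) ` (dyadics \<inter> {s..t})"
    proof (intro equalityI subsetI)
      fix r assume "r \<in> dyadics \<inter> {s + u..t + u}"
      then have "r - u \<in> dyadics \<inter> {s..t}" using assms by (auto intro!: dyadics_diff)
      then show "r \<in> (\<lambda>r. r + u) ` (dyadics \<inter> {s..t})" by (intro image_eqI[of _ _ "r - u"]) auto
    qed (use assms dyadics_add in auto)
    then show ?thesis by (simp add: exceed_def)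
  qed
  then show ?thesis
    using V_shift[of "dyadics \<inter> {s..t}" u y] assms dyadics_nonneg
    by (simp add: exceed_def countable_Int1[OF countable_dyadics] subset_iff)
qed

text \<open>\<open>ottaviani\<close> is applied twice with the same \<open>b\<close>: to the adapted
  copy of \<open>V\<close>, after which stationarity replaces \<open>V m\<close> by
  \<open>V 0\<close>, and to \<open>B 0\<close>, which obeys the same growth inequality.\<close>

lemma prob_exceed_le:
  assumes m: "m \<in> dyadics"
  shows "\<exists>b. \<forall>y>0. prob (exceed 0 m y) \<le> 2 * prob {\<omega> \<in> space M. y * exp (- b) < V 0 \<omega>} \<and>
    prob {\<omega> \<in> space M. \<exists>r\<in>dyadics \<inter> {0..m}. y < B 0 r \<omega>}
      \<le> 2 * prob {\<omega> \<in> space M. y * exp (- b) < B 0 m \<omega>}"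
proof -
  have m0: "0 \<le> m" using m by (rule dyadics_nonneg)
  obtain b where b: "\<And>r t. r \<in> dyadics \<Longrightarrow> t \<in> dyadics \<Longrightarrow> r \<le> t \<Longrightarrow> t - r \<le> m \<Longrightarrow>
    1 / 2 \<le> prob {\<omega> \<in> space M. \<xi> t \<omega> - \<xi> r \<omega> \<le> b}"
    using \<xi>_bound_prob by blast
  have top: "space M \<in> sets (past 0)" using sets.top[of "past 0"] by simp
  show ?thesis
  proof (intro exI[of _ b] allI impI conjI)
    fix y :: real assume y: "0 < y"
    have "prob (exceed 0 m y) = prob {\<omega> \<in> space M. \<exists>r\<in>dyadics \<inter> {0..m}. \<omega> \<in> space M \<and> y < V_adapted r \<omega>}"
    proof (rule prob_cong_good)
      show "exceed 0 m y \<in> events" by (rule exceed_events)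
      show "{\<omega> \<in> space M. \<exists>r\<in>dyadics \<inter> {0..m}. \<omega> \<in> space M \<and> y < V_adapted r \<omega>} \<in> events"
      proof (intro sets_Collect_bex_countable countable_Int1[OF countable_dyadics])
        fix r assume "r \<in> dyadics \<inter> {0..m}"
        then have [measurable]: "V_adapted r \<in> borel_measurable M" using V_adapted_measurable by auto
        show "{\<omega> \<in> space M. \<omega> \<in> space M \<and> y < V_adapted r \<omega>} \<in> events" by measurable
      qed
    qed (auto simp: exceed_def V_adapted_eq)
    also have "\<dots> \<le> 2 * prob {\<omega> \<in> space M. \<omega> \<in> space M \<and> y * exp (- b) < V_adapted m \<omega>}"
    proof (rule ottaviani[OF zero_dyadics m top _ _ _ y m0])
      fix \<omega> r assume "good \<omega>" "r \<in> dyadics" "0 \<le> r" "r \<le> m"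
      then show "exp (- (\<xi> m \<omega> - \<xi> r \<omega>)) * V_adapted r \<omega> \<le> V_adapted m \<omega>"
        using V_ge_scaled[OF _ _ m] m by (simp add: V_adapted_eq)
    qed (use b m in \<open>auto intro: V_adapted_past\<close>)
    also have "prob {\<omega> \<in> space M. \<omega> \<in> space M \<and> y * exp (- b) < V_adapted m \<omega>}
      = prob {\<omega> \<in> space M. y * exp (- b) < V m \<omega>}"
    proof (rule prob_cong_good)
      have [measurable]: "V_adapted m \<in> borel_measurable M" "V m \<in> borel_measurable M"
        using m V_adapted_measurable by auto
      show "{\<omega> \<in> space M. \<omega> \<in> space M \<and> y * exp (- b) < V_adapted m \<omega>} \<in> events"
        "{\<omega> \<in> space M. y * exp (- b) < V m \<omega>} \<in> events" by measurable
    qed (auto simp: V_adapted_eq m)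
    finally show "prob (exceed 0 m y) \<le> 2 * prob {\<omega> \<in> space M. y * exp (- b) < V 0 \<omega>}"
      using V_tail_eq[OF m0] by simp
    have "prob {\<omega> \<in> space M. \<exists>r\<in>dyadics \<inter> {0..m}. \<omega> \<in> space M \<and> y < B 0 r \<omega>}
      \<le> 2 * prob {\<omega> \<in> space M. \<omega> \<in> space M \<and> y * exp (- b) < B 0 m \<omega>}"
    proof (rule ottaviani[OF zero_dyadics m top _ _ _ y m0])
      fix \<omega> r assume "good \<omega>" "r \<in> dyadics" "0 \<le> r" "r \<le> m"
      then show "exp (- (\<xi> m \<omega> - \<xi> r \<omega>)) * B 0 r \<omega> \<le> B 0 m \<omega>"
        using m by (intro B_ge_scaled)
    qed (use b m in \<open>auto intro: B_past zero_dyadics\<close>)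
    then show "prob {\<omega> \<in> space M. \<exists>r\<in>dyadics \<inter> {0..m}. y < B 0 r \<omega>}
      \<le> 2 * prob {\<omega> \<in> space M. y * exp (- b) < B 0 m \<omega>}"
      by (simp cong: conj_cong)
  qed
qed

lemma prob_exceed_power_bound:
  assumes "m \<in> dyadics"
  obtains K where "0 < K" "\<And>y. 0 < y \<Longrightarrow> prob (exceed 0 m y) \<le> K * y powr (- \<alpha>)"
proof -
  obtain b where b: "\<And>y. 0 < y \<Longrightarrow> prob (exceed 0 m y) \<le> 2 * prob {\<omega> \<in> space M. y * exp (- b) < V 0 \<omega>}"
    using prob_exceed_le[OF assms] by blast
  obtain K where K: "0 < K" "\<And>y. 0 < y \<Longrightarrow> prob {\<omega> \<in> space M. y < V 0 \<omega>} \<le> K * y powr (- \<alpha>)"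
    using tail_bound[OF V0_tail \<alpha>_pos] by blast
  show ?thesis
  proof (rule that[of "2 * (K * exp (- b) powr (- \<alpha>))"])
    fix y :: real assume y: "0 < y"
    have "prob (exceed 0 m y) \<le> 2 * (K * (y * exp (- b)) powr (- \<alpha>))"
      using b[OF y] K(2)[of "y * exp (- b)"] y by simp
    then show "prob (exceed 0 m y) \<le> 2 * (K * exp (- b) powr (- \<alpha>)) * y powr (- \<alpha>)"
      using y by (simp add: powr_mult mult_ac)
  qed (use K in simp)
qed

section \<open>Suprema of the multiplicative part\<close>

definition sup_exp :: "real \<Rightarrow> real \<Rightarrow> 'a \<Rightarrow> ennreal" where
  "sup_exp s t \<omega> = (SUP r\<in>dyadics \<inter> {s..t}. ennreal (exp (- \<alpha> * (\<xi> r \<omega> - \<xi> 0 \<omega>))))"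

text \<open>The root turns the supremum of \<open>exp (- \<alpha> * \<xi> r)\<close> back into that
  of \<open>exp (- \<xi> r)\<close>, the factor of \<open>V 0\<close> in Breiman's lemma. Increments
  from time 0 on make it independent of \<open>V 0\<close>. An infinite supremum would be converted
  to 0, but does not occur at good points.\<close>

definition root_sup :: "real \<Rightarrow> real \<Rightarrow> 'a \<Rightarrow> real" where
  "root_sup s t \<omega> = enn2real (sup_exp s t \<omega>) powr (1 / \<alpha>)"

lemma sup_exp_future: "sup_exp s t \<in> borel_measurable (future 0)"
proof -
  have exp_meas: "(\<lambda>y. ennreal (exp (- \<alpha> * y))) \<in> borel_measurable borel" by measurable
  show ?thesis
    unfolding sup_exp_def
    by (intro borel_measurable_SUP countable_Int1[OF countable_dyadics]
        measurable_compose[OF \<xi>_incr_future[OF zero_dyadics _ _ order_refl] exp_meas])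
      (auto intro: dyadics_nonneg)
qed

lemma sup_exp_measurable [measurable]: "sup_exp s t \<in> borel_measurable M"
  using sup_exp_future by (rule measurable_future)

lemma root_sup_future: "root_sup s t \<in> borel_measurable (future 0)"
  unfolding root_sup_def[abs_def] using sup_exp_future[measurable] by measurable

lemma root_sup_powr: "root_sup s t \<omega> powr \<alpha> = enn2real (sup_exp s t \<omega>)"
  unfolding root_sup_def using \<alpha>_pos by (simp add: powr_powr)

lemma sup_exp_finite:
  assumes "good \<omega>" shows "sup_exp s t \<omega> < \<infinity>"
proof -
  obtain K where K: "\<And>r. 0 \<le> r \<Longrightarrow> r \<le> t \<Longrightarrow> \<bar>\<xi> r \<omega>\<bar> \<le> K"
    using assms cadlag_bounded[of "\<lambda>r. \<xi> r \<omega>" t] by (auto simp: good_def)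
  have "sup_exp s t \<omega> \<le> ennreal (exp (\<alpha> * K))"
    unfolding sup_exp_def
  proof (intro SUP_least ennreal_leI)
    fix r assume "r \<in> dyadics \<inter> {s..t}"
    then have "- \<xi> r \<omega> \<le> K" using K[of r] dyadics_nonneg[of r] by auto
    then have "\<alpha> * (- \<xi> r \<omega>) \<le> \<alpha> * K" using \<alpha>_pos by (intro mult_left_mono) auto
    then show "exp (- \<alpha> * (\<xi> r \<omega> - \<xi> 0 \<omega>)) \<le> exp (\<alpha> * K)" using assms by (simp add: good_def)
  qed
  then show ?thesis using ennreal_less_top le_less_trans infinity_ennreal_def by metis
qed

lemma root_sup_exceeds:
  assumes g: "good \<omega>" and y: "0 < y"
  shows "y < root_sup s t \<omega> * V 0 \<omega> \<longleftrightarrow> (\<exists>r\<in>dyadics \<inter> {s..t}. y < exp (- \<xi> r \<omega>) * V 0 \<omega>)"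
proof (cases "V 0 \<omega> = 0")
  case False
  then have V: "0 < V 0 \<omega>" using g by (auto simp: good_def less_le)
  have pos: "0 < y / V 0 \<omega>" using y V by simp
  have "y < root_sup s t \<omega> * V 0 \<omega> \<longleftrightarrow> y / V 0 \<omega> < root_sup s t \<omega>"
    using V by (simp add: field_simps)
  also have "\<dots> \<longleftrightarrow> (y / V 0 \<omega>) powr \<alpha> < root_sup s t \<omega> powr \<alpha>"
    using pos \<alpha>_pos by (subst powr_less_iff_base) (auto simp: root_sup_def)
  also have "\<dots> \<longleftrightarrow> ennreal ((y / V 0 \<omega>) powr \<alpha>) < sup_exp s t \<omega>"
    unfolding root_sup_powr using sup_exp_finite[OF g, of s t]
    by (cases "sup_exp s t \<omega>") (auto simp: ennreal_less_iff)
  also have "\<dots> \<longleftrightarrow> (\<exists>r\<in>dyadics \<inter> {s..t}. ennreal ((y / V 0 \<omega>) powr \<alpha>) < ennreal (exp (- \<alpha> * (\<xi> r \<omega> - \<xi> 0 \<omega>))))"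
    unfolding sup_exp_def by (rule less_SUP_iff)
  also have "\<dots> \<longleftrightarrow> (\<exists>r\<in>dyadics \<inter> {s..t}. y < exp (- \<xi> r \<omega>) * V 0 \<omega>)"
  proof (rule bex_cong[OF refl])
    fix r
    have "exp (- \<alpha> * (\<xi> r \<omega> - \<xi> 0 \<omega>)) = exp (- \<xi> r \<omega>) powr \<alpha>"
      using g by (simp add: good_def powr_def)
    then have "ennreal ((y / V 0 \<omega>) powr \<alpha>) < ennreal (exp (- \<alpha> * (\<xi> r \<omega> - \<xi> 0 \<omega>)))
      \<longleftrightarrow> (y / V 0 \<omega>) powr \<alpha> < exp (- \<xi> r \<omega>) powr \<alpha>"
      by (simp add: ennreal_less_iff)
    also have "\<dots> \<longleftrightarrow> y / V 0 \<omega> < exp (- \<xi> r \<omega>)"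
      using pos \<alpha>_pos by (subst powr_less_iff_base) auto
    also have "\<dots> \<longleftrightarrow> y < exp (- \<xi> r \<omega>) * V 0 \<omega>" using V by (simp add: field_simps)
    finally show "ennreal ((y / V 0 \<omega>) powr \<alpha>) < ennreal (exp (- \<alpha> * (\<xi> r \<omega> - \<xi> 0 \<omega>)))
      \<longleftrightarrow> y < exp (- \<xi> r \<omega>) * V 0 \<omega>" .
  qed
  finally show ?thesis .
qed (use y in simp)

end

section \<open>Scaling of tails and limits of block sums\<close>

lemma tail_scale:
  fixes f :: "real \<Rightarrow> real"
  assumes "((\<lambda>u. u powr \<alpha> * f u) \<longlongrightarrow> l) at_top" "0 < c"
  shows "((\<lambda>u. u powr \<alpha> * f (c * u)) \<longlongrightarrow> c powr (- \<alpha>) * l) at_top"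
proof -
  have "filterlim (\<lambda>u. c * u) at_top at_top"
    using filterlim_tendsto_pos_mult_at_top[OF tendsto_const[of c] assms(2) filterlim_ident] .
  from tendsto_mult[OF tendsto_const[of "c powr (- \<alpha>)"] filterlim_compose[OF assms(1) this]]
  have "((\<lambda>u. c powr (- \<alpha>) * ((c * u) powr \<alpha> * f (c * u))) \<longlongrightarrow> c powr (- \<alpha>) * l) at_top" .
  moreover have "\<forall>\<^sub>F u in at_top. c powr (- \<alpha>) * ((c * u) powr \<alpha> * f (c * u)) = u powr \<alpha> * f (c * u)"
    using eventually_gt_at_top[of 0]
  proof eventually_elim
    case (elim u)
    have "c powr (- \<alpha>) * (c * u) powr \<alpha> = u powr \<alpha>"
      using elim assms(2) by (simp add: powr_mult powr_minus field_simps)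
    then show ?case by (simp add: mult.assoc[symmetric])
  qed
  ultimately show ?thesis by (rule Lim_transform_eventually)
qed

text \<open>
  The alternative \<open>\<Theta> = 0\<close> covers the degenerate case, in which the anti-clustering bound fails.
\<close>

lemma block_sum_limit:
  fixes p :: "nat \<Rightarrow> nat \<Rightarrow> real" and F v :: "nat \<Rightarrow> real" and N :: "nat \<Rightarrow> nat" and \<theta> :: "nat \<Rightarrow> real"
  assumes p_nonneg: "\<And>m n. 0 \<le> p m n" and p_antimono: "\<And>m m' n. m \<le> m' \<Longrightarrow> p m' n \<le> p m n"
    and p_lim: "\<And>m. (\<lambda>n. real n * p m n) \<longlonglongrightarrow> \<kappa> * \<theta> m"
    and \<theta>: "\<theta> \<longlonglongrightarrow> \<Theta>"
    and F_nonneg: "\<And>n. 0 \<le> F n" and F_lim: "(\<lambda>n. real n * F n) \<longlonglongrightarrow> \<kappa>'"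
    and N: "filterlim N at_top sequentially" and N_small: "(\<lambda>n. real (N n) / real n) \<longlonglongrightarrow> 0"
    and v: "(\<lambda>n. real n * v n) \<longlonglongrightarrow> \<kappa>" and q: "0 \<le> q" "q < 1"
    and anticluster: "\<Theta> = 0 \<or>
      (\<forall>m M n. m \<le> M \<longrightarrow> p m n - p M n \<le> c * q ^ m * v n + c' * real M * (v n)\<^sup>2)"
  shows "(\<lambda>n. real n / real (N n) * (F n + (\<Sum>m<N n. p m n))) \<longlonglongrightarrow> \<kappa> * \<Theta>"
proof (rule order_tendstoI)
  have Nr: "filterlim (\<lambda>n. real (N n)) at_top sequentially"
    using filterlim_compose[OF filterlim_real_sequentially N] .
  have N_ge: "\<forall>\<^sub>F n in sequentially. k < N n" for k
    using N unfolding filterlim_at_top by (auto elim: eventually_mono dest!: spec[of _ "Suc k"])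
  fix l :: real
  { assume l: "\<kappa> * \<Theta> < l"
    have "(\<lambda>m. \<kappa> * \<theta> m) \<longlonglongrightarrow> \<kappa> * \<Theta>" by (intro tendsto_intros \<theta>)
    from order_tendstoD(2)[OF this l] obtain k where k: "\<kappa> * \<theta> k < l"
      by (auto simp: eventually_sequentially)
    \<comment> \<open>Upper bound: the first \<open>k\<close> terms are at most \<open>p 0 n\<close>
      each and the others at most \<open>p k n\<close>. After multiplication by
      \<open>n / N n\<close> the former vanish because \<open>N n\<close> grows, and
      \<open>k\<close> was chosen with \<open>\<kappa> * \<theta> k\<close> below
      \<open>l\<close>.\<close>
    have "(\<lambda>n. (real n * F n + real k * (real n * p 0 n)) * inverse (real (N n)) + real n * p k n)
      \<longlonglongrightarrow> (\<kappa>' + real k * (\<kappa> * \<theta> 0)) * 0 + \<kappa> * \<theta> k"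
      by (intro tendsto_intros F_lim p_lim tendsto_inverse_0_at_top Nr)
    then have "\<forall>\<^sub>F n in sequentially. (real n * F n + real k * (real n * p 0 n)) * inverse (real (N n)) + real n * p k n < l"
      by (rule order_tendstoD) (use k in simp)
    then show "\<forall>\<^sub>F n in sequentially. real n / real (N n) * (F n + (\<Sum>m<N n. p m n)) < l"
      using N_ge[of k]
    proof eventually_elim
      case (elim n)
      have "(\<Sum>m<N n. p m n) = (\<Sum>m<k. p m n) + (\<Sum>m=k..<N n. p m n)"
        using elim by (subst sum.atLeastLessThan_concat[of 0 k "N n", symmetric, simplified atLeast0LessThan]) auto
      also have "\<dots> \<le> (\<Sum>m<k. p 0 n) + (\<Sum>m=k..<N n. p k n)"
        by (intro add_mono sum_mono p_antimono) auto
      also have "\<dots> \<le> real k * p 0 n + real (N n) * p k n"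
        using p_nonneg by (auto intro!: mult_right_mono)
      finally have "real n / real (N n) * (F n + (\<Sum>m<N n. p m n))
        \<le> real n / real (N n) * (F n + (real k * p 0 n + real (N n) * p k n))"
        by (intro mult_left_mono add_left_mono) auto
      also have "\<dots> = (real n * F n + real k * (real n * p 0 n)) * inverse (real (N n)) + real n * p k n"
        using elim by (simp add: field_simps)
      finally show ?case using elim by simp
    qed }
  { assume l: "l < \<kappa> * \<Theta>"
    show "\<forall>\<^sub>F n in sequentially. l < real n / real (N n) * (F n + (\<Sum>m<N n. p m n))"
    proof (cases "\<Theta> = 0")
      case True
      then have "l < 0" using l by simp
      moreover have "0 \<le> real n / real (N n) * (F n + (\<Sum>m<N n. p m n))" for n
        by (intro mult_nonneg_nonneg add_nonneg_nonneg F_nonneg sum_nonneg p_nonneg) auto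
      ultimately show ?thesis by (intro always_eventually allI) (rule less_le_trans)
    next
      case False
      then have ac: "m \<le> M \<Longrightarrow> p m n - p M n \<le> c * q ^ m * v n + c' * real M * (v n)\<^sup>2" for m M n
        using anticluster by blast
      have "(\<lambda>m. \<kappa> * \<theta> m - c * q ^ m * \<kappa>) \<longlonglongrightarrow> \<kappa> * \<Theta> - c * 0 * \<kappa>"
        using q by (intro tendsto_intros \<theta> LIMSEQ_power_zero) auto
      then have "\<forall>\<^sub>F m in sequentially. l < \<kappa> * \<theta> m - c * q ^ m * \<kappa>"
        by (rule order_tendstoD) (use l in simp)
      then obtain k where k: "l < \<kappa> * \<theta> k - c * q ^ k * \<kappa>"
        by (auto simp: eventually_sequentially)
      \<comment> \<open>Lower bound: all terms are at least \<open>p (N n) n\<close>, which the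
        anti-clustering bound replaces by \<open>p k n\<close>. Multiplied by \<open>n\<close>, the
        quadratic error is of the order of \<open>N n / n\<close> and vanishes; the geometric error
        was absorbed in the choice of \<open>k\<close>.\<close>
      have "(\<lambda>n. real n * p k n - c * q ^ k * (real n * v n) - c' * (real (N n) / real n) * (real n * v n)\<^sup>2)
        \<longlonglongrightarrow> \<kappa> * \<theta> k - c * q ^ k * \<kappa> - c' * 0 * \<kappa>\<^sup>2"
        by (intro tendsto_intros p_lim v N_small)
      then have "\<forall>\<^sub>F n in sequentially.
        l < real n * p k n - c * q ^ k * (real n * v n) - c' * (real (N n) / real n) * (real n * v n)\<^sup>2"
        by (rule order_tendstoD) (use k in simp)
      then show ?thesis
        using N_ge[of k] eventually_gt_at_top[of 0]
      proof eventually_elim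
        case (elim n)
        have "real n * p k n - c * q ^ k * (real n * v n) - c' * (real (N n) / real n) * (real n * v n)\<^sup>2
          = real n * (p k n - (c * q ^ k * v n + c' * real (N n) * (v n)\<^sup>2))"
          using elim by (simp add: field_simps power2_eq_square)
        also have "\<dots> \<le> real n * p (N n) n"
          using ac[of k "N n" n] elim by (intro mult_left_mono) auto
        also have "\<dots> = real n / real (N n) * (\<Sum>m<N n. p (N n) n)"
          using elim by simp
        also have "\<dots> \<le> real n / real (N n) * (F n + (\<Sum>m<N n. p m n))"
          using F_nonneg[of n] by (intro mult_left_mono add_increasing sum_mono p_antimono) auto
        finally show ?case using elim by simp
      qed
    qed }
qed

section \<open>Exact tail constants for suprema over bounded intervals\<close>

context gou_tail
begin

lemma indep_V0_root_sup: "indep_var borel (V 0) borel (root_sup s t)"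
  by (rule indep_var_past_future[OF U_past root_sup_future])

lemma root_sup_nonneg: "0 \<le> root_sup s t \<omega>"
  by (simp add: root_sup_def)

lemma exceed_subset: "s' \<le> s \<Longrightarrow> t \<le> t' \<Longrightarrow> exceed s t u \<subseteq> exceed s' t' u"
  unfolding exceed_def by fastforce

lemma root_sup_measurable [measurable]: "root_sup s t \<in> borel_measurable M"
  using root_sup_future by (rule measurable_future)

lemma V0_measurable [measurable]: "V 0 \<in> borel_measurable M"
  by (rule V_dyadic[OF zero_dyadics])

lemma V_decomp:
  assumes "good \<omega>" "r \<in> dyadics"
  shows "V r \<omega> = exp (- \<xi> r \<omega>) * V 0 \<omega> + B 0 r \<omega>" "0 \<le> B 0 r \<omega>"
  using V_eq_B[OF assms(1) zero_dyadics assms(2) dyadics_nonneg[OF assms(2)]]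
    B_nonneg[OF assms(1) zero_dyadics assms(2) dyadics_nonneg[OF assms(2)]] assms(1)
  by (simp_all add: good_def)

lemma prob_root_sup_le:
  assumes u: "0 < u"
  shows "prob {\<omega> \<in> space M. u < root_sup s t \<omega> * V 0 \<omega>} \<le> prob (exceed s t u)"
proof (rule prob_mono_good)
  fix \<omega> assume g: "good \<omega>" and "\<omega> \<in> {\<omega> \<in> space M. u < root_sup s t \<omega> * V 0 \<omega>}"
  then obtain r where r: "r \<in> dyadics \<inter> {s..t}" "u < exp (- \<xi> r \<omega>) * V 0 \<omega>"
    using root_sup_exceeds[OF g u] by auto
  then have "u < V r \<omega>" using V_decomp[OF g, of r] by simp
  then show "\<omega> \<in> exceed s t u" using r g by (auto simp: exceed_def good_def)
qed simp

text \<open>Integrability is read off from tails: the power bound for \<open>exceed\<close>, due to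
  the maximal inequality, also bounds the tail of \<open>root_sup * V 0\<close>, and the converse of
  Breiman's lemma applies since \<open>C > 0\<close>.\<close>

lemma root_sup_integrable:
  assumes "t \<in> dyadics" "0 \<le> s"
  shows "integrable M (\<lambda>\<omega>. root_sup s t \<omega> powr \<alpha>)"
proof -
  obtain K where K: "0 < K" "\<And>y. 0 < y \<Longrightarrow> prob (exceed 0 t y) \<le> K * y powr (- \<alpha>)"
    using prob_exceed_power_bound[OF assms(1)] by blast
  show ?thesis
  proof (rule breiman_bound_integrable[OF indep_V0_root_sup root_sup_nonneg \<alpha>_pos V0_tail C_pos])
    fix u :: real assume u: "0 < u"
    have "prob {\<omega> \<in> space M. u < root_sup s t \<omega> * V 0 \<omega>} \<le> prob (exceed s t u)"
      by (rule prob_root_sup_le[OF u])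
    also have "\<dots> \<le> prob (exceed 0 t u)"
      using assms by (intro finite_measure_mono exceed_subset) auto
    also have "\<dots> \<le> K * u powr (- \<alpha>)" by (rule K(2)[OF u])
    finally show "prob {\<omega> \<in> space M. u < root_sup s t \<omega> * V 0 \<omega>} \<le> K * u powr (- \<alpha>)" .
  qed
qed

lemma root_sup_tail:
  assumes "t \<in> dyadics" "0 \<le> s"
  shows "((\<lambda>u. u powr \<alpha> * prob {\<omega> \<in> space M. u < root_sup s t \<omega> * V 0 \<omega>})
    \<longlongrightarrow> C * expectation (\<lambda>\<omega>. root_sup s t \<omega> powr \<alpha>)) at_top"
  by (rule breiman[OF indep_V0_root_sup root_sup_nonneg \<alpha>_pos V0_tail root_sup_integrable[OF assms]])

lemma V0_tail_zero: "((\<lambda>y. prob {\<omega> \<in> space M. V 0 \<omega> > y}) \<longlongrightarrow> 0) at_top"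
proof -
  have "((\<lambda>y. y powr (- \<alpha>) * (y powr \<alpha> * prob {\<omega> \<in> space M. V 0 \<omega> > y})) \<longlongrightarrow> 0 * C) at_top"
    using \<alpha>_pos by (intro tendsto_mult V0_tail tendsto_neg_powr filterlim_ident) auto
  moreover have "\<forall>\<^sub>F y in at_top. y powr (- \<alpha>) * (y powr \<alpha> * prob {\<omega> \<in> space M. V 0 \<omega> > y})
      = prob {\<omega> \<in> space M. V 0 \<omega> > y}"
    using eventually_gt_at_top[of 0]
    by eventually_elim (simp add: powr_minus field_simps)
  ultimately show ?thesis by (simp add: Lim_transform_eventually)
qed

text \<open>
  Since \<open>V\<^sub>m\<close> and \<open>Y V\<^sub>0\<close> with \<open>Y = exp (- \<xi>\<^sub>m)\<close> have equivalent tails, the event \<open>B > u, Y V\<^sub>0 \<le> u\<close> is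
  negligible; the condition \<open>Y V\<^sub>0 \<le> u\<close> is removed by independence of \<open>V\<^sub>0\<close> and \<open>(Y, B)\<close>.
\<close>

lemma B_tail: "((\<lambda>u. u powr \<alpha> * prob {\<omega> \<in> space M. u < B 0 (real m) \<omega>}) \<longlongrightarrow> 0) at_top"
proof -
  define Y where "Y \<omega> = exp (- (\<xi> (real m) \<omega> - \<xi> 0 \<omega>))" for \<omega>
  have m: "real m \<in> dyadics" by (rule of_nat_dyadics)
  have Y_future: "Y \<in> borel_measurable (future 0)"
    unfolding Y_def[abs_def]
    by (intro measurable_compose[OF _ borel_measurable_exp] borel_measurable_uminus \<xi>_incr_future zero_dyadics m) auto
  then have [measurable]: "Y \<in> borel_measurable M" by (rule measurable_future)
  have B_fut [measurable]: "B 0 (real m) \<in> borel_measurable (future 0)" by (rule B_future[OF zero_dyadics m])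
  then have [measurable]: "B 0 (real m) \<in> borel_measurable M" by (rule measurable_future)
  have Y_nonneg: "0 \<le> Y \<omega>" for \<omega> by (simp add: Y_def)
  have Y_powr: "Y \<omega> powr \<alpha> = exp (- \<alpha> * (\<xi> (real m) \<omega> - \<xi> 0 \<omega>))" for \<omega>
    by (simp add: Y_def powr_def algebra_simps)
  have nn1: "(\<integral>\<^sup>+\<omega>. ennreal (Y \<omega> powr \<alpha>) \<partial>M) = 1"
    unfolding Y_powr using exp_mom_incr[OF zero_dyadics m, of \<alpha>] exp_mom_nat[of \<alpha> m] exp_moment
    by (simp add: exp_mom_def)
  have Y_int: "integrable M (\<lambda>\<omega>. Y \<omega> powr \<alpha>)"
    by (rule integrableI_nonneg) (auto simp: nn1)
  have Y_exp: "expectation (\<lambda>\<omega>. Y \<omega> powr \<alpha>) = 1"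
    by (subst integral_eq_nn_integral) (auto simp: nn1)
  have indep: "indep_var borel (V 0) borel Y"
    by (rule indep_var_past_future[OF U_past Y_future])
  have limY: "((\<lambda>u. u powr \<alpha> * prob {\<omega> \<in> space M. u < Y \<omega> * V 0 \<omega>}) \<longlongrightarrow> C) at_top"
    using breiman[OF indep Y_nonneg \<alpha>_pos V0_tail Y_int] by (simp add: Y_exp)
  define Q where "Q u = prob {\<omega> \<in> space M. u < B 0 (real m) \<omega> \<and> Y \<omega> * V 0 \<omega> \<le> u}" for u
  \<comment> \<open>The event of \<open>Q u\<close> and the event \<open>u < Y * V 0\<close> are
    disjoint, and each forces \<open>V (real m) > u\<close> because both summands of
    \<open>V (real m)\<close> are nonnegative; the tail of \<open>V (real m)\<close> is that of
    \<open>V 0\<close>.\<close>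
  have Q_le: "Q u \<le> prob {\<omega> \<in> space M. u < V 0 \<omega>} - prob {\<omega> \<in> space M. u < Y \<omega> * V 0 \<omega>}" for u
  proof -
    have [measurable]: "V (real m) \<in> borel_measurable M" by (rule V_dyadic[OF m])
    have "Q u + prob {\<omega> \<in> space M. u < Y \<omega> * V 0 \<omega>}
      = prob ({\<omega> \<in> space M. u < B 0 (real m) \<omega> \<and> Y \<omega> * V 0 \<omega> \<le> u} \<union> {\<omega> \<in> space M. u < Y \<omega> * V 0 \<omega>})"
      unfolding Q_def by (rule finite_measure_Union[symmetric]) auto
    also have "\<dots> \<le> prob {\<omega> \<in> space M. u < V (real m) \<omega>}"
    proof (rule prob_mono_good)
      fix \<omega> assume g: "good \<omega>" and *: "\<omega> \<in> {\<omega> \<in> space M. u < B 0 (real m) \<omega> \<and> Y \<omega> * V 0 \<omega> \<le> u} \<union> {\<omega> \<in> space M. u < Y \<omega> * V 0 \<omega>}"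
      have "V (real m) \<omega> = Y \<omega> * V 0 \<omega> + B 0 (real m) \<omega>" "0 \<le> B 0 (real m) \<omega>" "0 \<le> Y \<omega> * V 0 \<omega>"
        using V_decomp[OF g m] g Y_nonneg by (simp_all add: Y_def good_def)
      then show "\<omega> \<in> {\<omega> \<in> space M. u < V (real m) \<omega>}" using * by auto
    qed simp
    finally show ?thesis using V_tail_eq[of "real m" u] by simp
  qed
  have "((\<lambda>u. u powr \<alpha> * prob {\<omega> \<in> space M. u < V 0 \<omega>} - u powr \<alpha> * prob {\<omega> \<in> space M. u < Y \<omega> * V 0 \<omega>})
    \<longlongrightarrow> C - C) at_top"
    by (intro tendsto_diff V0_tail limY)
  then have diff_lim: "((\<lambda>u. u powr \<alpha> * (prob {\<omega> \<in> space M. u < V 0 \<omega>} - prob {\<omega> \<in> space M. u < Y \<omega> * V 0 \<omega>}))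
    \<longlongrightarrow> 0) at_top"
    by (simp add: right_diff_distrib)
  have Qlim: "((\<lambda>u. u powr \<alpha> * Q u) \<longlongrightarrow> 0) at_top"
  proof (rule tendsto_sandwich[OF _ _ tendsto_const diff_lim])
    show "\<forall>\<^sub>F u in at_top. 0 \<le> u powr \<alpha> * Q u" by (simp add: Q_def)
    show "\<forall>\<^sub>F u in at_top. u powr \<alpha> * Q u
        \<le> u powr \<alpha> * (prob {\<omega> \<in> space M. u < V 0 \<omega>} - prob {\<omega> \<in> space M. u < Y \<omega> * V 0 \<omega>})"
      by (intro always_eventually allI mult_left_mono Q_le) simp
  qed
  \<comment> \<open>Any positive level that \<open>V 0\<close> exceeds with probability below 1/2
    may serve as \<open>v\<close>; restricting to \<open>V 0 \<le> v\<close> then costs only a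
    factor 2.\<close>
  have "\<forall>\<^sub>F y in at_top. prob {\<omega> \<in> space M. V 0 \<omega> > y} < 1 / 2"
    using V0_tail_zero by (rule order_tendstoD) simp
  from eventually_happens[OF eventually_conj[OF eventually_gt_at_top[of "0::real"] this]]
  obtain v where v: "0 < v" "prob {\<omega> \<in> space M. V 0 \<omega> > v} < 1 / 2" by auto
  have "prob {\<omega> \<in> space M. V 0 \<omega> \<le> v} = 1 - prob {\<omega> \<in> space M. V 0 \<omega> > v}"
    by (subst prob_neg[symmetric]) (auto simp: not_less intro!: arg_cong[where f = prob])
  with v have half: "1 / 2 \<le> prob {\<omega> \<in> space M. V 0 \<omega> \<le> v}" by simp
  \<comment> \<open>Breiman's lemma with the constant \<open>v\<close> in place of
    \<open>V 0\<close>: the scaled tail of a constant vanishes, so \<open>Y * v\<close> has a tail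
    of smaller order by the moment of order \<alpha> alone.\<close>
  have Yv: "((\<lambda>u. u powr \<alpha> * prob {\<omega> \<in> space M. u < Y \<omega> * v}) \<longlongrightarrow> 0 * expectation (\<lambda>\<omega>. Y \<omega> powr \<alpha>)) at_top"
  proof (rule breiman[OF _ Y_nonneg \<alpha>_pos _ Y_int, where V = "\<lambda>_. v"])
    show "indep_var borel (\<lambda>_. v) borel Y"
      by (rule indep_var_past_future[OF _ Y_future]) simp
    have "\<forall>\<^sub>F y in at_top. 0 = y powr \<alpha> * prob {\<omega> \<in> space M. v > y}"
      using eventually_ge_at_top[of v] by eventually_elim (simp add: not_less)
    then show "((\<lambda>y. y powr \<alpha> * prob {\<omega> \<in> space M. v > y}) \<longlongrightarrow> 0) at_top"
      by (blast intro: Lim_transform_eventually tendsto_const)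
  qed
  \<comment> \<open>If \<open>Y * v \<le> u\<close> and \<open>V 0 \<le> v\<close>, then also
    \<open>Y * V 0 \<le> u\<close>; independence of \<open>V 0\<close> from \<open>Y\<close> and
    \<open>B\<close> thus compares the event \<open>?D\<close> with \<open>Q u\<close>.\<close>
  have bound: "prob {\<omega> \<in> space M. u < B 0 (real m) \<omega>} \<le> 2 * Q u + prob {\<omega> \<in> space M. u < Y \<omega> * v}" for u
  proof -
    let ?D = "{\<omega> \<in> space M. u < B 0 (real m) \<omega> \<and> Y \<omega> * v \<le> u}"
    have Dfut: "?D \<in> sets (future 0)"
    proof -
      have [measurable]: "Y \<in> borel_measurable (future 0)" by (rule Y_future)
      have "{\<omega> \<in> space (future 0). u < B 0 (real m) \<omega> \<and> Y \<omega> * v \<le> u} \<in> sets (future 0)" by measurable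
      then show ?thesis by simp
    qed
    have Vpast: "{\<omega> \<in> space M. V 0 \<omega> \<le> v} \<in> sets (past 0)"
    proof -
      have [measurable]: "V 0 \<in> borel_measurable (past 0)" by (rule U_past)
      have "{\<omega> \<in> space (past 0). V 0 \<omega> \<le> v} \<in> sets (past 0)" by measurable
      then show ?thesis by simp
    qed
    have "1 / 2 * prob ?D \<le> prob {\<omega> \<in> space M. V 0 \<omega> \<le> v} * prob ?D"
      using half by (intro mult_right_mono) auto
    also have "\<dots> = prob ({\<omega> \<in> space M. V 0 \<omega> \<le> v} \<inter> ?D)"
      by (rule prob_past_future[OF Vpast Dfut, symmetric])
    also have "\<dots> \<le> Q u"
      unfolding Q_def
    proof (rule finite_measure_mono)
      show "{\<omega> \<in> space M. V 0 \<omega> \<le> v} \<inter> ?D \<subseteq> {\<omega> \<in> space M. u < B 0 (real m) \<omega> \<and> Y \<omega> * V 0 \<omega> \<le> u}"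
        using mult_left_mono[OF _ Y_nonneg] by (auto intro: order_trans)
    qed measurable
    finally have "prob ?D \<le> 2 * Q u" by simp
    moreover have "prob {\<omega> \<in> space M. u < B 0 (real m) \<omega>} \<le> prob (?D \<union> {\<omega> \<in> space M. u < Y \<omega> * v})"
      by (rule finite_measure_mono) auto
    moreover have "\<dots> \<le> prob ?D + prob {\<omega> \<in> space M. u < Y \<omega> * v}"
      by (rule measure_Un_le) measurable
    ultimately show ?thesis by simp
  qed
  have "((\<lambda>u. 2 * (u powr \<alpha> * Q u) + u powr \<alpha> * prob {\<omega> \<in> space M. u < Y \<omega> * v})
    \<longlongrightarrow> 2 * 0 + 0 * expectation (\<lambda>\<omega>. Y \<omega> powr \<alpha>)) at_top"
    by (intro tendsto_add tendsto_mult[OF tendsto_const] Qlim Yv)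
  then have lim: "((\<lambda>u. u powr \<alpha> * (2 * Q u + prob {\<omega> \<in> space M. u < Y \<omega> * v})) \<longlongrightarrow> 0) at_top"
    by (simp add: algebra_simps)
  show ?thesis
  proof (rule tendsto_sandwich[OF _ _ tendsto_const lim])
    show "\<forall>\<^sub>F u in at_top. u powr \<alpha> * prob {\<omega> \<in> space M. u < B 0 (real m) \<omega>}
        \<le> u powr \<alpha> * (2 * Q u + prob {\<omega> \<in> space M. u < Y \<omega> * v})"
      by (intro always_eventually allI mult_left_mono bound) simp
  qed simp
qed

lemma sup_B_tail:
  "((\<lambda>u. u powr \<alpha> * prob {\<omega> \<in> space M. \<exists>r\<in>dyadics \<inter> {0..real m}. u < B 0 r \<omega>}) \<longlongrightarrow> 0) at_top"
proof -
  obtain b where b: "\<And>y. 0 < y \<Longrightarrow> prob {\<omega> \<in> space M. \<exists>r\<in>dyadics \<inter> {0..real m}. y < B 0 r \<omega>}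
      \<le> 2 * prob {\<omega> \<in> space M. y * exp (- b) < B 0 (real m) \<omega>}"
    using prob_exceed_le[OF of_nat_dyadics[of m]] by blast
  have "((\<lambda>u. 2 * (u powr \<alpha> * prob {\<omega> \<in> space M. exp (- b) * u < B 0 (real m) \<omega>}))
    \<longlongrightarrow> 2 * (exp (- b) powr (- \<alpha>) * 0)) at_top"
    by (intro tendsto_mult[OF tendsto_const] tail_scale B_tail) simp
  then have lim: "((\<lambda>u. 2 * (u powr \<alpha> * prob {\<omega> \<in> space M. exp (- b) * u < B 0 (real m) \<omega>})) \<longlongrightarrow> 0) at_top"
    by simp
  show ?thesis
  proof (rule tendsto_sandwich[OF _ _ tendsto_const lim])
    show "\<forall>\<^sub>F u in at_top. u powr \<alpha> * prob {\<omega> \<in> space M. \<exists>r\<in>dyadics \<inter> {0..real m}. u < B 0 r \<omega>}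
      \<le> 2 * (u powr \<alpha> * prob {\<omega> \<in> space M. exp (- b) * u < B 0 (real m) \<omega>})"
      using eventually_gt_at_top[of 0]
    proof eventually_elim
      case (elim u)
      from mult_left_mono[OF b[OF elim], of "u powr \<alpha>"] show ?case
        by (simp add: mult_ac)
    qed
  qed simp
qed

text \<open>Since \<open>B\<close> is nonnegative, the multiplicative part alone gives the lower
  bound. For the upper bound the level is split into \<open>(1 - \<epsilon>) * u\<close> for the
  multiplicative part and \<open>\<epsilon> * u\<close> for \<open>B\<close>, whose supremum has a
  tail of smaller order.\<close>

lemma exceed_tail:
  assumes s: "0 \<le> s"
  shows "((\<lambda>u. u powr \<alpha> * prob (exceed s (real m) u))
    \<longlongrightarrow> C * expectation (\<lambda>\<omega>. root_sup s (real m) \<omega> powr \<alpha>)) at_top"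
proof (rule order_tendstoI)
  let ?h = "\<lambda>u. prob {\<omega> \<in> space M. u < root_sup s (real m) \<omega> * V 0 \<omega>}"
  let ?k = "\<lambda>u. prob {\<omega> \<in> space M. \<exists>r\<in>dyadics \<inter> {0..real m}. u < B 0 r \<omega>}"
  let ?L = "C * expectation (\<lambda>\<omega>. root_sup s (real m) \<omega> powr \<alpha>)"
  have h: "((\<lambda>u. u powr \<alpha> * ?h u) \<longlongrightarrow> ?L) at_top"
    using of_nat_dyadics s by (rule root_sup_tail)
  fix l
  { assume "l < ?L"
    with h have "\<forall>\<^sub>F u in at_top. l < u powr \<alpha> * ?h u" by (rule order_tendstoD)
    then show "\<forall>\<^sub>F u in at_top. l < u powr \<alpha> * prob (exceed s (real m) u)"
      using eventually_gt_at_top[of 0]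
    proof eventually_elim
      case (elim u)
      have "u powr \<alpha> * ?h u \<le> u powr \<alpha> * prob (exceed s (real m) u)"
        using prob_root_sup_le[OF elim(2)] by (intro mult_left_mono) auto
      with elim(1) show ?case by linarith
    qed }
  { assume l: "?L < l"
    \<comment> \<open>\<epsilon> is fixed before \<open>u\<close> grows, small enough that the
      distortion \<open>(1 - \<epsilon>) powr (- \<alpha>)\<close> keeps the limit below
      \<open>l\<close>.\<close>
    have "((\<lambda>\<epsilon>. (1 - \<epsilon>) powr (- \<alpha>) * ?L) \<longlongrightarrow> (1 - 0) powr (- \<alpha>) * ?L) (at_right 0)"
      by (intro tendsto_intros) auto
    then have "\<forall>\<^sub>F \<epsilon> in at_right 0. (1 - \<epsilon>) powr (- \<alpha>) * ?L < l"
      by (rule order_tendstoD) (use l in simp)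
    moreover have "\<forall>\<^sub>F \<epsilon> in at_right 0. \<epsilon> \<in> {0<..<1::real}"
      by (rule eventually_at_right_real) simp
    ultimately have "\<forall>\<^sub>F \<epsilon> in at_right 0. (1 - \<epsilon>) powr (- \<alpha>) * ?L < l \<and> \<epsilon> \<in> {0<..<1}"
      by (rule eventually_conj)
    from eventually_happens[OF this]
    obtain \<epsilon> where \<epsilon>: "(1 - \<epsilon>) powr (- \<alpha>) * ?L < l" "0 < \<epsilon>" "\<epsilon> < 1" by auto
    have "((\<lambda>u. u powr \<alpha> * ?h ((1 - \<epsilon>) * u) + u powr \<alpha> * ?k (\<epsilon> * u))
      \<longlongrightarrow> (1 - \<epsilon>) powr (- \<alpha>) * ?L + \<epsilon> powr (- \<alpha>) * 0) at_top"
      using \<epsilon> by (intro tendsto_add tail_scale[OF h] tail_scale[OF sup_B_tail]) auto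
    then have "\<forall>\<^sub>F u in at_top. u powr \<alpha> * ?h ((1 - \<epsilon>) * u) + u powr \<alpha> * ?k (\<epsilon> * u) < l"
      by (rule order_tendstoD) (use \<epsilon> in simp)
    then show "\<forall>\<^sub>F u in at_top. u powr \<alpha> * prob (exceed s (real m) u) < l"
      using eventually_gt_at_top[of 0]
    proof eventually_elim
      case (elim u)
      have k_events: "{\<omega> \<in> space M. \<exists>r\<in>dyadics \<inter> {0..real m}. \<epsilon> * u < B 0 r \<omega>} \<in> events"
      proof (intro sets_Collect_bex_countable countable_Int1[OF countable_dyadics])
        fix r assume "r \<in> dyadics \<inter> {0..real m}"
        then have [measurable]: "B 0 r \<in> borel_measurable M"
          using B_past[OF zero_dyadics] by (auto intro: measurable_past)
        show "{\<omega> \<in> space M. \<epsilon> * u < B 0 r \<omega>} \<in> events" by measurable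
      qed
      have "prob (exceed s (real m) u) \<le> prob ({\<omega> \<in> space M. (1 - \<epsilon>) * u < root_sup s (real m) \<omega> * V 0 \<omega>}
          \<union> {\<omega> \<in> space M. \<exists>r\<in>dyadics \<inter> {0..real m}. \<epsilon> * u < B 0 r \<omega>})"
      proof (rule prob_mono_good)
        fix \<omega> assume g: "good \<omega>" and "\<omega> \<in> exceed s (real m) u"
        then obtain r where r: "r \<in> dyadics" "s \<le> r" "r \<le> real m" "u < V r \<omega>"
          by (auto simp: exceed_def)
        have "u < exp (- \<xi> r \<omega>) * V 0 \<omega> + B 0 r \<omega>"
          using r V_decomp[OF g r(1)] by simp
        then consider "(1 - \<epsilon>) * u < exp (- \<xi> r \<omega>) * V 0 \<omega>" | "\<epsilon> * u < B 0 r \<omega>"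
          by (force simp: algebra_simps)
        then show "\<omega> \<in> {\<omega> \<in> space M. (1 - \<epsilon>) * u < root_sup s (real m) \<omega> * V 0 \<omega>}
            \<union> {\<omega> \<in> space M. \<exists>r\<in>dyadics \<inter> {0..real m}. \<epsilon> * u < B 0 r \<omega>}"
        proof cases
          case 1
          have pos: "0 < (1 - \<epsilon>) * u" using elim \<epsilon> by simp
          from 1 r have "(1 - \<epsilon>) * u < root_sup s (real m) \<omega> * V 0 \<omega>"
            unfolding root_sup_exceeds[OF g pos] by auto
          then show ?thesis using g by (simp add: good_def)
        next
          case 2
          then show ?thesis using g r s by (auto simp: good_def)
        qed
      qed (use k_events in measurable)
      also have "\<dots> \<le> ?h ((1 - \<epsilon>) * u) + ?k (\<epsilon> * u)"
        by (rule measure_Un_le) (use k_events in measurable)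
      finally have "u powr \<alpha> * prob (exceed s (real m) u) \<le> u powr \<alpha> * (?h ((1 - \<epsilon>) * u) + ?k (\<epsilon> * u))"
        by (intro mult_left_mono) auto
      with elim show ?case by (simp add: distrib_left)
    qed }
qed

end

section \<open>Absence of long-range clustering\<close>

text \<open>
  The exponent is halved because the moment of order \<open>\<alpha> / 2\<close> contracts, unlike the one of order \<open>\<alpha>\<close>.
\<close>

lemma min_one_le_sqrt_powr:
  fixes y :: real
  assumes "0 < y" "0 < \<alpha>" "x \<le> 1" "x \<le> y powr \<alpha>"
  shows "x \<le> y powr (\<alpha> / 2)"
proof (cases "1 \<le> y")
  case True
  then have "1 \<le> y powr (\<alpha> / 2)" using assms(2) by (intro ge_one_powr_ge_zero) auto
  then show ?thesis using assms(3) by simp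
next
  case False
  then have "y powr \<alpha> \<le> y powr (\<alpha> / 2)" using assms(1,2) by (intro powr_mono') auto
  then show ?thesis using assms(4) by simp
qed

context gou_tail
begin

text \<open>The peak probabilities are taken at \<open>Suc m\<close>, so that the interval free of
  exceedances, \<open>[1, Suc m]\<close>, has length \<open>m\<close> and contains time 1 even for
  \<open>m = 0\<close>.\<close>

abbreviation peak :: "nat \<Rightarrow> real \<Rightarrow> 'a set" where
  "peak m u \<equiv> exceed 0 1 u - exceed 1 (real m) u"

lemma exceed_1_past:
  "{\<omega> \<in> space M. \<exists>r\<in>dyadics \<inter> {0..1}. u < V_adapted r \<omega>} \<in> sets (past 1)"
proof -
  have "{\<omega> \<in> space (past 1). \<exists>r\<in>dyadics \<inter> {0..1}. u < V_adapted r \<omega>} \<in> sets (past 1)"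
  proof (intro sets_Collect_bex_countable countable_Int1[OF countable_dyadics])
    fix r assume "r \<in> dyadics \<inter> {0..1}"
    then have [measurable]: "V_adapted r \<in> borel_measurable (past 1)" using V_adapted_past by auto
    show "{\<omega> \<in> space (past 1). u < V_adapted r \<omega>} \<in> sets (past 1)" by measurable
  qed
  then show ?thesis by simp
qed

text \<open>The second exceedance is moved to time \<open>Suc k\<close>, where
  \<open>V (Suc k)\<close> equals \<open>Y * V 1 + B 1 (Suc k)\<close>. The summand \<open>B\<close>
  is independent of the first exceedance and gives a product of two tails. With \<open>Y\<close>
  frozen at \<open>y\<close>, the joint probability is at most a constant times
  \<open>u powr (- \<alpha>)\<close>, and also at most that times \<open>y powr \<alpha>\<close>;
  interpolating at half the exponent and integrating yields \<open>q ^ k\<close>, as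
  \<open>Y\<close> spans \<open>k\<close> units of time.\<close>

lemma anticluster_step:
  assumes q: "exp_mom (\<alpha> / 2) 1 = ennreal q" "0 \<le> q"
  obtains c c' where "0 \<le> c" "0 \<le> c'" "\<And>k u. 1 \<le> k \<Longrightarrow> 0 < u \<Longrightarrow>
    prob (exceed 0 1 u \<inter> exceed (real k) (real (Suc k)) u)
      \<le> c * q ^ k * u powr (- \<alpha>) + c' * (u powr (- \<alpha>))\<^sup>2"
proof -
  obtain b where b: "\<And>r t. r \<in> dyadics \<Longrightarrow> t \<in> dyadics \<Longrightarrow> r \<le> t \<Longrightarrow> t - r \<le> 1 \<Longrightarrow>
    1 / 2 \<le> prob {\<omega> \<in> space M. \<xi> t \<omega> - \<xi> r \<omega> \<le> b}"
    using \<xi>_bound_prob by blast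
  obtain K where K: "0 < K" "\<And>y. 0 < y \<Longrightarrow> prob (exceed 0 1 y) \<le> K * y powr (- \<alpha>)"
    using prob_exceed_power_bound[OF one_dyadics] by blast
  \<comment> \<open>The maximal inequality lowers the level by \<open>exp (- b)\<close>; half of
    that goes to each of the two summands of \<open>V (Suc k)\<close>.\<close>
  define \<gamma> where "\<gamma> = exp (- b) / 2"
  have \<gamma>: "0 < \<gamma>" by (simp add: \<gamma>_def)
  \<comment> \<open>Covers both bounds used for frozen \<open>Y\<close>: the one for the first
    exceedance alone and the one for \<open>V 1\<close> above
    \<open>\<gamma> * u / y\<close>.\<close>
  define K2 where "K2 = max K (K * \<gamma> powr (- \<alpha>))"
  have K2: "0 \<le> K2" "K \<le> K2" "K * \<gamma> powr (- \<alpha>) \<le> K2" using K(1) by (simp_all add: K2_def)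
  have V_tail: "prob {\<omega> \<in> space M. y < V t \<omega>} \<le> K * y powr (- \<alpha>)" if "0 < y" "0 \<le> t" for y t
  proof -
    have "prob {\<omega> \<in> space M. y < V t \<omega>} = prob {\<omega> \<in> space M. y < V 0 \<omega>}"
      using that by (intro V_tail_eq) auto
    also have "\<dots> \<le> prob (exceed 0 1 y)"
      by (rule finite_measure_mono[OF _ exceed_events]) (use zero_dyadics in \<open>auto simp: exceed_def\<close>)
    finally show ?thesis using K(2)[OF that(1)] by simp
  qed
  show ?thesis
  proof (rule that[of "2 * K2" "2 * (K * K2)"])
    fix k :: nat and u :: real assume k: "1 \<le> k" and u: "0 < u"
    have kd: "real k \<in> dyadics" and k1d: "real (Suc k) \<in> dyadics" by (rule of_nat_dyadics)+
    have le1: "1 \<le> real k" "1 \<le> real (Suc k)" using k by auto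
    define A where "A = {\<omega> \<in> space M. \<exists>r\<in>dyadics \<inter> {0..1}. u < V_adapted r \<omega>}"
    have A_past: "A \<in> sets (past 1)" unfolding A_def by (rule exceed_1_past)
    have A_past_k: "A \<in> sets (past (real k))" using A_past sets_past_mono[OF le1(1)] by blast
    have A_events [measurable]: "A \<in> events" using A_past sets_past_subset by blast
    have A_iff: "\<omega> \<in> A \<longleftrightarrow> \<omega> \<in> exceed 0 1 u" if "good \<omega>" for \<omega>
      using that by (auto simp: A_def exceed_def V_adapted_eq)
    have prob_A: "prob A \<le> K * u powr (- \<alpha>)"
    proof -
      have "prob A = prob (exceed 0 1 u)"
        by (rule prob_cong_good[OF A_iff]) simp_all
      then show ?thesis using K(2)[OF u] by simp
    qed
    define Y where "Y \<omega> = exp (- (\<xi> (real (Suc k)) \<omega> - \<xi> 1 \<omega>))" for \<omega>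
    have Y_future: "Y \<in> borel_measurable (future 1)"
      unfolding Y_def[abs_def]
      by (intro measurable_compose[OF _ borel_measurable_exp] borel_measurable_uminus \<xi>_incr_future one_dyadics k1d le1) auto
    \<comment> \<open>The value 0 off \<open>A\<close> encodes the first exceedance: as
      \<open>\<gamma> * u\<close> is positive, \<open>Y * T > \<gamma> * u\<close> can hold only on
      \<open>A\<close>.\<close>
    define T where "T \<omega> = (if \<omega> \<in> A then V_adapted 1 \<omega> else 0)" for \<omega>
    have T_past: "T \<in> borel_measurable (past 1)"
    proof -
      have [measurable]: "A \<in> sets (past 1)" "V_adapted 1 \<in> borel_measurable (past 1)"
        using A_past V_adapted_past[OF one_dyadics order_refl] by auto
      show ?thesis unfolding T_def[abs_def] by measurable
    qed
    have [measurable]: "Y \<in> borel_measurable M" "T \<in> borel_measurable M" "B 1 (real (Suc k)) \<in> borel_measurable M"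
      "V_adapted (real (Suc k)) \<in> borel_measurable M" "V (real (Suc k)) \<in> borel_measurable M"
      using measurable_future[OF Y_future] measurable_past[OF T_past]
        measurable_future[OF B_future[OF one_dyadics k1d]] V_adapted_measurable[OF k1d] V_dyadic[OF k1d] by auto
    let ?E1 = "{\<omega> \<in> space M. \<gamma> * u < Y \<omega> * T \<omega>}"
    let ?E2 = "{\<omega> \<in> space M. \<gamma> * u < B 1 (real (Suc k)) \<omega>}"
    have "prob (exceed 0 1 u \<inter> exceed (real k) (real (Suc k)) u)
      = prob {\<omega> \<in> space M. \<exists>r\<in>dyadics \<inter> {real k..real (Suc k)}. \<omega> \<in> A \<and> u < V_adapted r \<omega>}"
    proof (rule prob_cong_good)
      show "exceed 0 1 u \<inter> exceed (real k) (real (Suc k)) u \<in> events" by measurable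
      show "{\<omega> \<in> space M. \<exists>r\<in>dyadics \<inter> {real k..real (Suc k)}. \<omega> \<in> A \<and> u < V_adapted r \<omega>} \<in> events"
      proof (intro sets_Collect_bex_countable countable_Int1[OF countable_dyadics])
        fix r assume "r \<in> dyadics \<inter> {real k..real (Suc k)}"
        then have [measurable]: "V_adapted r \<in> borel_measurable M" using V_adapted_measurable by auto
        show "{\<omega> \<in> space M. \<omega> \<in> A \<and> u < V_adapted r \<omega>} \<in> events" by measurable
      qed
    qed (auto simp: A_iff exceed_def[of "real k"] V_adapted_eq)
    also have "\<dots> \<le> 2 * prob {\<omega> \<in> space M. \<omega> \<in> A \<and> u * exp (- b) < V_adapted (real (Suc k)) \<omega>}"
    proof (rule ottaviani[OF kd k1d A_past_k _ _ _ u])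
      fix \<omega> r assume "good \<omega>" "r \<in> dyadics" "real k \<le> r" "r \<le> real (Suc k)"
      then show "exp (- (\<xi> (real (Suc k)) \<omega> - \<xi> r \<omega>)) * V_adapted r \<omega> \<le> V_adapted (real (Suc k)) \<omega>"
        using V_ge_scaled[OF _ _ k1d] by (simp only: V_adapted_eq k1d)
    qed (use b k1d in \<open>auto intro: V_adapted_past\<close>)
    also have "prob {\<omega> \<in> space M. \<omega> \<in> A \<and> u * exp (- b) < V_adapted (real (Suc k)) \<omega>} \<le> prob (?E1 \<union> (A \<inter> ?E2))"
    proof (rule prob_mono_good)
      fix \<omega> assume g: "good \<omega>"
        and \<omega>: "\<omega> \<in> {\<omega> \<in> space M. \<omega> \<in> A \<and> u * exp (- b) < V_adapted (real (Suc k)) \<omega>}"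
      have "V_adapted (real (Suc k)) \<omega> = Y \<omega> * T \<omega> + B 1 (real (Suc k)) \<omega>"
        unfolding V_adapted_eq[OF g k1d] V_eq_B[OF g one_dyadics k1d le1(2)]
        using \<omega> by (simp add: Y_def T_def V_adapted_eq[OF g one_dyadics])
      moreover have "u * exp (- b) = \<gamma> * u + \<gamma> * u" by (simp add: \<gamma>_def)
      moreover have "u * exp (- b) < V_adapted (real (Suc k)) \<omega>" using \<omega> by (simp del: of_nat_Suc)
      ultimately have "\<gamma> * u < Y \<omega> * T \<omega> \<or> \<gamma> * u < B 1 (real (Suc k)) \<omega>" by linarith
      then show "\<omega> \<in> ?E1 \<union> (A \<inter> ?E2)" using \<omega> by auto
    qed measurable
    also have "\<dots> \<le> prob ?E1 + prob (A \<inter> ?E2)" by (rule measure_Un_le) measurable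
    also have "prob (A \<inter> ?E2) \<le> K * K2 * (u powr (- \<alpha>))\<^sup>2"
    proof -
      have E2: "?E2 \<in> sets (future 1)"
      proof -
        have [measurable]: "B 1 (real (Suc k)) \<in> borel_measurable (future 1)" by (rule B_future[OF one_dyadics k1d])
        have "{\<omega> \<in> space (future 1). \<gamma> * u < B 1 (real (Suc k)) \<omega>} \<in> sets (future 1)" by measurable
        then show ?thesis by simp
      qed
      \<comment> \<open>\<open>B 1 (Suc k)\<close> is dominated by \<open>V (Suc k)\<close>, so
        stationarity supplies a tail bound with a constant that does not depend on
        \<open>k\<close>.\<close>
      have "prob ?E2 \<le> prob {\<omega> \<in> space M. \<gamma> * u < V (real (Suc k)) \<omega>}"
      proof (rule prob_mono_good)
        fix \<omega> assume g: "good \<omega>" and \<omega>: "\<omega> \<in> ?E2"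
        have "0 \<le> exp (- (\<xi> (real (Suc k)) \<omega> - \<xi> 1 \<omega>)) * V 1 \<omega>" using g by (simp add: good_def)
        then show "\<omega> \<in> {\<omega> \<in> space M. \<gamma> * u < V (real (Suc k)) \<omega>}"
          using \<omega> V_eq_B[OF g one_dyadics k1d le1(2)] by (simp del: of_nat_Suc)
      qed measurable
      also have "\<dots> \<le> K * (\<gamma> * u) powr (- \<alpha>)" using \<gamma> u by (intro V_tail) auto
      also have "\<dots> = K * \<gamma> powr (- \<alpha>) * u powr (- \<alpha>)" using \<gamma> u by (simp add: powr_mult)
      also have "\<dots> \<le> K2 * u powr (- \<alpha>)" using K2 by (intro mult_right_mono) auto
      finally have "prob A * prob ?E2 \<le> (K * u powr (- \<alpha>)) * (K2 * u powr (- \<alpha>))"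
        using prob_A K by (intro mult_mono) auto
      then show ?thesis
        using prob_past_future[OF A_past E2] by (simp add: power2_eq_square mult_ac)
    qed
    also have "prob ?E1 \<le> K2 * q ^ k * u powr (- \<alpha>)"
    proof -
      have "ennreal (prob ?E1) = emeasure M {\<omega> \<in> space M. (T \<omega>, Y \<omega>) \<in> {p. \<gamma> * u < snd p * fst p}}"
        by (simp add: emeasure_eq_measure)
      also have "\<dots> = (\<integral>\<^sup>+\<omega>. emeasure M {\<omega>' \<in> space M. (T \<omega>', Y \<omega>) \<in> {p. \<gamma> * u < snd p * fst p}} \<partial>M)"
      proof (rule emeasure_indep_pair[OF indep_var_past_future[OF T_past Y_future]])
        have "{p \<in> space (borel \<Otimes>\<^sub>M borel). \<gamma> * u < snd p * fst p} \<in> sets (borel \<Otimes>\<^sub>M borel)"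
          by measurable
        then show "{p. \<gamma> * u < snd p * fst p} \<in> sets (borel \<Otimes>\<^sub>M borel)"
          by (simp add: space_pair_measure)
      qed
      also have "\<dots> \<le> (\<integral>\<^sup>+\<omega>. ennreal (K2 * u powr (- \<alpha>)) * ennreal (exp (- (\<alpha> / 2) * (\<xi> (real (Suc k)) \<omega> - \<xi> 1 \<omega>))) \<partial>M)"
      proof (rule nn_integral_mono)
        fix \<omega>
        define y where "y = Y \<omega>"
        have y: "0 < y" by (simp add: y_def Y_def)
        have gu: "0 < \<gamma> * u" using \<gamma> u by simp
        let ?D = "{\<omega>' \<in> space M. \<gamma> * u < y * T \<omega>'}"
        have "prob ?D \<le> prob A"
          using gu by (intro finite_measure_mono) (auto simp: T_def split: if_splits)
        also have "\<dots> \<le> K2 * u powr (- \<alpha>)"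
          using prob_A K2(2) by (meson mult_right_mono order_trans powr_ge_zero)
        finally have 1: "prob ?D \<le> K2 * u powr (- \<alpha>)" .
        have "prob ?D \<le> prob {\<omega> \<in> space M. \<gamma> * u / y < V 1 \<omega>}"
        proof (rule prob_mono_good)
          show "\<omega>' \<in> {\<omega> \<in> space M. \<gamma> * u / y < V 1 \<omega>}" if "good \<omega>'" "\<omega>' \<in> ?D" for \<omega>'
            using that gu y
            by (auto simp: T_def V_adapted_eq[OF _ one_dyadics] pos_divide_less_eq mult.commute split: if_splits)
          have [measurable]: "V 1 \<in> borel_measurable M" by (rule V_dyadic[OF one_dyadics])
          show "{\<omega> \<in> space M. \<gamma> * u / y < V 1 \<omega>} \<in> events" by measurable
        qed
        also have "\<dots> \<le> K * (\<gamma> * u / y) powr (- \<alpha>)" using gu y by (intro V_tail) auto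
        also have "\<dots> = K * \<gamma> powr (- \<alpha>) * (u powr (- \<alpha>) * y powr \<alpha>)"
          using \<gamma> u y by (simp add: powr_mult powr_divide powr_minus field_simps)
        also have "\<dots> \<le> K2 * (u powr (- \<alpha>) * y powr \<alpha>)" using K2 by (intro mult_right_mono) auto
        finally have 2: "prob ?D \<le> K2 * u powr (- \<alpha>) * y powr \<alpha>" by (simp add: mult.assoc)
        have K2u: "0 < K2 * u powr (- \<alpha>)" using K2 K u by simp
        have "prob ?D / (K2 * u powr (- \<alpha>)) \<le> y powr (\<alpha> / 2)"
          using 1 2 K2u by (intro min_one_le_sqrt_powr[OF y \<alpha>_pos]) (auto simp: pos_divide_le_eq mult.commute)
        then have "prob ?D \<le> K2 * u powr (- \<alpha>) * y powr (\<alpha> / 2)"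
          using K2u by (simp add: pos_divide_le_eq mult.commute)
        also have "y powr (\<alpha> / 2) = exp (- (\<alpha> / 2) * (\<xi> (real (Suc k)) \<omega> - \<xi> 1 \<omega>))"
          by (simp add: y_def Y_def powr_def algebra_simps)
        finally have "ennreal (prob ?D) \<le> ennreal (K2 * u powr (- \<alpha>) * exp (- (\<alpha> / 2) * (\<xi> (real (Suc k)) \<omega> - \<xi> 1 \<omega>)))"
          by (rule ennreal_leI)
        then show "emeasure M {\<omega>' \<in> space M. (T \<omega>', Y \<omega>) \<in> {p. \<gamma> * u < snd p * fst p}}
          \<le> ennreal (K2 * u powr (- \<alpha>)) * ennreal (exp (- (\<alpha> / 2) * (\<xi> (real (Suc k)) \<omega> - \<xi> 1 \<omega>)))"
          using K2u by (simp add: emeasure_eq_measure y_def ennreal_mult'')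
      qed
      also have "\<dots> = ennreal (K2 * u powr (- \<alpha>)) * exp_mom (\<alpha> / 2) (real (Suc k) - 1)"
      proof -
        have [measurable]: "\<xi> (real (Suc k)) \<in> borel_measurable M" "\<xi> 1 \<in> borel_measurable M"
          using k1d one_dyadics by (auto intro: \<xi>_dyadic)
        show ?thesis
          by (subst nn_integral_cmult) (measurable, simp only: exp_mom_incr[OF one_dyadics k1d le1(2)])
      qed
      also have "exp_mom (\<alpha> / 2) (real (Suc k) - 1) = ennreal (q ^ k)"
        using exp_mom_nat[of "\<alpha> / 2" k] q by (simp add: ennreal_power)
      finally have "ennreal (prob ?E1) \<le> ennreal (K2 * u powr (- \<alpha>) * q ^ k)"
        using q K2 by (simp add: ennreal_mult)
      then show ?thesis using q K2 by (subst (asm) ennreal_le_iff) (auto simp: mult_ac)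
    qed
    finally show "prob (exceed 0 1 u \<inter> exceed (real k) (real (Suc k)) u)
      \<le> 2 * K2 * q ^ k * u powr (- \<alpha>) + 2 * (K * K2) * (u powr (- \<alpha>))\<^sup>2"
      by (simp add: algebra_simps)
  qed (use K K2 in auto)
qed

text \<open>The two peak events differ only by paths that exceed the level again in one of the unit
  intervals between \<open>Suc m\<close> and \<open>Suc N\<close>; summing the pairwise bounds gives
  a geometric series and at most \<open>N\<close> quadratic terms.\<close>

lemma anticluster:
  assumes q: "exp_mom (\<alpha> / 2) 1 = ennreal q" "0 \<le> q" "q < 1"
  obtains c c' where "\<And>m N u. m \<le> N \<Longrightarrow> 0 < u \<Longrightarrow>
    prob (peak (Suc m) u) - prob (peak (Suc N) u)
      \<le> c * q ^ m * u powr (- \<alpha>) + c' * real N * (u powr (- \<alpha>))\<^sup>2"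
proof -
  obtain c c' where c: "0 \<le> c" "0 \<le> c'" "\<And>k u. 1 \<le> k \<Longrightarrow> 0 < u \<Longrightarrow>
    prob (exceed 0 1 u \<inter> exceed (real k) (real (Suc k)) u)
      \<le> c * q ^ k * u powr (- \<alpha>) + c' * (u powr (- \<alpha>))\<^sup>2"
    using anticluster_step[OF q(1,2)] by blast
  show ?thesis
  proof (rule that[of "c / (1 - q)" c'])
    fix m N :: nat and u :: real assume mN: "m \<le> N" and u: "0 < u"
    let ?E = "\<lambda>k. exceed 0 1 u \<inter> exceed (real k) (real (Suc k)) u"
    have "peak (Suc m) u \<subseteq> peak (Suc N) u \<union> (\<Union>k\<in>{Suc m..<Suc N}. ?E k)"
    proof
      fix \<omega> assume \<omega>: "\<omega> \<in> peak (Suc m) u"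
      show "\<omega> \<in> peak (Suc N) u \<union> (\<Union>k\<in>{Suc m..<Suc N}. ?E k)"
      proof (cases "\<omega> \<in> exceed 1 (real (Suc N)) u")
        case True
        then obtain r where r: "r \<in> dyadics" "1 \<le> r" "r \<le> real (Suc N)" "u < V r \<omega>" "\<omega> \<in> space M"
          by (auto simp: exceed_def)
        have "\<not> r \<le> real (Suc m)"
          using \<omega> r by (auto simp: exceed_def)
        then have r': "real (Suc m) < r" by simp
        \<comment> \<open>Ceiling minus one, so that \<open>k < r \<le> Suc k\<close>; together with
          \<open>r > Suc m\<close> this gives \<open>k \<ge> Suc m\<close> also when
          \<open>r\<close> is an integer.\<close>
        define k where "k = nat (\<lceil>r\<rceil> - 1)"
        have k: "real k < r" "r \<le> real (Suc k)" using r(2) unfolding k_def by linarith+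
        have "Suc m \<le> k" "k < Suc N" using k r' r(3) by linarith+
        moreover have "\<omega> \<in> ?E k" using \<omega> r k by (auto simp: exceed_def)
        ultimately show ?thesis by auto
      qed (use \<omega> in auto)
    qed
    then have "prob (peak (Suc m) u) \<le> prob (peak (Suc N) u \<union> (\<Union>k\<in>{Suc m..<Suc N}. ?E k))"
      by (intro finite_measure_mono) auto
    also have "\<dots> \<le> prob (peak (Suc N) u) + prob (\<Union>k\<in>{Suc m..<Suc N}. ?E k)"
      by (rule measure_Un_le) auto
    also have "prob (\<Union>k\<in>{Suc m..<Suc N}. ?E k) \<le> (\<Sum>k\<in>{Suc m..<Suc N}. prob (?E k))"
      by (intro measure_UNION_le) auto
    also have "\<dots> \<le> (\<Sum>k\<in>{Suc m..<Suc N}. c * q ^ k * u powr (- \<alpha>) + c' * (u powr (- \<alpha>))\<^sup>2)"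
      by (intro sum_mono c(3) u) auto
    also have "\<dots> = c * u powr (- \<alpha>) * (\<Sum>k\<in>{Suc m..<Suc N}. q ^ k) + c' * real (N - m) * (u powr (- \<alpha>))\<^sup>2"
      by (simp add: sum.distrib sum_distrib_left mult_ac del: sum.op_ivl_Suc)
    also have "\<dots> \<le> c * u powr (- \<alpha>) * (q ^ m / (1 - q)) + c' * real N * (u powr (- \<alpha>))\<^sup>2"
    proof (intro add_mono mult_left_mono mult_right_mono)
      have "(\<Sum>k\<in>{Suc m..<Suc N}. q ^ k) = q ^ Suc m * (\<Sum>k<N - m. q ^ k)"
        by (subst sum_distrib_left, rule sum.reindex_bij_witness[of _ "\<lambda>k. k + Suc m" "\<lambda>k. k - Suc m"])
          (auto simp del: power_Suc simp flip: power_add)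
      also have "\<dots> = q ^ Suc m * ((1 - q ^ (N - m)) / (1 - q))"
        using q by (subst sum_gp_strict) auto
      also have "\<dots> \<le> q ^ m * (1 / (1 - q))"
        using q by (intro mult_mono divide_right_mono power_decreasing divide_nonneg_nonneg) (auto simp: power_le_one)
      finally show "(\<Sum>k\<in>{Suc m..<Suc N}. q ^ k) \<le> q ^ m / (1 - q)" by simp
    qed (use c in auto)
    finally show "prob (peak (Suc m) u) - prob (peak (Suc N) u)
        \<le> c / (1 - q) * q ^ m * u powr (- \<alpha>) + c' * real N * (u powr (- \<alpha>))\<^sup>2"
      by (simp add: mult_ac)
  qed
qed

lemma exceed_Un:
  assumes "1 \<le> t" shows "exceed 0 1 u \<union> exceed 1 t u = exceed 0 t u"
  using assms unfolding exceed_def by (auto; fastforce)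

lemma prob_peak: "prob (peak (Suc m) u) = prob (exceed 0 (real (Suc m)) u) - prob (exceed 1 (real (Suc m)) u)"
proof -
  have "peak (Suc m) u = exceed 0 (real (Suc m)) u - exceed 1 (real (Suc m)) u"
    using exceed_Un[of "real (Suc m)" u] by auto
  then show ?thesis
    by (simp only:) (rule finite_measure_Diff; simp add: exceed_subset)
qed

text \<open>Telescoping: by stationarity the interval \<open>[1, Suc N]\<close> has the same
  exceedance probability as \<open>[0, N]\<close>, so passing from \<open>N\<close> to
  \<open>Suc N\<close> adds exactly one peak probability.\<close>

lemma prob_exceed_sum:
  "prob (exceed 0 (real N) u) = prob {\<omega> \<in> space M. u < V 0 \<omega>} + (\<Sum>m<N. prob (peak (Suc m) u))"
proof (induction N)
  case 0
  have "exceed 0 0 u = {\<omega> \<in> space M. u < V 0 \<omega>}"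
    using zero_dyadics by (auto simp: exceed_def)
  then show ?case by simp
next
  case (Suc N)
  have "prob (exceed (0 + 1) (real N + 1) u) = prob (exceed 0 (real N) u)"
    by (rule prob_exceed_shift[OF one_dyadics]) simp
  then have "prob (exceed 1 (real (Suc N)) u) = prob (exceed 0 (real N) u)"
    by (simp add: add.commute)
  with Suc show ?case using prob_peak[of u N] by simp
qed

text \<open>The difference of two Breiman constants; that it is the mean of a positive part is the
  content of \<open>peak_const_eq\<close>.\<close>

definition peak_const :: "nat \<Rightarrow> real" where
  "peak_const m = expectation (\<lambda>\<omega>. root_sup 0 (real (Suc m)) \<omega> powr \<alpha>)
     - expectation (\<lambda>\<omega>. root_sup 1 (real (Suc m)) \<omega> powr \<alpha>)"

lemma peak_tail: "((\<lambda>u. u powr \<alpha> * prob (peak (Suc m) u)) \<longlongrightarrow> C * peak_const m) at_top"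
  using tendsto_diff[OF exceed_tail[of 0 "Suc m"] exceed_tail[of 1 "Suc m"]]
  by (simp add: prob_peak peak_const_def right_diff_distrib del: of_nat_Suc)

end

section \<open>The extremal constant\<close>

text \<open>Right-continuity transfers values to dyadic times to the right inside \<open>S\<close>.
  A closed right end point has no such room and must be dyadic itself, which the last hypothesis
  allows for.\<close>

lemma SUP_cadlag_dyadics:
  fixes f :: "real \<Rightarrow> real"
  assumes f: "cadlag f" "\<And>r. 0 \<le> f r" and S: "S \<subseteq> {0..}"
    and dense: "\<And>t. t \<in> S \<Longrightarrow> t \<in> dyadics \<or> (\<exists>t'>t. {t..<t'} \<subseteq> S)"
  shows "(SUP t\<in>S. ennreal (f t)) = (SUP t\<in>dyadics \<inter> S. ennreal (f t))"
proof (rule antisym)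
  show "(SUP t\<in>dyadics \<inter> S. ennreal (f t)) \<le> (SUP t\<in>S. ennreal (f t))"
    by (rule SUP_subset_mono) auto
  show "(SUP t\<in>S. ennreal (f t)) \<le> (SUP t\<in>dyadics \<inter> S. ennreal (f t))"
  proof (rule SUP_least)
    fix t assume t: "t \<in> S"
    from dense[OF t] show "ennreal (f t) \<le> (SUP t\<in>dyadics \<inter> S. ennreal (f t))"
    proof
      assume "t \<in> dyadics"
      with t show ?thesis by (intro SUP_upper) auto
    next
      assume "\<exists>t'>t. {t..<t'} \<subseteq> S"
      then obtain t' where t': "t < t'" "{t..<t'} \<subseteq> S" by blast
      show ?thesis
      proof (rule dense_le)
        fix c assume c: "c < ennreal (f t)"
        then obtain c' where c': "c = ennreal c'" "0 \<le> c'" by (cases c) auto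
        with c have "c' < f t" by (simp add: ennreal_less_iff)
        have "0 \<le> t" using t S by auto
        from cadlag_dyadic_exceeds[OF f(1) this t'(1) \<open>c' < f t\<close>]
        obtain r where r: "r \<in> dyadics" "t < r" "r < t'" "c' < f r" .
        then have "c \<le> ennreal (f r)" using c' by (simp add: ennreal_leI)
        also have "\<dots> \<le> (SUP t\<in>dyadics \<inter> S. ennreal (f t))"
          using r t' by (intro SUP_upper) auto
        finally show "c \<le> (SUP t\<in>dyadics \<inter> S. ennreal (f t))" .
      qed
    qed
  qed
qed

lemma ennreal_power_eq_1_imp:
  fixes x :: ennreal
  assumes "x ^ k = 1" "0 < k" shows "x = 1"
proof (cases x)
  case (real r)
  then have "r ^ k = 1" using assms(1) by (simp add: ennreal_power ennreal_eq_1)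
  then have "r = 1" using assms(2) real power_eq_imp_eq_base[of r k 1] by simp
  then show ?thesis using real by simp
next
  case top
  have "(top :: ennreal) ^ Suc j = top" for j by (induction j) (simp_all add: ennreal_top_mult)
  with assms top show ?thesis by (cases k) auto
qed

context gou_tail
begin

definition sup_exp_tail :: "'a \<Rightarrow> ennreal" where
  "sup_exp_tail \<omega> = (SUP m. sup_exp 1 (real (Suc m)) \<omega>)"

lemma sup_exp_mono: "s' \<le> s \<Longrightarrow> t \<le> t' \<Longrightarrow> sup_exp s t \<omega> \<le> sup_exp s' t' \<omega>"
  unfolding sup_exp_def by (rule SUP_subset_mono) auto

lemma sup_exp_tail_measurable [measurable]: "sup_exp_tail \<in> borel_measurable M"
  unfolding sup_exp_tail_def[abs_def] by measurable

lemma sup_decrease_mean_dyadic: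
  "sup_decrease_mean M \<xi> \<alpha> = enn2real (\<integral>\<^sup>+\<omega>. sup_exp 0 1 \<omega> - sup_exp_tail \<omega> \<partial>M)"
  unfolding sup_decrease_mean_def
proof (rule arg_cong[where f = enn2real], rule nn_integral_cong_AE, rule AE_mp[OF AE_good], intro AE_I2 impI)
  fix \<omega> assume g: "good \<omega>"
  let ?f = "\<lambda>r. exp (- \<alpha> * \<xi> r \<omega>)"
  have f: "cadlag ?f"
    using g by (intro cadlag_compose[of "\<lambda>r. \<xi> r \<omega>" "\<lambda>y. exp (- \<alpha> * y)"] continuous_intros)
      (simp add: good_def)
  have \<xi>0: "\<xi> 0 \<omega> = 0" using g by (simp add: good_def)
  have "(SUP s\<in>{0..1}. ennreal (?f s)) = (SUP s\<in>dyadics \<inter> {0..1}. ennreal (?f s))"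
  proof (rule SUP_cadlag_dyadics[OF f])
    fix t :: real assume t: "t \<in> {0..1}"
    show "t \<in> dyadics \<or> (\<exists>t'>t. {t..<t'} \<subseteq> {0..1})"
    proof (cases "t = 1")
      case True
      then show ?thesis by (simp add: one_dyadics)
    next
      case False
      then show ?thesis using t by (intro disjI2 exI[of _ 1]) auto
    qed
  qed auto
  also have "\<dots> = sup_exp 0 1 \<omega>" by (simp add: sup_exp_def \<xi>0)
  finally have 1: "(SUP s\<in>{0..1}. ennreal (?f s)) = sup_exp 0 1 \<omega>" .
  have "(SUP s\<in>{1..}. ennreal (?f s)) = (SUP s\<in>dyadics \<inter> {1..}. ennreal (?f s))"
  proof (rule SUP_cadlag_dyadics[OF f])
    fix t :: real assume "t \<in> {1..}"
    then show "t \<in> dyadics \<or> (\<exists>t'>t. {t..<t'} \<subseteq> {1..})"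
      by (intro disjI2 exI[of _ "t + 1"]) auto
  qed auto
  also have "\<dots> = sup_exp_tail \<omega>"
  proof (rule antisym)
    show "(SUP s\<in>dyadics \<inter> {1..}. ennreal (?f s)) \<le> sup_exp_tail \<omega>"
    proof (rule SUP_least)
      fix s assume s: "s \<in> dyadics \<inter> {1..}"
      obtain m where m: "s \<le> real m" using real_arch_simple by blast
      have "ennreal (?f s) \<le> sup_exp 1 (real (Suc m)) \<omega>"
        unfolding sup_exp_def using s m by (intro SUP_upper2[of s]) (auto simp: \<xi>0)
      also have "\<dots> \<le> sup_exp_tail \<omega>" unfolding sup_exp_tail_def by (rule SUP_upper) simp
      finally show "ennreal (?f s) \<le> sup_exp_tail \<omega>" .
    qed
    show "sup_exp_tail \<omega> \<le> (SUP s\<in>dyadics \<inter> {1..}. ennreal (?f s))"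
      unfolding sup_exp_tail_def sup_exp_def \<xi>0
      by (intro SUP_least) (auto intro!: SUP_upper)
  qed
  finally have 2: "(SUP s\<in>{1..}. ennreal (?f s)) = sup_exp_tail \<omega>" .
  show "(SUP s\<in>{0..1}. ennreal (?f s)) - (SUP s\<in>{1..}. ennreal (?f s)) = sup_exp 0 1 \<omega> - sup_exp_tail \<omega>"
    by (simp only: 1 2)
qed

lemma nn_integral_sup_exp:
  assumes "t \<in> dyadics" "0 \<le> s"
  shows "(\<integral>\<^sup>+\<omega>. sup_exp s t \<omega> \<partial>M) = ennreal (expectation (\<lambda>\<omega>. root_sup s t \<omega> powr \<alpha>))"
proof -
  have "(\<integral>\<^sup>+\<omega>. sup_exp s t \<omega> \<partial>M) = (\<integral>\<^sup>+\<omega>. ennreal (root_sup s t \<omega> powr \<alpha>) \<partial>M)"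
    unfolding root_sup_powr
    by (rule nn_integral_cong_AE, rule AE_mp[OF AE_good], intro AE_I2 impI) (simp add: sup_exp_finite[simplified])
  also have "\<dots> = ennreal (expectation (\<lambda>\<omega>. root_sup s t \<omega> powr \<alpha>))"
    by (rule nn_integral_eq_integral[OF root_sup_integrable[OF assms]]) simp
  finally show ?thesis .
qed

text \<open>If \<open>a\<close> and \<open>b\<close> are the suprema over the first and the second
  interval, the supremum over the union is their maximum, and the truncated difference
  \<open>a - b\<close> equals \<open>max a b - b\<close> for finite \<open>b\<close>; finite means
  let the expectation be split.\<close>

lemma peak_const_eq: "ennreal (peak_const m) = (\<integral>\<^sup>+\<omega>. sup_exp 0 1 \<omega> - sup_exp 1 (real (Suc m)) \<omega> \<partial>M)"
  and peak_const_nonneg: "0 \<le> peak_const m"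
proof -
  let ?t = "real (Suc m)"
  have t: "?t \<in> dyadics" by (rule of_nat_dyadics)
  have un: "sup_exp 0 ?t \<omega> = sup (sup_exp 0 1 \<omega>) (sup_exp 1 ?t \<omega>)" for \<omega>
  proof -
    have "dyadics \<inter> {0..?t} = (dyadics \<inter> {0..1}) \<union> (dyadics \<inter> {1..?t})" by auto
    then show ?thesis unfolding sup_exp_def by (simp only: SUP_union)
  qed
  have int: "expectation (\<lambda>\<omega>. root_sup 1 ?t \<omega> powr \<alpha>) \<le> expectation (\<lambda>\<omega>. root_sup 0 ?t \<omega> powr \<alpha>)"
  proof (rule integral_mono_AE[OF root_sup_integrable[OF t] root_sup_integrable[OF t]])
    show "AE \<omega> in M. root_sup 1 ?t \<omega> powr \<alpha> \<le> root_sup 0 ?t \<omega> powr \<alpha>"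
      by (rule AE_mp[OF AE_good], intro AE_I2 impI, unfold root_sup_powr,
          rule enn2real_mono[OF sup_exp_mono]) (use sup_exp_finite in auto)
  qed auto
  then show "0 \<le> peak_const m" by (simp add: peak_const_def)
  have "(\<integral>\<^sup>+\<omega>. sup_exp 0 1 \<omega> - sup_exp 1 ?t \<omega> \<partial>M) = (\<integral>\<^sup>+\<omega>. sup_exp 0 ?t \<omega> - sup_exp 1 ?t \<omega> \<partial>M)"
  proof (rule nn_integral_cong_AE, rule AE_mp[OF AE_good], intro AE_I2 impI)
    fix \<omega> assume g: "good \<omega>"
    have fin: "sup_exp 1 ?t \<omega> < \<infinity>" by (rule sup_exp_finite[OF g])
    show "sup_exp 0 1 \<omega> - sup_exp 1 ?t \<omega> = sup_exp 0 ?t \<omega> - sup_exp 1 ?t \<omega>"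
    proof (cases "sup_exp 0 1 \<omega> \<le> sup_exp 1 ?t \<omega>")
      case True
      then show ?thesis unfolding un using fin
        by (simp add: sup_absorb2 diff_eq_0_ennreal)
    next
      case False
      then show ?thesis unfolding un by (simp add: sup_absorb1)
    qed
  qed
  also have "\<dots> = (\<integral>\<^sup>+\<omega>. sup_exp 0 ?t \<omega> \<partial>M) - (\<integral>\<^sup>+\<omega>. sup_exp 1 ?t \<omega> \<partial>M)"
    by (rule nn_integral_diff) (auto simp: nn_integral_sup_exp[OF t] sup_exp_mono simp del: of_nat_Suc)
  also have "\<dots> = ennreal (peak_const m)"
    using int by (simp add: nn_integral_sup_exp[OF t] peak_const_def ennreal_minus del: of_nat_Suc)
  finally show "ennreal (peak_const m) = (\<integral>\<^sup>+\<omega>. sup_exp 0 1 \<omega> - sup_exp 1 ?t \<omega> \<partial>M)" by simp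
qed

lemma peak_const_tendsto: "peak_const \<longlonglongrightarrow> sup_decrease_mean M \<xi> \<alpha>"
proof -
  have fin: "(\<integral>\<^sup>+\<omega>. sup_exp 0 1 \<omega> \<partial>M) < \<infinity>"
    by (simp add: nn_integral_sup_exp[OF one_dyadics] ennreal_less_top)
  have le: "(\<integral>\<^sup>+\<omega>. sup_exp 0 1 \<omega> - sup_exp_tail \<omega> \<partial>M) \<le> (\<integral>\<^sup>+\<omega>. sup_exp 0 1 \<omega> \<partial>M)"
    by (rule nn_integral_mono) (rule diff_le_self_ennreal)
  have "(\<lambda>m. \<integral>\<^sup>+\<omega>. sup_exp 0 1 \<omega> - sup_exp 1 (real (Suc m)) \<omega> \<partial>M)
    \<longlonglongrightarrow> (\<integral>\<^sup>+\<omega>. sup_exp 0 1 \<omega> - sup_exp_tail \<omega> \<partial>M)"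
  proof (rule nn_integral_dominated_convergence[where w = "sup_exp 0 1"])
    show "AE \<omega> in M. sup_exp 0 1 \<omega> - sup_exp 1 (real (Suc m)) \<omega> \<le> sup_exp 0 1 \<omega>" for m
      by (rule AE_I2) (rule diff_le_self_ennreal)
    show "AE \<omega> in M. (\<lambda>m. sup_exp 0 1 \<omega> - sup_exp 1 (real (Suc m)) \<omega>) \<longlonglongrightarrow> sup_exp 0 1 \<omega> - sup_exp_tail \<omega>"
    proof (rule AE_mp[OF AE_good], intro AE_I2 impI)
      fix \<omega> assume g: "good \<omega>"
      have a: "sup_exp 0 1 \<omega> \<noteq> top" using sup_exp_finite[OF g, of 0 1] by simp
      \<comment> \<open>The suprema over growing intervals may tend to infinity, which puts the
        limit of the differences in doubt; cutting them off at the finite value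
        \<open>sup_exp 0 1 \<omega>\<close> leaves the truncated differences unchanged.\<close>
      have cut: "sup_exp 0 1 \<omega> - y = sup_exp 0 1 \<omega> - min (sup_exp 0 1 \<omega>) y" for y
        by (cases "sup_exp 0 1 \<omega> \<le> y") (use a in \<open>auto simp: min_def diff_eq_0_ennreal less_top\<close>)
      have "(\<lambda>m. sup_exp 1 (real (Suc m)) \<omega>) \<longlonglongrightarrow> sup_exp_tail \<omega>"
        unfolding sup_exp_tail_def by (rule LIMSEQ_SUP) (auto intro!: incseq_SucI sup_exp_mono)
      then have "(\<lambda>m. sup_exp 0 1 \<omega> - min (sup_exp 0 1 \<omega>) (sup_exp 1 (real (Suc m)) \<omega>))
        \<longlonglongrightarrow> sup_exp 0 1 \<omega> - min (sup_exp 0 1 \<omega>) (sup_exp_tail \<omega>)"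
        using a by (intro tendsto_diff_ennreal tendsto_min tendsto_const) (auto simp: min_def)
      then show "(\<lambda>m. sup_exp 0 1 \<omega> - sup_exp 1 (real (Suc m)) \<omega>) \<longlonglongrightarrow> sup_exp 0 1 \<omega> - sup_exp_tail \<omega>"
        unfolding cut[symmetric] .
    qed
  qed (use fin in auto)
  then have "(\<lambda>m. ennreal (peak_const m)) \<longlonglongrightarrow> (\<integral>\<^sup>+\<omega>. sup_exp 0 1 \<omega> - sup_exp_tail \<omega> \<partial>M)"
    by (simp only: peak_const_eq)
  also have "(\<integral>\<^sup>+\<omega>. sup_exp 0 1 \<omega> - sup_exp_tail \<omega> \<partial>M) = ennreal (sup_decrease_mean M \<xi> \<alpha>)"
    unfolding sup_decrease_mean_dyadic using le fin by (simp add: le_less_trans less_top)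
  finally show ?thesis
    using peak_const_nonneg by (simp add: sup_decrease_mean_def)
qed

text \<open>
  By equality in Cauchy--Schwarz, \<open>E exp (- \<alpha> \<xi>\<^sub>1 / 2) = 1 = E exp (- \<alpha> \<xi>\<^sub>1)\<close> forces \<open>\<xi> = 0\<close>.
\<close>

lemma half_moment_le: "exp_mom (\<alpha> / 2) 1 \<le> 1"
  and half_moment_degenerate:
    "exp_mom (\<alpha> / 2) 1 = 1 \<Longrightarrow> t \<in> dyadics \<Longrightarrow> AE \<omega> in M. \<xi> t \<omega> = 0"
proof -
  define Y where "Y t \<omega> = exp (- (\<alpha> / 2) * \<xi> t \<omega>)" for t \<omega>
  have sq: "(Y t \<omega>)\<^sup>2 = exp (- \<alpha> * \<xi> t \<omega>)" for t \<omega>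
    unfolding Y_def by (simp flip: exp_double)
  \<comment> \<open>The identity \<open>Y\<^sup>2 + 1 = 2 * Y + (Y - 1)\<^sup>2\<close> under the
    integral, arranged without subtraction of moments since these live in \<open>ennreal\<close>. It
    gives both the bound and the equality case.\<close>
  have id: "exp_mom \<alpha> t + 1 = 2 * exp_mom (\<alpha> / 2) t + (\<integral>\<^sup>+\<omega>. ennreal ((Y t \<omega> - 1)\<^sup>2) \<partial>M)"
    if t: "t \<in> dyadics" for t
  proof -
    have [measurable]: "\<xi> t \<in> borel_measurable M" using t by (rule \<xi>_dyadic)
    have [measurable]: "Y t \<in> borel_measurable M" unfolding Y_def[abs_def] by measurable
    have "exp_mom \<alpha> t + 1 = (\<integral>\<^sup>+\<omega>. ennreal (exp (- \<alpha> * \<xi> t \<omega>)) + 1 \<partial>M)"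
      unfolding exp_mom_def by (subst nn_integral_add) (auto simp: emeasure_space_1)
    also have "\<dots> = (\<integral>\<^sup>+\<omega>. 2 * ennreal (Y t \<omega>) + ennreal ((Y t \<omega> - 1)\<^sup>2) \<partial>M)"
    proof (rule nn_integral_cong)
      fix \<omega>
      have pos: "0 \<le> Y t \<omega>" by (simp add: Y_def)
      have "ennreal (exp (- \<alpha> * \<xi> t \<omega>)) + 1 = ennreal ((Y t \<omega>)\<^sup>2 + 1)"
        by (subst ennreal_plus) (auto simp: sq)
      also have "\<dots> = ennreal (2 * Y t \<omega> + (Y t \<omega> - 1)\<^sup>2)"
        by (rule arg_cong[where f = ennreal]) (simp add: power2_eq_square algebra_simps)
      also have "\<dots> = 2 * ennreal (Y t \<omega>) + ennreal ((Y t \<omega> - 1)\<^sup>2)"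
        using pos by (simp add: ennreal_mult)
      finally show "ennreal (exp (- \<alpha> * \<xi> t \<omega>)) + 1 = 2 * ennreal (Y t \<omega>) + ennreal ((Y t \<omega> - 1)\<^sup>2)" .
    qed
    also have "\<dots> = 2 * exp_mom (\<alpha> / 2) t + (\<integral>\<^sup>+\<omega>. ennreal ((Y t \<omega> - 1)\<^sup>2) \<partial>M)"
      by (subst nn_integral_add) (auto simp: nn_integral_cmult exp_mom_def Y_def)
    finally show ?thesis .
  qed
  have \<alpha>1: "exp_mom \<alpha> 1 = 1" using exp_moment by (simp add: exp_mom_def)
  have "2 * exp_mom (\<alpha> / 2) 1 \<le> 2 * 1"
    using id[OF one_dyadics] \<alpha>1 by (metis add_increasing2 le_iff_add mult.right_neutral one_add_one zero_le)
  then show "exp_mom (\<alpha> / 2) 1 \<le> 1"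
    by (cases "exp_mom (\<alpha> / 2) 1") (auto simp: ennreal_mult_top top_unique simp flip: ennreal_numeral ennreal_mult ennreal_1)
  \<comment> \<open>From time 1 to all dyadic times: a power of the moment at
    \<open>1 / 2 ^ n\<close> is the moment at time 1, hence it is 1, and its other powers give the
    rest.\<close>
  have one: "exp_mom c t = 1" if c: "exp_mom c 1 = 1" and t: "t \<in> dyadics" for c t
  proof -
    obtain i n where t: "t = real i / 2 ^ n" using t by (auto simp: dyadics_def)
    have d: "1 / 2 ^ n \<in> dyadics" using dyadicsI[of 1 n] by simp
    have "exp_mom c (1 / 2 ^ n) ^ (2 ^ n) = 1"
      using exp_mom_multiple(2)[OF d, of c "2 ^ n"] c by simp
    then have "exp_mom c (1 / 2 ^ n) = 1" by (rule ennreal_power_eq_1_imp) simp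
    then show ?thesis using exp_mom_multiple(2)[OF d, of c i] by (simp add: t)
  qed
  assume c: "exp_mom (\<alpha> / 2) 1 = 1" and t: "t \<in> dyadics"
  have [measurable]: "\<xi> t \<in> borel_measurable M" using t by (rule \<xi>_dyadic)
  have [measurable]: "Y t \<in> borel_measurable M" unfolding Y_def[abs_def] by measurable
  have "2 + 0 = 2 + (\<integral>\<^sup>+\<omega>. ennreal ((Y t \<omega> - 1)\<^sup>2) \<partial>M)"
    using id[OF t] one[OF c t] one[OF \<alpha>1 t] by (simp add: one_add_one)
  then have "(\<integral>\<^sup>+\<omega>. ennreal ((Y t \<omega> - 1)\<^sup>2) \<partial>M) = 0"
    by (metis ennreal_add_left_cancel ennreal_numeral ennreal_neq_top infinity_ennreal_def)
  then have "AE \<omega> in M. ennreal ((Y t \<omega> - 1)\<^sup>2) = 0"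
    by (subst (asm) nn_integral_0_iff_AE) auto
  then show "AE \<omega> in M. \<xi> t \<omega> = 0"
    by (rule AE_mp, intro AE_I2 impI) (use \<alpha>_pos in \<open>auto simp: Y_def\<close>)
qed

lemma sup_decrease_mean_degenerate:
  assumes "exp_mom (\<alpha> / 2) 1 = 1" shows "sup_decrease_mean M \<xi> \<alpha> = 0"
proof -
  have "AE \<omega> in M. \<forall>t\<in>dyadics. \<xi> t \<omega> = 0"
    by (intro AE_ball_countable' countable_dyadics half_moment_degenerate assms)
  then have "(\<integral>\<^sup>+\<omega>. sup_exp 0 1 \<omega> - sup_exp_tail \<omega> \<partial>M) = (\<integral>\<^sup>+\<omega>. 0 \<partial>M)"
  proof (intro nn_integral_cong_AE, rule AE_mp, intro AE_I2 impI)
    fix \<omega> assume z: "\<forall>t\<in>dyadics. \<xi> t \<omega> = 0"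
    have "sup_exp 0 1 \<omega> \<le> 1"
      unfolding sup_exp_def by (rule SUP_least) (use z zero_dyadics in auto)
    also have "1 \<le> sup_exp 1 (real (Suc 0)) \<omega>"
      unfolding sup_exp_def by (rule SUP_upper2[of 1]) (use z zero_dyadics one_dyadics in auto)
    also have "\<dots> \<le> sup_exp_tail \<omega>"
      unfolding sup_exp_tail_def by (rule SUP_upper) simp
    finally have "sup_exp 0 1 \<omega> \<le> sup_exp_tail \<omega>" .
    moreover have "sup_exp 0 1 \<omega> < top"
      using \<open>sup_exp 0 1 \<omega> \<le> 1\<close> by (rule le_less_trans) simp
    ultimately show "sup_exp 0 1 \<omega> - sup_exp_tail \<omega> = 0" by (simp add: diff_eq_0_ennreal)
  qed
  then show ?thesis by (simp add: sup_decrease_mean_dyadic)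
qed

text \<open>Tail asymptotics in \<open>u\<close> are read along the sequence \<open>u n\<close>,
  where \<open>u n powr (- \<alpha>)\<close> plays the part of \<open>v n\<close> in
  \<open>block_sum_limit\<close>; the dichotomy there is decided by whether the moment of order
  \<open>\<alpha> / 2\<close> lies below 1 or equals 1.\<close>

lemma block_tail:
  assumes u: "\<And>n. 0 < u n" "filterlim u at_top sequentially"
    and \<kappa>: "(\<lambda>n. real n * u n powr (- \<alpha>)) \<longlonglongrightarrow> \<kappa>"
    and N: "filterlim N at_top sequentially" "(\<lambda>n. real (N n) / real n) \<longlonglongrightarrow> 0"
  shows "(\<lambda>n. real n / real (N n) * prob (exceed 0 (real (N n)) (u n)))
    \<longlonglongrightarrow> \<kappa> * (C * sup_decrease_mean M \<xi> \<alpha>)"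
proof -
  have transfer: "(\<lambda>n. real n * f (u n)) \<longlonglongrightarrow> \<kappa> * l"
    if "((\<lambda>u. u powr \<alpha> * f u) \<longlongrightarrow> l) at_top" for f l
  proof -
    have "(\<lambda>n. (real n * u n powr (- \<alpha>)) * (u n powr \<alpha> * f (u n))) \<longlonglongrightarrow> \<kappa> * l"
      by (intro tendsto_mult \<kappa> filterlim_compose[OF that u(2)])
    moreover have "(real n * u n powr (- \<alpha>)) * (u n powr \<alpha> * f (u n)) = real n * f (u n)" for n
      using u(1)[of n] by (simp add: powr_minus field_simps)
    ultimately show ?thesis by simp
  qed
  obtain q where q: "exp_mom (\<alpha> / 2) 1 = ennreal q" "0 \<le> q"
    using half_moment_le by (cases "exp_mom (\<alpha> / 2) 1") (auto simp: top_unique)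
  have limit: ?thesis
    if ac: "C * sup_decrease_mean M \<xi> \<alpha> = 0 \<or> (\<forall>m M n. m \<le> M \<longrightarrow>
      prob (peak (Suc m) (u n)) - prob (peak (Suc M) (u n))
        \<le> c * q' ^ m * u n powr (- \<alpha>) + c' * real M * (u n powr (- \<alpha>))\<^sup>2)"
      and q': "0 \<le> q'" "q' < 1" for c c' q'
    unfolding prob_exceed_sum
  proof (rule block_sum_limit[where \<theta> = "\<lambda>m. C * peak_const m" and v = "\<lambda>n. u n powr (- \<alpha>)"
        and q = q' and c = c and c' = c' and \<kappa>' = "\<kappa> * C"])
    show "(\<lambda>n. real n * prob (peak (Suc m) (u n))) \<longlonglongrightarrow> \<kappa> * (C * peak_const m)" for m
      by (rule transfer[OF peak_tail])
    show "(\<lambda>n. real n * prob {\<omega> \<in> space M. u n < V 0 \<omega>}) \<longlonglongrightarrow> \<kappa> * C"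
      by (rule transfer[OF V0_tail])
    show "prob (peak (Suc m') (u n)) \<le> prob (peak (Suc m) (u n))" if "m \<le> m'" for m m' n
      using that exceed_subset[of 1 1 "real (Suc m)" "real (Suc m')" "u n"]
      by (intro finite_measure_mono) auto
  qed (use ac q' \<kappa> N in \<open>auto intro!: tendsto_mult peak_const_tendsto\<close>)
  show ?thesis
  proof (cases "q < 1")
    case True
    obtain c c' where "\<And>m N u. m \<le> N \<Longrightarrow> 0 < u \<Longrightarrow>
      prob (peak (Suc m) u) - prob (peak (Suc N) u)
        \<le> c * q ^ m * u powr (- \<alpha>) + c' * real N * (u powr (- \<alpha>))\<^sup>2"
      using anticluster[OF q True] by blast
    with True q(2) u(1) show ?thesis by (intro limit[of c q c']) auto
  next
    case False
    then have "exp_mom (\<alpha> / 2) 1 = 1"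
      using half_moment_le q by (simp add: ennreal_le_1)
    then have "sup_decrease_mean M \<xi> \<alpha> = 0" by (rule sup_decrease_mean_degenerate)
    then show ?thesis by (intro limit[of 0 0 0]) auto
  qed
qed

end

section \<open>Maxima over long intervals\<close>

text \<open>Squeezed between exponentials by \<open>1 - p \<le> exp (- p)\<close> and
  \<open>1 - p \<ge> exp (- (p / (1 - p)))\<close>; the latter comes from
  \<open>1 / (1 - p) = 1 + p / (1 - p)\<close> and the tangent bound for the exponential.\<close>

lemma power_one_minus_tendsto:
  fixes p :: "nat \<Rightarrow> real" and k :: "nat \<Rightarrow> nat"
  assumes p: "\<And>n. 0 \<le> p n" "p \<longlonglongrightarrow> 0" and lim: "(\<lambda>n. real (k n) * p n) \<longlonglongrightarrow> c"
  shows "(\<lambda>n. (1 - p n) ^ k n) \<longlonglongrightarrow> exp (- c)"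
proof (rule tendsto_sandwich)
  have lt: "\<forall>\<^sub>F n in sequentially. p n < 1" using p(2) by (rule order_tendstoD) simp
  show "\<forall>\<^sub>F n in sequentially. (1 - p n) ^ k n \<le> exp (- (real (k n) * p n))"
    using lt
  proof eventually_elim
    case (elim n)
    have "1 - p n \<le> exp (- p n)" using exp_ge_add_one_self[of "- p n"] by simp
    then have "(1 - p n) ^ k n \<le> exp (- p n) ^ k n" using elim by (intro power_mono) auto
    then show ?case by (simp flip: exp_of_nat_mult)
  qed
  show "\<forall>\<^sub>F n in sequentially. exp (- (real (k n) * p n / (1 - p n))) \<le> (1 - p n) ^ k n"
    using lt
  proof eventually_elim
    case (elim n)
    have "1 / (1 - p n) = 1 + p n / (1 - p n)" using elim by (simp add: field_simps)
    also have "\<dots> \<le> exp (p n / (1 - p n))" by (rule exp_ge_add_one_self)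
    finally have "exp (- (p n / (1 - p n))) \<le> 1 - p n"
      using elim by (simp add: exp_minus field_simps)
    then have "exp (- (p n / (1 - p n))) ^ k n \<le> (1 - p n) ^ k n" by (intro power_mono) auto
    then show ?case by (simp flip: exp_of_nat_mult)
  qed
  show "(\<lambda>n. exp (- (real (k n) * p n))) \<longlonglongrightarrow> exp (- c)" by (intro tendsto_intros lim)
  have "(\<lambda>n. exp (- (real (k n) * p n / (1 - p n)))) \<longlonglongrightarrow> exp (- (c / (1 - 0)))"
    by (intro tendsto_intros lim p) auto
  then show "(\<lambda>n. exp (- (real (k n) * p n / (1 - p n)))) \<longlonglongrightarrow> exp (- c)" by simp
qed

text \<open>The sum is 0 off the union of the events and at least \<open>K\<close> on it, so the
  exponential lies between the indicator of the complement and that indicator plus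
  \<open>exp (- K)\<close> on the union.\<close>

lemma (in prob_space) expectation_exp_count_bounds:
  assumes J: "finite J" and E: "\<And>j. j \<in> J \<Longrightarrow> E j \<in> events" and K: "0 \<le> (K::real)"
    and g: "\<And>j \<omega>. j \<in> J \<Longrightarrow> \<omega> \<in> space M \<Longrightarrow> g j \<omega> = K * indicator (E j) \<omega>"
  shows "1 - prob (\<Union>j\<in>J. E j) \<le> expectation (\<lambda>\<omega>. exp (- (\<Sum>j\<in>J. g j \<omega>)))"
    and "expectation (\<lambda>\<omega>. exp (- (\<Sum>j\<in>J. g j \<omega>))) \<le> 1 - (1 - exp (- K)) * prob (\<Union>j\<in>J. E j)"
proof -
  let ?A = "\<Union>j\<in>J. E j"
  define s where "s \<omega> = (\<Sum>j\<in>J. K * indicator (E j) \<omega>)" for \<omega>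
  have [measurable]: "?A \<in> events" using J E by auto
  have s_nonneg: "0 \<le> s \<omega>" for \<omega> unfolding s_def using K by (intro sum_nonneg) auto
  have s0: "s \<omega> = 0" if "\<omega> \<notin> ?A" for \<omega> using that by (simp add: s_def)
  have sK: "K \<le> s \<omega>" if "\<omega> \<in> ?A" for \<omega>
  proof -
    from that obtain j where j: "j \<in> J" "\<omega> \<in> E j" by blast
    then have "K = K * indicator (E j) \<omega>" by simp
    also have "\<dots> \<le> s \<omega>" unfolding s_def using J j K by (intro member_le_sum) auto
    finally show ?thesis .
  qed
  have [measurable]: "s \<in> borel_measurable M"
    unfolding s_def[abs_def] using E by (intro borel_measurable_sum borel_measurable_times) auto
  have int: "integrable M (\<lambda>\<omega>. exp (- s \<omega>))"
    by (rule integrable_const_bound[where B = 1]) (use s_nonneg in auto)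
  have eq: "expectation (\<lambda>\<omega>. exp (- (\<Sum>j\<in>J. g j \<omega>))) = expectation (\<lambda>\<omega>. exp (- s \<omega>))"
    unfolding s_def by (intro Bochner_Integration.integral_cong refl arg_cong[where f = exp] arg_cong[where f = uminus] sum.cong g)
  have ind: "integrable M (indicator ?A :: 'a \<Rightarrow> real)"
    by (intro integrable_real_indicator) (auto simp: emeasure_eq_measure ennreal_less_top)
  have int': "integrable M (\<lambda>\<omega>. 1 - c * indicator ?A \<omega> :: real)" for c
    using ind by (intro Bochner_Integration.integrable_diff integrable_mult_right) auto
  have "expectation (\<lambda>\<omega>. 1 - indicator ?A \<omega>) \<le> expectation (\<lambda>\<omega>. exp (- s \<omega>))"
  proof (rule integral_mono[OF _ int])
    show "integrable M (\<lambda>\<omega>. 1 - indicator ?A \<omega> :: real)" using int'[of 1] by simp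
    show "1 - indicator ?A \<omega> \<le> exp (- s \<omega>)" for \<omega>
      by (cases "\<omega> \<in> ?A") (simp_all add: s0)
  qed
  moreover have "expectation (\<lambda>\<omega>. 1 - indicator ?A \<omega>) = 1 - prob ?A"
    using ind by (simp add: prob_space)
  ultimately show "1 - prob ?A \<le> expectation (\<lambda>\<omega>. exp (- (\<Sum>j\<in>J. g j \<omega>)))" by (simp add: eq)
  have "expectation (\<lambda>\<omega>. exp (- s \<omega>)) \<le> expectation (\<lambda>\<omega>. 1 - (1 - exp (- K)) * indicator ?A \<omega>)"
  proof (rule integral_mono[OF int int'])
    show "exp (- s \<omega>) \<le> 1 - (1 - exp (- K)) * indicator ?A \<omega>" for \<omega>
      using sK[of \<omega>] s0[of \<omega>] by (cases "\<omega> \<in> ?A") simp_all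
  qed
  moreover have "expectation (\<lambda>\<omega>. 1 - (1 - exp (- K)) * indicator ?A \<omega>) = 1 - (1 - exp (- K)) * prob ?A"
    using ind by (simp add: prob_space)
  ultimately show "expectation (\<lambda>\<omega>. exp (- (\<Sum>j\<in>J. g j \<omega>))) \<le> 1 - (1 - exp (- K)) * prob ?A"
    by (simp add: eq)
qed

lemma step_fun_threshold:
  assumes "0 \<le> K" "0 < y"
  shows "step_fun (\<lambda>z. K * indicator {ereal y<..} z)"
  unfolding step_fun_def
proof (intro conjI)
  show "\<exists>(m::nat) c J. (\<forall>i<m. \<forall>x\<in>J i. \<forall>y\<in>J i. {x..y} \<subseteq> J i) \<and>
      (\<forall>z. K * indicator {ereal y<..} z = (\<Sum>i<m. c i * indicator (J i) z))"
    by (rule exI[of _ "1::nat"], rule exI[of _ "\<lambda>_. K"], rule exI[of _ "\<lambda>_. {ereal y<..}"])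
      (auto intro: less_le_trans)
  show "\<forall>z. 0 \<le> K * indicator {ereal y<..} z" using assms by simp
  show "\<exists>\<epsilon>>0. \<forall>z. \<bar>z\<bar> \<le> ereal \<epsilon> \<longrightarrow> K * indicator {ereal y<..} z = 0"
  \<comment> \<open>The interval is open at \<open>y\<close>, so \<open>y\<close> itself is an
    admissible margin around 0.\<close>
  proof (intro exI[of _ y] conjI allI impI)
    fix z :: ereal assume "\<bar>z\<bar> \<le> ereal y"
    then have "z \<le> ereal y" by (cases z) auto
    then show "K * indicator {ereal y<..} z = 0" by (simp add: indicator_def not_less)
  qed (rule assms)
qed

section \<open>Continuous time, norming constants and blocks of length h\<close>

locale gou_extremes = gou_tail M \<xi> \<eta> L V \<alpha> C
  for M :: "'a measure" and \<xi> \<eta> L V :: "real \<Rightarrow> 'a \<Rightarrow> real" and \<alpha> C :: real +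
  fixes a :: "nat \<Rightarrow> real" and h :: real
  assumes a_pos: "\<And>n. 0 < a n"
    and a_top: "filterlim a at_top sequentially"
    and a_norm: "\<And>y. 0 < y \<Longrightarrow> (\<lambda>n. real n * prob {\<omega> \<in> space M. V 0 \<omega> > a n * y}) \<longlonglongrightarrow> y powr (- \<alpha>)"
    and h_pos: "0 < h"
    and asymp: "asymp_indep M (\<lambda>k \<omega>. SUP t\<in>{(real k - 1) * h..real k * h}. V t \<omega>) a"
begin

definition exceed_all :: "real \<Rightarrow> real \<Rightarrow> real \<Rightarrow> 'a set" where
  "exceed_all s t y = {\<omega> \<in> space M. \<exists>r\<in>{s..t}. y < V r \<omega>}"

text \<open>Right-continuity moves an exceedance at \<open>r < t\<close> to a dyadic time before
  \<open>t\<close>. Nothing lies to the right of \<open>t\<close> inside the interval, so the end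
  point is kept as a separate event. All paths of \<open>V\<close> are cadlag, so no null set is
  involved.\<close>

lemma exceed_all_eq:
  assumes "0 \<le> s" "s \<le> t"
  shows "exceed_all s t y = exceed s t y \<union> {\<omega> \<in> space M. y < V t \<omega>}"
proof
  show "exceed s t y \<union> {\<omega> \<in> space M. y < V t \<omega>} \<subseteq> exceed_all s t y"
    using assms by (auto simp: exceed_all_def exceed_def)
  show "exceed_all s t y \<subseteq> exceed s t y \<union> {\<omega> \<in> space M. y < V t \<omega>}"
  proof
    fix \<omega> assume "\<omega> \<in> exceed_all s t y"
    then obtain r where r: "\<omega> \<in> space M" "s \<le> r" "r \<le> t" "y < V r \<omega>" by (auto simp: exceed_all_def)
    show "\<omega> \<in> exceed s t y \<union> {\<omega> \<in> space M. y < V t \<omega>}"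
    proof (cases "r = t")
      case False
      have "0 \<le> r" "r < t" using r assms False by auto
      from cadlag_dyadic_exceeds[OF V_cadlag[OF r(1)] this r(4)]
      obtain r' where "r' \<in> dyadics" "r < r'" "r' < t" "y < V r' \<omega>" .
      with r have "\<omega> \<in> exceed s t y" by (auto simp: exceed_def)
      then show ?thesis by simp
    qed (use r in auto)
  qed
qed

lemma exceed_all_events: "0 \<le> s \<Longrightarrow> s \<le> t \<Longrightarrow> exceed_all s t y \<in> events"
proof -
  assume st: "0 \<le> s" "s \<le> t"
  then have [measurable]: "V t \<in> borel_measurable M" by (intro V_measurable) auto
  show ?thesis unfolding exceed_all_eq[OF st] by measurable
qed

lemma exceed_all_mono: "t \<le> t' \<Longrightarrow> y' \<le> y \<Longrightarrow> exceed_all s t y \<subseteq> exceed_all s t' y'"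
  unfolding exceed_all_def by (auto intro: le_less_trans bexI[rotated])

lemma exceed_all_nat: "exceed_all 0 (real N) y = exceed 0 (real N) y"
  unfolding exceed_all_eq[OF order_refl of_nat_0_le_iff]
  using of_nat_dyadics[of N] by (auto simp: exceed_def)

lemma less_SUP_V_iff:
  assumes "\<omega> \<in> space M" "0 \<le> s" "s \<le> t"
  shows "y < (SUP r\<in>{s..t}. V r \<omega>) \<longleftrightarrow> (\<exists>r\<in>{s..t}. y < V r \<omega>)"
proof (rule less_cSUP_iff)
  obtain K where "\<And>r. 0 \<le> r \<Longrightarrow> r \<le> t \<Longrightarrow> \<bar>V r \<omega>\<bar> \<le> K"
    using cadlag_bounded[OF V_cadlag[OF assms(1)]] by blast
  then show "bdd_above ((\<lambda>r. V r \<omega>) ` {s..t})"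
    using assms by (intro bdd_aboveI2[of _ _ K]) (force simp: abs_le_iff)
qed (use assms in auto)

text \<open>The tail of \<open>V 0\<close> at \<open>y * a n\<close> is known in two ways, from the
  norming of \<open>a\<close> and from the constant \<open>C\<close>; the quotient isolates
  \<open>n * (y * a n) powr (- \<alpha>)\<close>.\<close>

lemma a_powr_limit:
  assumes y: "0 < y"
  shows "(\<lambda>n. real n * (y * a n) powr (- \<alpha>)) \<longlonglongrightarrow> y powr (- \<alpha>) / C"
proof -
  have top: "filterlim (\<lambda>n. y * a n) at_top sequentially"
    using filterlim_tendsto_pos_mult_at_top[OF tendsto_const[of y] y a_top] .
  let ?F = "\<lambda>n. prob {\<omega> \<in> space M. V 0 \<omega> > y * a n}"
  have F: "(\<lambda>n. (y * a n) powr \<alpha> * ?F n) \<longlonglongrightarrow> C"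
    using filterlim_compose[OF V0_tail top] .
  have "(\<lambda>n. (real n * ?F n) / ((y * a n) powr \<alpha> * ?F n)) \<longlonglongrightarrow> y powr (- \<alpha>) / C"
    using a_norm[OF y] C_pos by (intro tendsto_divide F) (auto simp: mult.commute)
  moreover have "\<forall>\<^sub>F n in sequentially. (real n * ?F n) / ((y * a n) powr \<alpha> * ?F n) = real n * (y * a n) powr (- \<alpha>)"
    using order_tendstoD(1)[OF F C_pos]
  proof eventually_elim
    case (elim n)
    then have "?F n \<noteq> 0" by auto
    then show ?case by (simp add: powr_minus divide_inverse)
  qed
  ultimately show ?thesis by (rule Lim_transform_eventually)
qed

text \<open>As \<open>n * a n powr (- \<alpha>)\<close> has a positive limit, it has the same limit
  along \<open>j\<close>; the quotient of the two expresses the ratio through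
  \<open>n / j n\<close>, and the root of order \<alpha> remains to be taken.\<close>

lemma a_ratio_limit:
  assumes j: "filterlim j at_top sequentially" "(\<lambda>n. real n / real (j n)) \<longlonglongrightarrow> h"
  shows "(\<lambda>n. a n / a (j n)) \<longlonglongrightarrow> h powr (1 / \<alpha>)"
proof -
  have 1: "(\<lambda>n. real n * a n powr (- \<alpha>)) \<longlonglongrightarrow> 1 / C"
    using a_powr_limit[of 1] by simp
  have 2: "(\<lambda>n. real (j n) * a (j n) powr (- \<alpha>)) \<longlonglongrightarrow> 1 / C"
    using filterlim_compose[OF 1 j(1)] .
  have "(\<lambda>n. ((real (j n) * a (j n) powr (- \<alpha>)) / (real n * a n powr (- \<alpha>)) * (real n / real (j n))) powr (1 / \<alpha>))
    \<longlonglongrightarrow> ((1 / C) / (1 / C) * h) powr (1 / \<alpha>)"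
    using C_pos h_pos by (intro tendsto_powr tendsto_mult tendsto_divide 1 2 j tendsto_const) auto
  moreover have "\<forall>\<^sub>F n in sequentially.
    ((real (j n) * a (j n) powr (- \<alpha>)) / (real n * a n powr (- \<alpha>)) * (real n / real (j n))) powr (1 / \<alpha>) = a n / a (j n)"
    using eventually_gt_at_top[of 0] filterlim_at_top_dense[THEN iffD1, OF filterlim_compose[OF filterlim_real_sequentially j(1)], rule_format, of 0]
  proof eventually_elim
    case (elim n)
    have "(real (j n) * a (j n) powr (- \<alpha>)) / (real n * a n powr (- \<alpha>)) * (real n / real (j n))
      = (a n / a (j n)) powr \<alpha>"
      using elim a_pos[of n] a_pos[of "j n"] by (simp add: powr_divide powr_minus field_simps)
    then show ?case using \<alpha>_pos a_pos[of n] a_pos[of "j n"] by (simp add: powr_powr)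
  qed
  ultimately show ?thesis using C_pos by (simp add: Lim_transform_eventually)
qed

lemma block_exceedance_limit:
  assumes y: "0 < y" and r: "\<And>n. 0 < r n" "filterlim r at_top sequentially" "(\<lambda>n. real (r n) / real n) \<longlonglongrightarrow> 0"
  shows "(\<lambda>n. real n / real (r n) * prob (exceed_all 0 (real (r n) * h) (y * a n)))
    \<longlonglongrightarrow> h * (sup_decrease_mean M \<xi> \<alpha> * y powr (- \<alpha>))"
proof -
  let ?l = "sup_decrease_mean M \<xi> \<alpha> * y powr (- \<alpha>)"
  \<comment> \<open>The block of length \<open>r n * h\<close> is enclosed between the integer times
    \<open>N n\<close> and \<open>Suc (N n)\<close>, for which \<open>block_tail\<close> is
    available; divided by \<open>r n\<close>, both tend to \<open>h\<close>.\<close>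
  define N where "N n = nat \<lfloor>real (r n) * h\<rfloor>" for n
  have N_bounds: "real (N n) \<le> real (r n) * h" "real (r n) * h \<le> real (Suc (N n))" for n
  proof -
    have "0 \<le> real (r n) * h" using h_pos by simp
    then show "real (N n) \<le> real (r n) * h" "real (r n) * h \<le> real (Suc (N n))"
      unfolding N_def by linarith+
  qed
  have rh: "filterlim (\<lambda>n. real (r n) * h) at_top sequentially"
    using filterlim_tendsto_pos_mult_at_top[OF tendsto_const[of h] h_pos filterlim_compose[OF filterlim_real_sequentially r(2)]]
    by (simp add: mult.commute)
  have N_top: "filterlim N at_top sequentially"
    unfolding N_def using rh
    by (intro filterlim_compose[OF filterlim_nat_sequentially] filterlim_compose[OF filterlim_floor_sequentially])
  have SN_top: "filterlim (\<lambda>n. Suc (N n)) at_top sequentially"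
    by (rule filterlim_compose[OF filterlim_Suc N_top])
  have r_inv: "(\<lambda>n. inverse (real (r n))) \<longlonglongrightarrow> 0"
    by (intro tendsto_inverse_0_at_top filterlim_compose[OF filterlim_real_sequentially r(2)])
  have "(\<lambda>n. h - inverse (real (r n))) \<longlonglongrightarrow> h - 0" "(\<lambda>n. h + inverse (real (r n))) \<longlonglongrightarrow> h + 0"
    by (intro tendsto_intros r_inv)+
  then have hr: "(\<lambda>n. h - inverse (real (r n))) \<longlonglongrightarrow> h" "(\<lambda>n. h + inverse (real (r n))) \<longlonglongrightarrow> h" by simp_all
  have rpos: "0 < real (r n)" for n using r(1) by simp
  have lower: "h \<le> real (Suc (N n)) / real (r n)" and upper: "real (N n) / real (r n) \<le> h"
    and Suc_eq: "real (Suc (N n)) / real (r n) = real (N n) / real (r n) + inverse (real (r n))" for n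
  proof -
    show "h \<le> real (Suc (N n)) / real (r n)"
      using N_bounds(2)[of n] rpos[of n] by (simp add: pos_le_divide_eq mult.commute del: of_nat_Suc)
    show "real (N n) / real (r n) \<le> h"
      using N_bounds(1)[of n] rpos[of n] by (simp add: pos_divide_le_eq mult.commute)
    show "real (Suc (N n)) / real (r n) = real (N n) / real (r n) + inverse (real (r n))"
      by (simp add: add_divide_distrib inverse_eq_divide)
  qed
  have Nr: "(\<lambda>n. real (N n) / real (r n)) \<longlonglongrightarrow> h"
  proof (rule tendsto_sandwich[OF _ _ hr(1) tendsto_const])
    show "\<forall>\<^sub>F n in sequentially. h - inverse (real (r n)) \<le> real (N n) / real (r n)"
    proof (intro always_eventually allI)
      fix n show "h - inverse (real (r n)) \<le> real (N n) / real (r n)" using lower[of n] upper[of n] Suc_eq[of n] by linarith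
    qed
    show "\<forall>\<^sub>F n in sequentially. real (N n) / real (r n) \<le> h"
    proof (intro always_eventually allI)
      fix n show "real (N n) / real (r n) \<le> h" using lower[of n] upper[of n] Suc_eq[of n] by linarith
    qed
  qed
  have SNr: "(\<lambda>n. real (Suc (N n)) / real (r n)) \<longlonglongrightarrow> h"
  proof (rule tendsto_sandwich[OF _ _ tendsto_const hr(2)])
    show "\<forall>\<^sub>F n in sequentially. h \<le> real (Suc (N n)) / real (r n)"
    proof (intro always_eventually allI)
      fix n show "h \<le> real (Suc (N n)) / real (r n)" using lower[of n] upper[of n] Suc_eq[of n] by linarith
    qed
    show "\<forall>\<^sub>F n in sequentially. real (Suc (N n)) / real (r n) \<le> h + inverse (real (r n))"
    proof (intro always_eventually allI)
      fix n show "real (Suc (N n)) / real (r n) \<le> h + inverse (real (r n))" using lower[of n] upper[of n] Suc_eq[of n] by linarith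
    qed
  qed
  have block: "(\<lambda>n. real n / real (r n) * prob (exceed 0 (real (K n)) (y * a n))) \<longlonglongrightarrow> h * ?l"
    if K: "filterlim K at_top sequentially" "(\<lambda>n. real (K n) / real (r n)) \<longlonglongrightarrow> h" for K :: "nat \<Rightarrow> nat"
  proof -
    have "(\<lambda>n. real (K n) / real (r n) * (real (r n) / real n)) \<longlonglongrightarrow> h * 0"
      by (intro tendsto_mult K r)
    moreover have "(\<lambda>n. real (K n) / real (r n) * (real (r n) / real n)) = (\<lambda>n. real (K n) / real n)"
      using less_imp_neq[OF rpos] by (intro ext) (simp add: eq_commute[of 0])
    ultimately have Kn: "(\<lambda>n. real (K n) / real n) \<longlonglongrightarrow> 0" by (simp only: mult_zero_right)
    have "(\<lambda>n. real n / real (K n) * prob (exceed 0 (real (K n)) (y * a n)))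
      \<longlonglongrightarrow> y powr (- \<alpha>) / C * (C * sup_decrease_mean M \<xi> \<alpha>)"
      using y a_pos by (intro block_tail a_powr_limit K Kn
          filterlim_tendsto_pos_mult_at_top[OF tendsto_const[of y] y a_top]) auto
    also have "y powr (- \<alpha>) / C * (C * sup_decrease_mean M \<xi> \<alpha>) = ?l" using C_pos by simp
    finally have "(\<lambda>n. real n / real (K n) * prob (exceed 0 (real (K n)) (y * a n))) \<longlonglongrightarrow> ?l" .
    from tendsto_mult[OF K(2) this]
    have "(\<lambda>n. real (K n) / real (r n) * (real n / real (K n) * prob (exceed 0 (real (K n)) (y * a n))))
      \<longlonglongrightarrow> h * ?l" .
    moreover have "\<forall>\<^sub>F n in sequentially.
      real (K n) / real (r n) * (real n / real (K n) * prob (exceed 0 (real (K n)) (y * a n)))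
        = real n / real (r n) * prob (exceed 0 (real (K n)) (y * a n))"
      using filterlim_at_top_dense[THEN iffD1, OF filterlim_compose[OF filterlim_real_sequentially K(1)], rule_format, of 0]
    proof eventually_elim
      case (elim n)
      then show ?case using rpos[of n] by (simp add: field_simps)
    qed
    ultimately show ?thesis by (rule Lim_transform_eventually)
  qed
  show ?thesis
  proof (rule tendsto_sandwich[OF _ _ block[OF N_top Nr] block[OF SN_top SNr]])
    have rh0: "0 \<le> real (r n) * h" for n using h_pos by simp
    have "prob (exceed 0 (real (N n)) (y * a n)) \<le> prob (exceed_all 0 (real (r n) * h) (y * a n))" for n
      unfolding exceed_all_nat[symmetric]
      by (intro finite_measure_mono exceed_all_mono exceed_all_events N_bounds rh0 order_refl)
    then show "\<forall>\<^sub>F n in sequentially. real n / real (r n) * prob (exceed 0 (real (N n)) (y * a n))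
        \<le> real n / real (r n) * prob (exceed_all 0 (real (r n) * h) (y * a n))"
      by (intro always_eventually allI mult_left_mono) auto
    have "prob (exceed_all 0 (real (r n) * h) (y * a n)) \<le> prob (exceed 0 (real (Suc (N n))) (y * a n))" for n
      unfolding exceed_all_nat[symmetric]
      by (intro finite_measure_mono exceed_all_mono exceed_all_events N_bounds order_refl) simp
    then show "\<forall>\<^sub>F n in sequentially. real n / real (r n) * prob (exceed_all 0 (real (r n) * h) (y * a n))
        \<le> real n / real (r n) * prob (exceed 0 (real (Suc (N n))) (y * a n))"
      by (intro always_eventually allI mult_left_mono) auto
  qed
qed

lemma exceed_all_UN:
  assumes "0 < n"
  shows "(\<Union>j\<in>{1..n}. exceed_all ((real j - 1) * h) (real j * h) y) = exceed_all 0 (real n * h) y"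
proof
  show "(\<Union>j\<in>{1..n}. exceed_all ((real j - 1) * h) (real j * h) y) \<subseteq> exceed_all 0 (real n * h) y"
  proof
    fix \<omega> assume "\<omega> \<in> (\<Union>j\<in>{1..n}. exceed_all ((real j - 1) * h) (real j * h) y)"
    then obtain j r where jr: "1 \<le> j" "j \<le> n" "\<omega> \<in> space M" "(real j - 1) * h \<le> r" "r \<le> real j * h" "y < V r \<omega>"
      by (auto simp: exceed_all_def)
    have "0 \<le> (real j - 1) * h" "real j * h \<le> real n * h" using jr h_pos by auto
    with jr show "\<omega> \<in> exceed_all 0 (real n * h) y" by (force simp: exceed_all_def)
  qed
  show "exceed_all 0 (real n * h) y \<subseteq> (\<Union>j\<in>{1..n}. exceed_all ((real j - 1) * h) (real j * h) y)"
  proof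
    fix \<omega> assume "\<omega> \<in> exceed_all 0 (real n * h) y"
    then obtain r where r: "\<omega> \<in> space M" "0 \<le> r" "r \<le> real n * h" "y < V r \<omega>"
      by (auto simp: exceed_all_def)
    \<comment> \<open>The maximum with 1 takes care of \<open>r = 0\<close>, whose ceiling 0 is not
      the index of a block; time 0 belongs to the first block.\<close>
    define j where "j = max 1 (nat \<lceil>r / h\<rceil>)"
    have "r / h \<le> real n" using r h_pos by (simp add: pos_divide_le_eq)
    then have j: "1 \<le> j" "j \<le> n" using assms unfolding j_def by linarith+
    have "0 \<le> r / h" using r h_pos by simp
    then have "real j - 1 \<le> r / h" "r / h \<le> real j" unfolding j_def by linarith+
    then have "(real j - 1) * h \<le> r" "r \<le> real j * h"
      using h_pos by (simp_all add: pos_le_divide_eq pos_divide_le_eq)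
    with r j show "\<omega> \<in> (\<Union>j\<in>{1..n}. exceed_all ((real j - 1) * h) (real j * h) y)"
      by (intro UN_I[of j]) (auto simp: exceed_all_def)
  qed
qed

text \<open>The number of blocks \<open>m\<close> and the level index \<open>n\<close> are separate
  arguments, because condition A compares \<open>n\<close> blocks with \<open>r n\<close> blocks at
  the same level \<open>a n\<close>.\<close>

definition laplace_count :: "(ereal \<Rightarrow> real) \<Rightarrow> nat \<Rightarrow> nat \<Rightarrow> real" where
  "laplace_count f m n =
     expectation (\<lambda>\<omega>. exp (- (\<Sum>j=1..m. f (ereal ((SUP t\<in>{(real j - 1) * h..real j * h}. V t \<omega>) / a n)))))"

lemma exp_count_bounds:
  fixes K y :: real and n :: nat
  assumes K: "0 \<le> K" and m: "0 < m"
  defines "f \<equiv> (\<lambda>z. K * indicator {ereal y<..} z)"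
  shows "1 - prob (exceed_all 0 (real m * h) (y * a n)) \<le> laplace_count f m n"
    and "laplace_count f m n \<le> 1 - (1 - exp (- K)) * prob (exceed_all 0 (real m * h) (y * a n))"
proof -
  let ?E = "\<lambda>j. exceed_all ((real j - 1) * h) (real j * h) (y * a n)"
  have st: "0 \<le> (real j - 1) * h" "(real j - 1) * h \<le> real j * h" if "j \<in> {1..m}" for j
    using that h_pos by auto
  have E: "?E j \<in> events" if "j \<in> {1..m}" for j using exceed_all_events st[OF that] .
  have g: "f (ereal ((SUP t\<in>{(real j - 1) * h..real j * h}. V t \<omega>) / a n)) = K * indicator (?E j) \<omega>"
    if j: "j \<in> {1..m}" and \<omega>: "\<omega> \<in> space M" for j \<omega>
  proof -
    have "y < (SUP t\<in>{(real j - 1) * h..real j * h}. V t \<omega>) / a n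
      \<longleftrightarrow> y * a n < (SUP t\<in>{(real j - 1) * h..real j * h}. V t \<omega>)"
      using a_pos[of n] by (simp add: pos_less_divide_eq)
    also have "\<dots> \<longleftrightarrow> \<omega> \<in> ?E j"
      using less_SUP_V_iff[OF \<omega> st[OF j]] \<omega> by (simp add: exceed_all_def)
    finally show ?thesis by (simp add: f_def indicator_def)
  qed
  note b = expectation_exp_count_bounds[where E = ?E and J = "{1..m}" and K = K
      and g = "\<lambda>j \<omega>. f (ereal ((SUP t\<in>{(real j - 1) * h..real j * h}. V t \<omega>) / a n))",
      OF finite_atLeastAtMost E K g]
  show "1 - prob (exceed_all 0 (real m * h) (y * a n)) \<le> laplace_count f m n"
    "laplace_count f m n \<le> 1 - (1 - exp (- K)) * prob (exceed_all 0 (real m * h) (y * a n))"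
    using b unfolding laplace_count_def exceed_all_UN[OF m] by blast+
qed

text \<open>For fixed \<open>K\<close> the Laplace functionals enclose the probabilities: the lower
  estimate loses \<open>exp (- K)\<close> once, over all \<open>n\<close> blocks, and the upper one
  replaces the exceedance probability \<open>p n\<close> of a group of \<open>r n\<close> blocks by
  \<open>(1 - exp (- K)) * p n\<close>. The limit in \<open>n\<close> comes first, then
  \<open>K\<close> is taken large.\<close>

lemma grid_maximum_limit:
  assumes y: "0 < y"
  shows "(\<lambda>n. 1 - prob (exceed_all 0 (real n * h) (y * a n)))
    \<longlonglongrightarrow> exp (- (h * (sup_decrease_mean M \<xi> \<alpha> * y powr (- \<alpha>))))"
proof -
  let ?\<tau> = "h * (sup_decrease_mean M \<xi> \<alpha> * y powr (- \<alpha>))"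
  obtain r where r: "\<And>n. 0 < r n" "filterlim r at_top sequentially" "(\<lambda>n. real (r n) / real n) \<longlonglongrightarrow> 0"
    and ind: "\<And>f. step_fun f \<Longrightarrow>
      (\<lambda>n. laplace_count f n n - laplace_count f (r n) n ^ (n div r n)) \<longlonglongrightarrow> 0"
    using asymp unfolding asymp_indep_def laplace_count_def by blast
  define p where "p n = prob (exceed_all 0 (real (r n) * h) (y * a n))" for n
  define k where "k n = n div r n" for n
  have rpos: "0 < real (r n)" for n using r(1) by simp
  have block: "(\<lambda>n. real n / real (r n) * p n) \<longlonglongrightarrow> ?\<tau>"
    unfolding p_def by (rule block_exceedance_limit[OF y r])
  \<comment> \<open>Rounding \<open>n / r n\<close> down loses less than one group of
    \<open>r n\<close> blocks, which is harmless since \<open>r n / n\<close> tends to 0.\<close>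
  have kr: "(\<lambda>n. real (k n) * (real (r n) / real n)) \<longlonglongrightarrow> 1"
  proof (rule tendsto_sandwich[OF _ _ _ tendsto_const])
    have "(\<lambda>n. 1 - real (r n) / real n) \<longlonglongrightarrow> 1 - 0" by (intro tendsto_intros r)
    then show "(\<lambda>n. 1 - real (r n) / real n) \<longlonglongrightarrow> 1" by simp
    show "\<forall>\<^sub>F n in sequentially. 1 - real (r n) / real n \<le> real (k n) * (real (r n) / real n)"
      using eventually_gt_at_top[of 0]
    proof eventually_elim
      case (elim n)
      have "n mod r n < r n" using r(1) by simp
      then have "n \<le> k n * r n + r n" unfolding k_def using div_mult_mod_eq[of n "r n"] by linarith
      then have "real n \<le> real (k n) * real (r n) + real (r n)"
        by (metis of_nat_add of_nat_le_iff of_nat_mult)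
      then have "real n / real n \<le> (real (k n) * real (r n) + real (r n)) / real n"
        by (intro divide_right_mono) auto
      then show ?case using elim by (simp add: add_divide_distrib)
    qed
    show "\<forall>\<^sub>F n in sequentially. real (k n) * (real (r n) / real n) \<le> 1"
      using eventually_gt_at_top[of 0]
    proof eventually_elim
      case (elim n)
      have "k n * r n \<le> n" unfolding k_def by (rule div_times_less_eq_dividend)
      then have "real (k n) * real (r n) \<le> real n" by (metis of_nat_le_iff of_nat_mult)
      then show ?case using elim by (simp add: field_simps)
    qed
  qed
  have kp: "(\<lambda>n. real (k n) * p n) \<longlonglongrightarrow> ?\<tau>"
  proof -
    have "(\<lambda>n. (real (k n) * (real (r n) / real n)) * (real n / real (r n) * p n)) \<longlonglongrightarrow> 1 * ?\<tau>"
      by (intro tendsto_mult kr block)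
    moreover have "\<forall>\<^sub>F n in sequentially.
      (real (k n) * (real (r n) / real n)) * (real n / real (r n) * p n) = real (k n) * p n"
      using eventually_gt_at_top[of 0]
    proof eventually_elim
      case (elim n)
      then show ?case using rpos[of n] by (simp add: field_simps)
    qed
    ultimately show ?thesis by (simp add: Lim_transform_eventually)
  qed
  have p0: "p \<longlonglongrightarrow> 0"
  proof -
    have "(\<lambda>n. real (r n) / real n * (real n / real (r n) * p n)) \<longlonglongrightarrow> 0 * ?\<tau>"
      by (intro tendsto_mult r block)
    moreover have "\<forall>\<^sub>F n in sequentially. real (r n) / real n * (real n / real (r n) * p n) = p n"
      using eventually_gt_at_top[of 0]
    proof eventually_elim
      case (elim n)
      then show ?case using rpos[of n] by (simp add: field_simps)
    qed
    ultimately show ?thesis by (simp add: Lim_transform_eventually)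
  qed
  have p_bounds: "0 \<le> p n" "p n \<le> 1" for n by (simp_all add: p_def)
  have pow: "(\<lambda>n. (1 - c * p n) ^ k n) \<longlonglongrightarrow> exp (- (c * ?\<tau>))" if "0 \<le> c" for c
  proof (rule power_one_minus_tendsto)
    show "(\<lambda>n. c * p n) \<longlonglongrightarrow> 0" using tendsto_mult[OF tendsto_const[of c] p0] by simp
    show "(\<lambda>n. real (k n) * (c * p n)) \<longlonglongrightarrow> c * ?\<tau>"
      using tendsto_mult[OF tendsto_const[of c] kp] by (simp add: mult_ac)
  qed (use that p_bounds in auto)
  define P where "P n = 1 - prob (exceed_all 0 (real n * h) (y * a n))" for n
  define d where "d K n = laplace_count (\<lambda>z. K * indicator {ereal y<..} z) n n
        - laplace_count (\<lambda>z. K * indicator {ereal y<..} z) (r n) n ^ k n"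
    for K :: real and n
  have d: "d K \<longlonglongrightarrow> 0" if "0 \<le> K" for K
    unfolding d_def k_def by (rule ind[OF step_fun_threshold[OF that y]])
  have upper: "P n \<le> d K n + (1 - (1 - exp (- K)) * p n) ^ k n"
    and lower: "d K n + (1 - p n) ^ k n - exp (- K) \<le> P n" if K: "0 \<le> K" and n: "0 < n" for K n
  proof -
    let ?e = "laplace_count (\<lambda>z. K * indicator {ereal y<..} z) (r n) n"
    have e: "1 - p n \<le> ?e" "?e \<le> 1 - (1 - exp (- K)) * p n"
      unfolding p_def by (rule exp_count_bounds[OF K r(1)])+
    have "0 \<le> ?e" using e(1) p_bounds[of n] by linarith
    then have e_pow: "?e ^ k n \<le> (1 - (1 - exp (- K)) * p n) ^ k n" using e(2) by (intro power_mono) auto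
    have pow_e: "(1 - p n) ^ k n \<le> ?e ^ k n" using e(1) p_bounds by (intro power_mono) auto
    have 1: "P n \<le> d K n + ?e ^ k n"
      using exp_count_bounds(1)[OF K n, of y n] by (simp add: d_def P_def)
    have "d K n + ?e ^ k n \<le> 1 - (1 - exp (- K)) * prob (exceed_all 0 (real n * h) (y * a n))"
      using exp_count_bounds(2)[OF K n, of y n] by (simp add: d_def)
    also have "\<dots> = P n + exp (- K) * prob (exceed_all 0 (real n * h) (y * a n))"
      by (simp add: P_def algebra_simps)
    also have "\<dots> \<le> P n + exp (- K) * 1"
      by (intro add_left_mono mult_left_mono) auto
    finally have 2: "d K n + ?e ^ k n \<le> P n + exp (- K)" by simp
    show "P n \<le> d K n + (1 - (1 - exp (- K)) * p n) ^ k n" using 1 e_pow by linarith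
    show "d K n + (1 - p n) ^ k n - exp (- K) \<le> P n" using 2 pow_e by linarith
  qed
  have Klim: "((\<lambda>K::real. exp (- K)) \<longlongrightarrow> 0) at_top"
    by (rule filterlim_compose[OF exp_at_bot filterlim_uminus_at_bot_at_top])
  have "P \<longlonglongrightarrow> exp (- ?\<tau>)"
  proof (rule order_tendstoI)
    fix l
    { assume l: "l < exp (- ?\<tau>)"
      have "((\<lambda>K. exp (- ?\<tau>) - exp (- K)) \<longlongrightarrow> exp (- ?\<tau>) - 0) at_top"
        by (intro tendsto_diff tendsto_const Klim)
      then have "\<forall>\<^sub>F K in at_top. l < exp (- ?\<tau>) - exp (- K)"
        by (rule order_tendstoD) (use l in simp)
      from eventually_happens[OF eventually_conj[OF this eventually_ge_at_top[of 0]]]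
      obtain K where K: "l < exp (- ?\<tau>) - exp (- K)" "0 \<le> K" by auto
      have "(\<lambda>n. d K n + (1 - 1 * p n) ^ k n - exp (- K)) \<longlonglongrightarrow> 0 + exp (- (1 * ?\<tau>)) - exp (- K)"
        by (intro tendsto_diff tendsto_add d K pow tendsto_const) simp
      then have "\<forall>\<^sub>F n in sequentially. l < d K n + (1 - 1 * p n) ^ k n - exp (- K)"
        by (rule order_tendstoD) (use K in simp)
      then show "\<forall>\<^sub>F n in sequentially. l < P n"
        using eventually_gt_at_top[of 0]
      proof eventually_elim
        case (elim n)
        then show ?case using lower[OF K(2), of n] by simp
      qed }
    { assume l: "exp (- ?\<tau>) < l"
      have "((\<lambda>K. exp (- ((1 - exp (- K)) * ?\<tau>))) \<longlongrightarrow> exp (- ((1 - 0) * ?\<tau>))) at_top"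
        by (intro tendsto_intros Klim)
      then have "\<forall>\<^sub>F K in at_top. exp (- ((1 - exp (- K)) * ?\<tau>)) < l"
        by (rule order_tendstoD) (use l in simp)
      from eventually_happens[OF eventually_conj[OF this eventually_ge_at_top[of 0]]]
      obtain K where K: "exp (- ((1 - exp (- K)) * ?\<tau>)) < l" "0 \<le> K" by auto
      have "(\<lambda>n. d K n + (1 - (1 - exp (- K)) * p n) ^ k n) \<longlonglongrightarrow> 0 + exp (- ((1 - exp (- K)) * ?\<tau>))"
        using K by (intro tendsto_add d pow) auto
      then have "\<forall>\<^sub>F n in sequentially. d K n + (1 - (1 - exp (- K)) * p n) ^ k n < l"
        by (rule order_tendstoD) (use K in simp)
      then show "\<forall>\<^sub>F n in sequentially. P n < l"
        using eventually_gt_at_top[of 0]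
      proof eventually_elim
        case (elim n)
        then show ?case using upper[OF K(2), of n] by simp
      qed }
  qed
  then show ?thesis unfolding P_def .
qed

text \<open>The interval \<open>[0, n]\<close> lies between \<open>j n\<close> and
  \<open>Suc (j n)\<close> blocks. The level \<open>x * a n\<close> is no fixed multiple of
  \<open>a (j n)\<close>, but their ratio tends to \<open>y0\<close>; hence every
  \<open>y > y0\<close> gives a bound from one side and, with \<open>Suc (j n)\<close>, every
  \<open>y < y0\<close> one from the other. Continuity in \<open>y\<close> closes the gap.\<close>

lemma maximum_limit:
  assumes x: "0 < x"
  shows "(\<lambda>n. 1 - prob (exceed_all 0 (real n) (x * a n)))
    \<longlonglongrightarrow> exp (- sup_decrease_mean M \<xi> \<alpha> * x powr (- \<alpha>))"
proof -
  let ?\<theta> = "sup_decrease_mean M \<xi> \<alpha>"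
  \<comment> \<open>Chosen so that \<open>y0 powr (- \<alpha>)\<close> equals
    \<open>x powr (- \<alpha>) / h\<close>, which removes the block length from the
    exponent.\<close>
  define y0 where "y0 = x * h powr (1 / \<alpha>)"
  have y0: "0 < y0" using x h_pos by (simp add: y0_def)
  define \<phi> where "\<phi> y = exp (- (h * (?\<theta> * y powr (- \<alpha>))))" for y
  have \<phi>_y0: "\<phi> y0 = exp (- ?\<theta> * x powr (- \<alpha>))"
  proof -
    have "y0 powr (- \<alpha>) = x powr (- \<alpha>) * inverse h"
      unfolding y0_def using x h_pos \<alpha>_pos by (simp add: powr_mult powr_powr powr_minus)
    then show ?thesis using h_pos by (simp add: \<phi>_def)
  qed
  have \<phi>_cont: "(\<phi> \<longlongrightarrow> \<phi> y0) (at y0)"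
    unfolding \<phi>_def using y0 by (intro tendsto_intros) auto
  define j where "j n = nat \<lfloor>real n / h\<rfloor>" for n
  have j_bounds: "real (j n) * h \<le> real n" "real n \<le> real (Suc (j n)) * h" for n
  proof -
    have "0 \<le> real n / h" using h_pos by simp
    then have "real (j n) \<le> real n / h" "real n / h \<le> real (Suc (j n))" unfolding j_def by linarith+
    then show "real (j n) * h \<le> real n" "real n \<le> real (Suc (j n)) * h"
      using h_pos by (simp_all add: pos_le_divide_eq pos_divide_le_eq del: of_nat_Suc)
  qed
  have nh: "filterlim (\<lambda>n. real n / h) at_top sequentially"
    using filterlim_tendsto_pos_mult_at_top[OF tendsto_const[of "inverse h"] _ filterlim_real_sequentially] h_pos
    by (simp add: divide_inverse mult.commute)
  have j_top: "filterlim j at_top sequentially"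
    unfolding j_def
    by (intro filterlim_compose[OF filterlim_nat_sequentially] filterlim_compose[OF filterlim_floor_sequentially] nh)
  have Sj_top: "filterlim (\<lambda>n. Suc (j n)) at_top sequentially"
    by (rule filterlim_compose[OF filterlim_Suc j_top])
  have ratio: "(\<lambda>n. real n / real (m n)) \<longlonglongrightarrow> h"
    if m: "filterlim m at_top sequentially" "\<And>n. real (m n) * h \<le> real n + h" "\<And>n. real n \<le> (real (m n) + 1) * h"
    for m :: "nat \<Rightarrow> nat"
  proof (rule tendsto_sandwich)
    have inv: "(\<lambda>n. inverse (real (m n))) \<longlonglongrightarrow> 0"
      by (intro tendsto_inverse_0_at_top filterlim_compose[OF filterlim_real_sequentially m(1)])
    have pos: "\<forall>\<^sub>F n in sequentially. 0 < real (m n)"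
      using filterlim_at_top_dense[THEN iffD1, OF filterlim_compose[OF filterlim_real_sequentially m(1)], rule_format] .
    have "(\<lambda>n. h - h * inverse (real (m n))) \<longlonglongrightarrow> h - h * 0" "(\<lambda>n. h + h * inverse (real (m n))) \<longlonglongrightarrow> h + h * 0"
      by (intro tendsto_intros inv)+
    then show "(\<lambda>n. h - h * inverse (real (m n))) \<longlonglongrightarrow> h" "(\<lambda>n. h + h * inverse (real (m n))) \<longlonglongrightarrow> h" by simp_all
    show "\<forall>\<^sub>F n in sequentially. h - h * inverse (real (m n)) \<le> real n / real (m n)"
      using pos
    proof eventually_elim
      case (elim n)
      have "(real (m n) * h - h) / real (m n) \<le> real n / real (m n)"
        using m(2)[of n] elim by (intro divide_right_mono) auto
      moreover have "(real (m n) * h - h) / real (m n) = h - h * inverse (real (m n))"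
        using elim by (simp add: field_simps)
      ultimately show ?case by simp
    qed
    show "\<forall>\<^sub>F n in sequentially. real n / real (m n) \<le> h + h * inverse (real (m n))"
      using pos
    proof eventually_elim
      case (elim n)
      have "real n / real (m n) \<le> (real (m n) + 1) * h / real (m n)"
        using m(3)[of n] elim by (intro divide_right_mono) auto
      also have "\<dots> = h + h * inverse (real (m n))"
        using elim by (simp add: field_simps)
      finally show ?case .
    qed
  qed
  have ratio_j: "(\<lambda>n. x * (a n / a (m n))) \<longlonglongrightarrow> y0"
    if m: "filterlim m at_top sequentially" "\<And>n. real (m n) * h \<le> real n + h" "\<And>n. real n \<le> (real (m n) + 1) * h"
    for m :: "nat \<Rightarrow> nat"
    unfolding y0_def by (intro tendsto_mult tendsto_const a_ratio_limit m ratio)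
  have j_lim: "(\<lambda>n. x * (a n / a (j n))) \<longlonglongrightarrow> y0"
  proof (rule ratio_j[OF j_top])
    show "real (j n) * h \<le> real n + h" for n using j_bounds(1)[of n] h_pos by simp
    show "real n \<le> (real (j n) + 1) * h" for n using j_bounds(2)[of n] by (simp add: add.commute)
  qed
  have Sj_lim: "(\<lambda>n. x * (a n / a (Suc (j n)))) \<longlonglongrightarrow> y0"
  proof (rule ratio_j[OF Sj_top])
    show "real (Suc (j n)) * h \<le> real n + h" for n using j_bounds(1)[of n] by (simp add: algebra_simps)
    show "real n \<le> (real (Suc (j n)) + 1) * h" for n
      using j_bounds(2)[of n] h_pos by (simp add: algebra_simps)
  qed
  show ?thesis
    unfolding \<phi>_y0[symmetric]
  proof (rule order_tendstoI)
    fix l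
    { assume "\<phi> y0 < l"
      then have "\<forall>\<^sub>F y in at_right y0. \<phi> y < l"
        by (rule order_tendstoD(2)[OF tendsto_within_subset[OF \<phi>_cont subset_UNIV]])
      from eventually_happens[OF eventually_conj[OF this eventually_at_right_less]]
      obtain y where y: "\<phi> y < l" "y0 < y" by auto
      have ypos: "0 < y" using y y0 by simp
      have "(\<lambda>n. 1 - prob (exceed_all 0 (real (j n) * h) (y * a (j n)))) \<longlonglongrightarrow> \<phi> y"
        unfolding \<phi>_def by (rule filterlim_compose[OF grid_maximum_limit[OF ypos] j_top])
      then have "\<forall>\<^sub>F n in sequentially. 1 - prob (exceed_all 0 (real (j n) * h) (y * a (j n))) < l"
        using y(1) by (rule order_tendstoD)
      then show "\<forall>\<^sub>F n in sequentially. 1 - prob (exceed_all 0 (real n) (x * a n)) < l"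
        using order_tendstoD(2)[OF j_lim y(2)]
      proof eventually_elim
        case (elim n)
        have "x * a n \<le> y * a (j n)" using elim(2) a_pos[of "j n"] by (simp add: field_simps)
        then have "prob (exceed_all 0 (real (j n) * h) (y * a (j n))) \<le> prob (exceed_all 0 (real n) (x * a n))"
          by (intro finite_measure_mono exceed_all_mono exceed_all_events j_bounds) auto
        with elim(1) show ?case by linarith
      qed }
    { assume "l < \<phi> y0"
      then have "\<forall>\<^sub>F y in at_left y0. l < \<phi> y"
        by (rule order_tendstoD(1)[OF tendsto_within_subset[OF \<phi>_cont subset_UNIV]])
      from eventually_happens[OF eventually_conj[OF this eventually_at_left_real[OF y0]]]
      obtain y where y: "l < \<phi> y" "0 < y" "y < y0" by auto
      have "(\<lambda>n. 1 - prob (exceed_all 0 (real (Suc (j n)) * h) (y * a (Suc (j n))))) \<longlonglongrightarrow> \<phi> y"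
        unfolding \<phi>_def by (rule filterlim_compose[OF grid_maximum_limit[OF y(2)] Sj_top])
      then have "\<forall>\<^sub>F n in sequentially. l < 1 - prob (exceed_all 0 (real (Suc (j n)) * h) (y * a (Suc (j n))))"
        using y(1) by (rule order_tendstoD)
      then show "\<forall>\<^sub>F n in sequentially. l < 1 - prob (exceed_all 0 (real n) (x * a n))"
        using order_tendstoD(1)[OF Sj_lim y(3)]
      proof eventually_elim
        case (elim n)
        have "y * a (Suc (j n)) \<le> x * a n" using elim(2) a_pos[of "Suc (j n)"] by (simp add: field_simps)
        then have "prob (exceed_all 0 (real n) (x * a n)) \<le> prob (exceed_all 0 (real (Suc (j n)) * h) (y * a (Suc (j n))))"
          using h_pos by (intro finite_measure_mono exceed_all_mono exceed_all_events j_bounds) auto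
        with elim(1) show ?case by linarith
      qed }
  qed
qed

lemma prob_maximum:
  "prob {\<omega> \<in> space M. inverse (a n) * (SUP t\<in>{0..real n}. V t \<omega>) \<le> x} = 1 - prob (exceed_all 0 (real n) (x * a n))"
proof -
  have "{\<omega> \<in> space M. inverse (a n) * (SUP t\<in>{0..real n}. V t \<omega>) \<le> x} = space M - exceed_all 0 (real n) (x * a n)"
  proof (intro equalityI subsetI)
    have iff: "inverse (a n) * (SUP t\<in>{0..real n}. V t \<omega>) \<le> x \<longleftrightarrow> \<omega> \<notin> exceed_all 0 (real n) (x * a n)"
      if \<omega>: "\<omega> \<in> space M" for \<omega>
    proof -
      have "inverse (a n) * (SUP t\<in>{0..real n}. V t \<omega>) \<le> x \<longleftrightarrow> \<not> x * a n < (SUP t\<in>{0..real n}. V t \<omega>)"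
        using a_pos[of n] by (simp add: field_simps not_less)
      also have "\<dots> \<longleftrightarrow> \<omega> \<notin> exceed_all 0 (real n) (x * a n)"
        using less_SUP_V_iff[OF \<omega>, of 0 "real n"] \<omega> by (simp add: exceed_all_def)
      finally show ?thesis .
    qed
    fix \<omega>
    show "\<omega> \<in> space M - exceed_all 0 (real n) (x * a n)"
      if "\<omega> \<in> {\<omega> \<in> space M. inverse (a n) * (SUP t\<in>{0..real n}. V t \<omega>) \<le> x}" using that iff by blast
    show "\<omega> \<in> {\<omega> \<in> space M. inverse (a n) * (SUP t\<in>{0..real n}. V t \<omega>) \<le> x}"
      if "\<omega> \<in> space M - exceed_all 0 (real n) (x * a n)" using that iff by blast
  qed
  then show ?thesis
    using prob_compl[OF exceed_all_events[of 0 "real n" "x * a n"]] by simp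
qed

end

section \<open>Tail constant and unit moment from the hypotheses, and the limit law\<close>

theorem proposition4p2:
  fixes M :: "'a measure"
    and \<xi> \<eta> L V :: "real \<Rightarrow> 'a \<Rightarrow> real"
    and a :: "nat \<Rightarrow> real"
    and \<alpha> h x :: real
  assumes "prob_space M"
    and "levy_process M (\<lambda>t \<omega>. (\<xi> t \<omega>, \<eta> t \<omega>, L t \<omega>))"
    and "prob_space.indep_set M
           (sets (vimage_algebra (space M) (\<lambda>\<omega>. \<lambda>t\<in>{0..}. (\<xi> t \<omega>, \<eta> t \<omega>, L t \<omega>))
                    (PiM {0..} (\<lambda>_. borel))))
           (sets (vimage_algebra (space M) (V 0) borel))"
    and "subordinator M \<eta>"
    and "\<not> subordinator M (\<lambda>t \<omega>. - L t \<omega>)"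
    and "0 < \<alpha>"
    and "tail_condition M \<xi> \<eta> V \<alpha>"
    and "moment_condition M \<xi> \<eta> \<alpha>"
    and "\<And>n. 0 < a n"
    and "incseq a"
    and "filterlim a at_top sequentially"
    and "\<And>y. 0 < y \<Longrightarrow>
           (\<lambda>n. real n * measure M {\<omega> \<in> space M. V 0 \<omega> > a n * y}) \<longlonglongrightarrow> y powr (- \<alpha>)"
    and "0 < h"
    and "asymp_indep M (\<lambda>k \<omega>. SUP t\<in>{(real k - 1) * h..real k * h}. V t \<omega>) a"
    and "0 < x"
  shows "(\<lambda>n. measure M {\<omega> \<in> space M. inverse (a n) * (SUP t\<in>{0..real n}. V t \<omega>) \<le> x})
           \<longlonglongrightarrow> exp (- sup_decrease_mean M \<xi> \<alpha> * x powr (- \<alpha>))"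
proof -
  interpret P: prob_space M by fact
  interpret G: gou M \<xi> \<eta> L V \<alpha>
    using assms(2-4,7) by unfold_locales
  obtain C where C: "0 < C" and equiv: "(\<lambda>y. measure M {\<omega> \<in> space M. V 0 \<omega> > y}) \<sim>[at_top] (\<lambda>y. C * y powr (- \<alpha>))"
    using assms(7) by (auto simp: tail_condition_def)
  \<comment> \<open>Asymptotic equivalence assigns the quotient 1 where both sides vanish; as
    \<open>C * y powr (- \<alpha>)\<close> is positive for \<open>y > 0\<close>, only the plain
    quotient occurs for large \<open>y\<close>.\<close>
  have nz: "\<forall>\<^sub>F y in at_top. measure M {\<omega> \<in> space M. V 0 \<omega> > y} \<noteq> 0 \<or> C * y powr (- \<alpha>) \<noteq> 0"
    using eventually_gt_at_top[of 0] by eventually_elim (use C in simp)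
  have "((\<lambda>y. C * (measure M {\<omega> \<in> space M. V 0 \<omega> > y} / (C * y powr (- \<alpha>)))) \<longlongrightarrow> C * 1) at_top"
    by (intro tendsto_mult tendsto_const asymp_equivD_strong[OF equiv nz])
  then have tail: "((\<lambda>y. y powr \<alpha> * measure M {\<omega> \<in> space M. V 0 \<omega> > y}) \<longlongrightarrow> C) at_top"
    using C by (simp add: powr_minus field_simps)
  have "Psi M \<xi> \<alpha> = 0" using assms(8) by (auto simp: moment_condition_def)
  then have int: "integrable M (\<lambda>\<omega>. exp (- \<alpha> * \<xi> 1 \<omega>))" and ln: "ln (\<integral>\<omega>. exp (- \<alpha> * \<xi> 1 \<omega>) \<partial>M) = 0"
    by (auto simp: Psi_def split: if_splits)
  \<comment> \<open>A vanishing logarithm yields the value 1 only for a positive argument. The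
    integral of a positive function over a probability space cannot be 0.\<close>
  have "0 < (\<integral>\<omega>. exp (- \<alpha> * \<xi> 1 \<omega>) \<partial>M)"
  proof (rule ccontr)
    assume "\<not> 0 < (\<integral>\<omega>. exp (- \<alpha> * \<xi> 1 \<omega>) \<partial>M)"
    moreover have "0 \<le> (\<integral>\<omega>. exp (- \<alpha> * \<xi> 1 \<omega>) \<partial>M)"
      by (rule Bochner_Integration.integral_nonneg) simp
    ultimately have "(\<integral>\<omega>. exp (- \<alpha> * \<xi> 1 \<omega>) \<partial>M) = 0" by linarith
    then have "AE \<omega> in M. exp (- \<alpha> * \<xi> 1 \<omega>) = 0"
      using integral_nonneg_eq_0_iff_AE[OF int] by simp
    then show False by simp
  qed
  then have "(\<integral>\<omega>. exp (- \<alpha> * \<xi> 1 \<omega>) \<partial>M) = 1" using ln by (simp add: ln_eq_zero_iff)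
  then have mom: "(\<integral>\<^sup>+\<omega>. ennreal (exp (- \<alpha> * \<xi> 1 \<omega>)) \<partial>M) = 1"
    using nn_integral_eq_integral[OF int] by simp
  interpret E: gou_extremes M \<xi> \<eta> L V \<alpha> C a h
    using C tail mom assms(9,11-14) by unfold_locales
  show ?thesis
    unfolding E.prob_maximum by (rule E.maximum_limit) fact
qed

end
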